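(* Every curve-irreducible, nonlinear, and conjugate-to-linear self-conformal measure in $\mathbb{C}$ has polynomial Fourier decay.
   Context: Conformal IFS on $\mathbb{C}$: let $\Omega\subset D\subset U\subset\mathbb{C}$ where $\Omega$ is open, convex and non-empty, $D=\overline{\Omega}$, and $U$ is open, convex and bounded. Let $\varphi_1,\dotsc,\varphi_N\colon U\to\mathbb{C}$ be injective conformal maps (i.e. holomorphic with non-vanishing complex derivative) satisfying $\overline{\varphi_i(U)}\subset U$ and $\varphi_i(D)\subset\Omega$ for each $i$, with $$0<\inf\{|\varphi_i'(z)|:z\in U,\,1\leq i\leq N\}\leq\sup\{|\varphi_i'(z)|:z\in U,\,1\leq i\leq N\}<1,$$ and assume that $\varphi_1,\dotsc,\varphi_N$ do not share a common fixed point. Then $\Phi=\{\varphi_1,\dotsc,\varphi_N\}$ is called a conformal IFS. The self-conformal set is the unique non-empty compact $K\subseteq D$ with $K=\bigcup_i\varphi_i(K)$. For $p_1,\dotsc,p_N\in(0,1)$ with $\sum_ip_i=1$, the self-conformal measure is the unique Borel probability measure $\nu$ with $\nu=\sum_ip_i\,\nu_{\varphi_i}$, where $\nu_{\varphi_i}(B)=\nu(\varphi_i^{-1}(B))$. No separation condition is assumed. Nonlinear: $\Phi$ and $\nu$ are nonlinear if there exists $i$ such that $\varphi_i$ is non-affine. Analytic curve: a non-empty set $\Gamma\subset\mathbb{C}$ is an analytic curve if it is an embedded 1-dimensional real-analytic submanifold of $\mathbb{C}$, i.e. for each $z_0\in\Gamma$ there exist an open set $W\subset\mathbb{C}$ with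 $z_0\in W$ and a map $\gamma\colon(0,1)\to\mathbb{C}$ with real-analytic real and imaginary parts, such that $\gamma$ is a homeomorphism from $(0,1)$ onto $\Gamma\cap W$ and $\gamma'(t)\neq0$ for all $t\in(0,1)$. Curve-irreducible: $\Phi$ and $\nu$ are curve-reducible if there is an analytic curve $\Gamma$ (in the domain of the maps) such that $\varphi_i(\Gamma)\subseteq\Gamma$ for each $i$, and curve-irreducible otherwise. Conjugate to linear: $\Phi=\{\varphi_i\}_{i\in I}$ (and $\nu$) is conjugate to linear if there exist a self-similar IFS $\{\psi_i\}_{i\in I}$ on $\mathbb{C}\cong\mathbb{R}^2$ (contracting similarities $\psi_i(\mathbf{x})=r_iO_i\mathbf{x}+\mathbf{t}_i$ with $r_i\in(0,1)$, $O_i\in O_2(\mathbb{R})$) and a holomorphic diffeomorphism $f$ from an open neighbourhood of the self-similar set (the attractor of $\{\psi_i\}$) to an open neighbourhood of the self-conformal set, such that $\varphi_i=f\circ\psi_i\circ f^{-1}$ for all $i\in I$. Polynomial Fourier decay: identifying $\mathbb{C}$ with $\mathbb{R}^2$, $\widehat{\nu}(\boldsymbol{\xi})=\int e^{-2\pi i\langle\boldsymbol{\xi},\mathbf{x}\rangle}\,d\nu(\mathbf{x})$, and $\nu$ has polynomial Fourier decay if there are $\sigma,c>0$ with $|\widehat{\nu}(\boldsymbol{\xi})|\leq c|\boldsymbol{\xi}|^{-\sigma}$ for all $\boldsymbol{\xi}\neq\mathbf{0}$. *)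

theory Defs
  imports "HOL-Probability.Probability" "HOL-Complex_Analysis.Complex_Analysis"
begin

section \<open>Iterated function systems and self-conformal measures\<close>

text \<open>
  Partial maps are rendered as total functions that are only ever inspected on their domain: the
  maps of an IFS are \<open>\<phi> 1, \<dots>, \<phi> N\<close>, and for a conformal IFS only their restrictions to \<open>U\<close> matter.
  The closed set \<open>D\<close> is \<open>closure \<Omega>\<close>.  The supremum of an unbounded set of reals carries no information
  in HOL, hence the explicit \<open>bdd_above\<close>.
\<close>

definition conformal_IFS :: "complex set \<Rightarrow> complex set \<Rightarrow> nat \<Rightarrow> (nat \<Rightarrow> complex \<Rightarrow> complex) \<Rightarrow> bool" where
  "conformal_IFS U \<Omega> N \<phi> \<longleftrightarrow>
     open \<Omega> \<and> convex \<Omega> \<and> \<Omega> \<noteq> {} \<and> closure \<Omega> \<subseteq> U \<and>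
     open U \<and> convex U \<and> bounded U \<and>
     (\<forall>i\<in>{1..N}.
        inj_on (\<phi> i) U \<and> \<phi> i holomorphic_on U \<and> (\<forall>z\<in>U. deriv (\<phi> i) z \<noteq> 0) \<and>
        closure (\<phi> i ` U) \<subseteq> U \<and> \<phi> i ` closure \<Omega> \<subseteq> \<Omega>) \<and>
     0 < Inf {cmod (deriv (\<phi> i) z) | z i. z \<in> U \<and> i \<in> {1..N}} \<and>
     bdd_above {cmod (deriv (\<phi> i) z) | z i. z \<in> U \<and> i \<in> {1..N}} \<and>
     Sup {cmod (deriv (\<phi> i) z) | z i. z \<in> U \<and> i \<in> {1..N}} < 1 \<and>
     \<not> (\<exists>z\<in>U. \<forall>i\<in>{1..N}. \<phi> i z = z)"

definition invariant_compact :: "nat \<Rightarrow> (nat \<Rightarrow> complex \<Rightarrow> complex) \<Rightarrow> complex set \<Rightarrow> bool" where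
  "invariant_compact N \<phi> K \<longleftrightarrow> compact K \<and> K \<noteq> {} \<and> K = (\<Union>i\<in>{1..N}. \<phi> i ` K)"

definition self_conformal_set ::
    "complex set \<Rightarrow> nat \<Rightarrow> (nat \<Rightarrow> complex \<Rightarrow> complex) \<Rightarrow> complex set \<Rightarrow> bool" where
  "self_conformal_set \<Omega> N \<phi> K \<longleftrightarrow> invariant_compact N \<phi> K \<and> K \<subseteq> closure \<Omega>"

definition probability_vector :: "nat \<Rightarrow> (nat \<Rightarrow> real) \<Rightarrow> bool" where
  "probability_vector N p \<longleftrightarrow> (\<forall>i\<in>{1..N}. 0 < p i \<and> p i < 1) \<and> (\<Sum>i=1..N. p i) = 1"

text \<open>
  The set \<open>\<phi> i -` B \<inter> U\<close> is the preimage of \<open>B\<close> under the map \<open>\<phi> i\<close> with domain \<open>U\<close>.  Taking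
  \<open>B = UNIV\<close> shows that such a \<open>\<nu>\<close> is concentrated on \<open>U\<close>.
\<close>

definition self_conformal_measure ::
    "complex set \<Rightarrow> nat \<Rightarrow> (nat \<Rightarrow> complex \<Rightarrow> complex) \<Rightarrow> (nat \<Rightarrow> real) \<Rightarrow> complex measure \<Rightarrow> bool" where
  "self_conformal_measure U N \<phi> p \<nu> \<longleftrightarrow>
     prob_space \<nu> \<and> sets \<nu> = sets borel \<and>
     (\<forall>B\<in>sets borel. measure \<nu> B = (\<Sum>i=1..N. p i * measure \<nu> (\<phi> i -` B \<inter> U)))"

definition nonlinear_IFS :: "complex set \<Rightarrow> nat \<Rightarrow> (nat \<Rightarrow> complex \<Rightarrow> complex) \<Rightarrow> bool" where
  "nonlinear_IFS U N \<phi> \<longleftrightarrow> (\<exists>i\<in>{1..N}. \<not> (\<exists>a b. \<forall>z\<in>U. \<phi> i z = a * z + b))"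


section \<open>Analytic curves and curve-irreducibility\<close>

definition real_analytic_on :: "(real \<Rightarrow> real) \<Rightarrow> real set \<Rightarrow> bool" (infix "real'_analytic'_on" 50) where
  "h real_analytic_on S \<longleftrightarrow>
     (\<forall>t0\<in>S. \<exists>r>0. \<exists>a. \<forall>t. \<bar>t - t0\<bar> < r \<longrightarrow> (\<lambda>n. a n * (t - t0) ^ n) sums h t)"

definition analytic_curve :: "complex set \<Rightarrow> bool" where
  "analytic_curve \<Gamma> \<longleftrightarrow>
     \<Gamma> \<noteq> {} \<and>
     (\<forall>z0\<in>\<Gamma>. \<exists>W \<gamma>. open W \<and> z0 \<in> W \<and>
        (\<lambda>t. Re (\<gamma> t)) real_analytic_on {0<..<1} \<and>
        (\<lambda>t. Im (\<gamma> t)) real_analytic_on {0<..<1} \<and>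
        (\<exists>g. homeomorphism {0<..<1} (\<Gamma> \<inter> W) \<gamma> g) \<and>
        (\<forall>t\<in>{0<..<1}. vector_derivative \<gamma> (at t) \<noteq> 0))"

definition curve_reducible :: "complex set \<Rightarrow> nat \<Rightarrow> (nat \<Rightarrow> complex \<Rightarrow> complex) \<Rightarrow> bool" where
  "curve_reducible U N \<phi> \<longleftrightarrow>
     (\<exists>\<Gamma>. analytic_curve \<Gamma> \<and> \<Gamma> \<subseteq> U \<and> (\<forall>i\<in>{1..N}. \<phi> i ` \<Gamma> \<subseteq> \<Gamma>))"


section \<open>Conjugacy to a self-similar IFS\<close>

definition contracting_similarity :: "(complex \<Rightarrow> complex) \<Rightarrow> bool" where
  "contracting_similarity \<psi> \<longleftrightarrow>
     (\<exists>r T t. 0 < r \<and> r < 1 \<and> orthogonal_transformation T \<and> (\<forall>x. \<psi> x = r *\<^sub>R T x + t))"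

text \<open>
  The identity \<open>\<phi> i = f \<circ> \<psi> i \<circ> f\<inverse>\<close> is required at each point of \<open>V'\<close> at which the composition of
  partial maps is defined, the domain of \<open>f\<close> being \<open>V\<close>.  Since each \<open>\<psi> i\<close> maps the attractor \<open>L\<close> into
  itself and contracts, replacing \<open>V\<close> by a small metric neighbourhood of \<open>L\<close> yields an equivalent
  definition in which \<open>\<psi> i ` V \<subseteq> V\<close> and the identity holds on all of \<open>V'\<close>.  The sets \<open>K\<close> and \<open>L\<close> are
  uniquely determined by the two systems.
\<close>

definition conjugate_to_linear ::
    "complex set \<Rightarrow> complex set \<Rightarrow> nat \<Rightarrow> (nat \<Rightarrow> complex \<Rightarrow> complex) \<Rightarrow> bool" where
  "conjugate_to_linear U \<Omega> N \<phi> \<longleftrightarrow>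
     (\<exists>\<psi> L K V V' f.
        (\<forall>i\<in>{1..N}. contracting_similarity (\<psi> i)) \<and>
        invariant_compact N \<psi> L \<and> self_conformal_set \<Omega> N \<phi> K \<and>
        open V \<and> L \<subseteq> V \<and> open V' \<and> K \<subseteq> V' \<and> V' \<subseteq> U \<and>
        bij_betw f V V' \<and> f holomorphic_on V \<and> inv_into V f holomorphic_on V' \<and>
        (\<forall>i\<in>{1..N}. \<forall>z\<in>V'. \<psi> i (inv_into V f z) \<in> V \<longrightarrow> \<phi> i z = f (\<psi> i (inv_into V f z))))"


section \<open>Fourier decay\<close>

definition fourier_transform :: "complex measure \<Rightarrow> complex \<Rightarrow> complex" where
  "fourier_transform \<nu> \<xi> = (LINT x|\<nu>. exp (- 2 * complex_of_real pi * \<i> * complex_of_real (inner \<xi> x)))"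

definition polynomial_Fourier_decay :: "complex measure \<Rightarrow> bool" where
  "polynomial_Fourier_decay \<nu> \<longleftrightarrow>
     (\<exists>\<sigma>>0. \<exists>c>0. \<forall>\<xi>. \<xi> \<noteq> 0 \<longrightarrow> cmod (fourier_transform \<nu> \<xi>) \<le> c * cmod \<xi> powr (- \<sigma>))"

end

theory Submission
  imports Defs "HOL-Computational_Algebra.Fundamental_Theorem_Algebra"
begin

text \<open>
  Pulling \<open>\<nu>\<close> back by the conjugacy \<open>f\<close> gives a self-similar measure \<open>\<mu>\<close> for maps \<open>x \<mapsto> a\<^sub>i x + t\<^sub>i\<close>, which
  are complex linear because they are holomorphic near the attractor.  Subdividing \<open>\<mu>\<close> into pieces of
  diameter \<open>\<bar>\<xi>\<bar> powr (- 2 / 3)\<close> and linearising \<open>f\<close> on each of them bounds the Fourier transform of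
  \<open>\<nu>\<close> at \<open>\<xi>\<close> by averages of \<open>F (\<eta> f'(x))\<close> over \<open>\<mu>\<close>, where \<open>F\<close> is the modulus of the Fourier transform of \<open>\<mu>\<close>.

  Since the linear parts commute, words of length three with equal linear part and different translations
  (such as \<open>ijk\<close> and \<open>jik\<close>) make \<open>F\<close> decay along a multiplicative random walk of frequencies, except when
  the frequency is close to a lattice.  Curve irreducibility prevents the fixed points from lying on a line
  with all \<open>a\<^sub>i\<close> real, so two independent translations are available and the lattice has full rank.  By the
  Erdos--Kahane argument a frequency that stays close to the lattices for most of the time is determined by
  few choices.  As the law of \<open>f'\<close> under \<open>\<mu>\<close> satisfies a Frostman condition, by nonlinearity, such frequencies
  contribute little to the average.
\<close>
section \<open>Erdos--Kahane counting for damped multiplicative random walks\<close>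

text \<open>The exponent 2 / 3 balances two demands: pieces of diameter r give a linearisation error
  of order |xi| r^2, while the frequency |xi| r left for \<mu> must still grow. Grouping the pieces
  by linear part leaves only polylogarithmically many groups, so even an unweighted sum over them
  costs an arbitrarily small power of |xi|.

  The delicate point in the counting is the order of choices. A path of n steps with e exceptional
  ones costs 2 ^ n for the pattern and M ^ e for the coverings, and the Frostman gain has to beat
  both. The ratio l = n / e is fixed so that exceptional steps are rare enough; then k elementary
  steps are merged into one, which turns covering loss and Frostman gain into k-th powers, leaves
  the pattern count alone and makes the probability of an undamped step tiny. Only then are the
  lattices, the tolerance \<sigma> and the damping \<theta> known. No circle arises because the
  Chernoff estimate needs only \<open>\<delta> * l \<le> 1 / 2\<close>, uniformly in \<theta>
  between 1 / 2 and 1.\<close>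

text \<open>
  The probability that a random walk of length \<open>n\<close>, started at the frequency \<open>\<eta>\<close> and multiplying by
  \<open>\<beta> j\<close> with probability \<open>q j\<close>, makes at most \<open>e\<close> exceptional steps, a step \<open>j\<close> from \<open>\<eta>\<close> being
  exceptional if \<open>X j \<eta>\<close>.
\<close>

primrec few_prob ::
  "'i set \<Rightarrow> ('i \<Rightarrow> real) \<Rightarrow> ('i \<Rightarrow> complex) \<Rightarrow> ('i \<Rightarrow> complex \<Rightarrow> bool) \<Rightarrow> nat \<Rightarrow> nat \<Rightarrow> complex \<Rightarrow> real"
where
  "few_prob J q \<beta> X 0 e \<eta> = 1"
| "few_prob J q \<beta> X (Suc n) e \<eta> =
     (\<Sum>j\<in>J. q j * (if X j \<eta>
        then (case e of 0 \<Rightarrow> 0 | Suc e' \<Rightarrow> few_prob J q \<beta> X n e' (\<beta> j * \<eta>))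
        else few_prob J q \<beta> X n e (\<beta> j * \<eta>)))"

lemma few_prob_nonneg:
  assumes "\<And>j. j \<in> J \<Longrightarrow> 0 \<le> q j"
  shows "0 \<le> few_prob J q \<beta> X n e \<eta>"
proof (induction n arbitrary: e \<eta>)
  case (Suc n)
  show ?case
    using Suc assms by (auto intro!: sum_nonneg mult_nonneg_nonneg split: nat.split)
qed simp

lemma few_prob_le_1:
  assumes "\<And>j. j \<in> J \<Longrightarrow> 0 \<le> q j" and "sum q J = 1"
  shows "few_prob J q \<beta> X n e \<eta> \<le> 1"
proof (induction n arbitrary: e \<eta>)
  case (Suc n)
  have "few_prob J q \<beta> X (Suc n) e \<eta> \<le> (\<Sum>j\<in>J. q j * 1)"
    unfolding few_prob.simps
    using Suc assms by (intro sum_mono mult_left_mono) (auto split: nat.split)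
  then show ?case using assms by simp
qed simp

lemma few_prob_measurable [measurable]:
  assumes X: "\<And>j. j \<in> J \<Longrightarrow> Measurable.pred borel (X j)"
  shows "few_prob J q \<beta> X n e \<in> borel_measurable borel"
proof (induction n arbitrary: e)
  case 0
  show ?case by (simp add: few_prob.simps(1)[abs_def])
next
  case (Suc n)
  have [measurable]: "(\<lambda>\<eta>. few_prob J q \<beta> X n e' (\<beta> j * \<eta>)) \<in> borel_measurable borel" for e' j
    by (rule measurable_compose[OF _ Suc]) simp
  show ?case
    unfolding few_prob.simps(2)[abs_def]
  proof (intro borel_measurable_sum borel_measurable_times borel_measurable_const)
    fix j assume "j \<in> J"
    note [measurable] = X[OF this]
    show "(\<lambda>\<eta>. if X j \<eta> then (case e of 0 \<Rightarrow> 0 | Suc e' \<Rightarrow> few_prob J q \<beta> X n e' (\<beta> j * \<eta>))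
        else few_prob J q \<beta> X n e (\<beta> j * \<eta>)) \<in> borel_measurable borel"
      by (cases e) simp_all
  qed
qed

text \<open>Union bound over the discs of a cover. It pays for an exceptional step (\<open>M\<close>
  discs) and for the end of the walk (\<open>M0\<close> discs).\<close>

lemma measure_le_ball_cover:
  fixes Y :: "'a \<Rightarrow> complex"
  assumes \<mu>: "finite_measure \<mu>" and A: "A \<in> sets \<mu>" and Y: "Y \<in> borel_measurable \<mu>"
    and s: "\<And>c. measure \<mu> {x \<in> A. cmod (Y x - c) \<le> \<tau>} \<le> s"
    and S: "finite S" "card S \<le> M"
    and Z: "Z \<subseteq> A" "\<And>x. x \<in> Z \<Longrightarrow> Y x \<in> (\<Union>d\<in>S. cball d \<tau>)"
  shows "measure \<mu> Z \<le> real M * s"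
proof -
  interpret finite_measure \<mu> by (rule \<mu>)
  note [measurable] = A Y
  have s0: "0 \<le> s" using s[of 0] measure_nonneg order_trans by blast
  have SA: "{x \<in> A. cmod (Y x - d) \<le> \<tau>} \<in> sets \<mu>" for d
  proof -
    have "{x \<in> A. cmod (Y x - d) \<le> \<tau>} = {x \<in> space \<mu>. x \<in> A \<and> cmod (Y x - d) \<le> \<tau>}"
      using sets.sets_into_space[OF A] by auto
    then show ?thesis by simp
  qed
  have "measure \<mu> Z \<le> measure \<mu> (\<Union>d\<in>S. {x \<in> A. cmod (Y x - d) \<le> \<tau>})"
  proof (rule finite_measure_mono)
    show "(\<Union>d\<in>S. {x \<in> A. cmod (Y x - d) \<le> \<tau>}) \<in> sets \<mu>"
      using S(1) SA by (intro sets.finite_UN) auto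
    show "Z \<subseteq> (\<Union>d\<in>S. {x \<in> A. cmod (Y x - d) \<le> \<tau>})"
      using Z by (auto simp: dist_norm norm_minus_commute)
  qed
  also have "\<dots> \<le> (\<Sum>d\<in>S. measure \<mu> {x \<in> A. cmod (Y x - d) \<le> \<tau>})"
    using S(1) SA by (intro finite_measure_subadditive_finite) auto
  also have "\<dots> \<le> real (card S) * s" using sum_bounded_above[of S _ s] s by simp
  also have "\<dots> \<le> real M * s" using S s0 by (intro mult_right_mono) auto
  finally show ?thesis .
qed

text \<open>
  The Erdos--Kahane counting argument, phrased on the level of measures: instead of covering the
  set of good frequencies, the bound on the mass of balls of radius \<open>\<tau>\<close> is transported along each
  step.  A step that is not exceptional does not lose anything, by the separation property
  \<open>uniq\<close>; an exceptional one costs a factor \<open>M\<close>.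
\<close>

lemma few_prob_integral_le:
  fixes J :: "'i set" and \<mu> :: "'a measure" and Y :: "'a \<Rightarrow> complex"
  assumes J: "finite J" "\<And>j. j \<in> J \<Longrightarrow> 0 \<le> q j" "sum q J = 1"
    and \<beta>: "\<And>j. j \<in> J \<Longrightarrow> b \<le> cmod (\<beta> j) \<and> cmod (\<beta> j) \<le> B" "0 < b" "0 < B"
    and X: "\<And>j. j \<in> J \<Longrightarrow> Measurable.pred borel (X j)"
    and uniq: "\<And>j \<eta> \<eta>'. \<lbrakk>j \<in> J; \<not> X j \<eta>; \<not> X j \<eta>'; cmod (\<eta> - \<eta>') \<le> 2 * \<tau> / b\<rbrakk>
                 \<Longrightarrow> cmod (\<eta> - \<eta>') \<le> \<tau>"
    and M: "\<And>c::complex. \<exists>S. finite S \<and> card S \<le> M \<and> cball c (\<tau> / b) \<subseteq> (\<Union>s\<in>S. cball s \<tau>)"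
    and M0: "\<exists>S. finite S \<and> card S \<le> M0 \<and> cball (0::complex) 1 \<subseteq> (\<Union>s\<in>S. cball s \<tau>)"
    and \<mu>: "finite_measure \<mu>"
    and A: "A \<in> sets \<mu>" and Y: "Y \<in> borel_measurable \<mu>"
    and s: "\<And>c. measure \<mu> {x \<in> A. cmod (Y x - c) \<le> \<tau>} \<le> s"
    and Yn: "\<And>x. x \<in> A \<Longrightarrow> B ^ n * cmod (Y x) \<le> 1"
  shows "(\<integral>x. indicator A x * few_prob J q \<beta> X n e (Y x) \<partial>\<mu>) \<le> 2 ^ n * real M ^ e * real M0 * s"
  using A Y s Yn
proof (induction n arbitrary: e A Y s)
  case 0
  interpret finite_measure \<mu> by (rule \<mu>)
  have AS: "A \<subseteq> space \<mu>" using 0 sets.sets_into_space by blast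
  obtain S where S: "finite S" "card S \<le> M0" "cball (0::complex) 1 \<subseteq> (\<Union>s\<in>S. cball s \<tau>)" using M0 by blast
  have s0: "0 \<le> s" using 0(3)[of 0] measure_nonneg order_trans by blast
  \<comment> \<open>Needed because \<open>M ^ e\<close> must dominate 1 when no steps remain. For
    negative \<tau> every \<open>cball s \<tau>\<close> is empty, which contradicts the covering
    hypothesis \<open>M0\<close>.\<close>
  have M1: "1 \<le> M"
  proof -
    obtain S where S: "finite S" "card S \<le> M" "cball (0::complex) (\<tau> / b) \<subseteq> (\<Union>s\<in>S. cball s \<tau>)"
      using M by blast
    show ?thesis
    proof (cases "0 \<le> \<tau>")
      case True
      then have "0 \<in> cball (0::complex) (\<tau> / b)" using \<beta> by simp
      then have "S \<noteq> {}" using S(3) by blast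
      then show ?thesis using S by (metis One_nat_def Suc_leI card_gt_0_iff order.trans)
    next
      case False
      obtain S where S: "cball (0::complex) 1 \<subseteq> (\<Union>s\<in>S. cball s \<tau>)" using M0 by blast
      have "cball s \<tau> = {}" for s :: complex using False by simp
      then have "cball (0::complex) 1 = {}" using S by blast
      then show ?thesis by simp
    qed
  qed
  have "(\<integral>x. indicator A x * few_prob J q \<beta> X 0 e (Y x) \<partial>\<mu>) = measure \<mu> A"
    using AS by (simp add: Int_absorb2)
  also have "\<dots> \<le> real M0 * s"
    by (rule measure_le_ball_cover[OF \<mu> 0(1,2,3) S(1,2)]) (use subsetD[OF S(3)] 0(4) in simp_all)
  also have "\<dots> \<le> real M ^ e * (real M0 * s)"
    using mult_right_mono[of 1 "real M ^ e" "real M0 * s"] M1 s0 by simp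
  finally show ?case by (simp add: mult.assoc)
next
  case (Suc n)
  interpret finite_measure \<mu> by (rule \<mu>)
  note [measurable] = Suc.prems(1,2) X
  have AS: "A \<subseteq> space \<mu>" using Suc sets.sets_into_space by blast
  have s0: "0 \<le> s" using Suc.prems(3)[of 0] measure_nonneg order_trans by blast
  define W where "W n e = 2 ^ n * real M ^ e * real M0" for n e
  have W0: "0 \<le> W n e" for n e by (simp add: W_def)
  let ?P = "few_prob J q \<beta> X"
  have Pm [measurable]: "?P n e \<in> borel_measurable borel" for n e
    by (rule few_prob_measurable) (rule X)
  have bnd: "\<bar>?P n e \<eta>\<bar> \<le> 1" for n e \<eta>
    using few_prob_nonneg[of J q \<beta> X n e \<eta>] few_prob_le_1[of J q \<beta> X n e \<eta>] J by auto
  have int: "integrable \<mu> (\<lambda>x. indicator C x * ?P n e (\<beta> j * Y x))" if "C \<in> sets \<mu>" for C n e j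
    by (rule integrable_const_bound[where B = 1])
       (use that bnd in \<open>auto simp: indicator_def\<close>)
  define A1 where "A1 j = {x \<in> A. \<not> X j (Y x)}" for j
  define A2 where "A2 j = {x \<in> A. X j (Y x)}" for j
  have A1e: "A1 j = {x \<in> space \<mu>. x \<in> A \<and> \<not> X j (Y x)}" and
       A2e: "A2 j = {x \<in> space \<mu>. x \<in> A \<and> X j (Y x)}" for j
    using AS by (auto simp: A1_def A2_def)
  have A12[measurable]: "A1 j \<in> sets \<mu>" "A2 j \<in> sets \<mu>" if "j \<in> J" for j
  proof -
    have [measurable]: "Measurable.pred \<mu> (\<lambda>x. X j (Y x))"
      by (rule measurable_compose[OF Suc.prems(2) X[OF that]])
    show "A1 j \<in> sets \<mu>" "A2 j \<in> sets \<mu>" unfolding A1e A2e by measurable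
  qed
  have Bn: "B ^ n * cmod (\<beta> j * Y x) \<le> 1" if "j \<in> J" "x \<in> A" for j x
  proof -
    have "B ^ n * cmod (\<beta> j * Y x) \<le> B ^ n * (B * cmod (Y x))"
      using \<beta> that by (auto simp: norm_mult intro!: mult_left_mono mult_right_mono)
    then show ?thesis using Suc.prems(4)[OF that(2)] by (simp add: mult.assoc mult.left_commute)
  qed
  \<comment> \<open>Values of \<open>Y\<close> whose images under \<open>\<beta> j\<close> lie in
    one \<tau>-disc differ by at most \<open>2 * \<tau> / b\<close>; off the exceptional set
    \<open>uniq\<close> puts them all in the \<tau>-disc around \<open>Y x0\<close>, so the same
    \<open>s\<close> serves for the next step.\<close>
  have good: "(\<integral>x. indicator (A1 j) x * ?P n e (\<beta> j * Y x) \<partial>\<mu>) \<le> W n e * s" if j: "j \<in> J" for j e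
  proof -
    have "(\<integral>x. indicator (A1 j) x * ?P n e ((\<lambda>x. \<beta> j * Y x) x) \<partial>\<mu>) \<le> 2 ^ n * real M ^ e * real M0 * s"
    proof (rule Suc.IH)
      show "A1 j \<in> sets \<mu>" using j by simp
      show "B ^ n * cmod (\<beta> j * Y x) \<le> 1" if "x \<in> A1 j" for x
        using Bn j that by (auto simp: A1_def)
      fix c
      show "measure \<mu> {x \<in> A1 j. cmod (\<beta> j * Y x - c) \<le> \<tau>} \<le> s"
      proof (cases "{x \<in> A1 j. cmod (\<beta> j * Y x - c) \<le> \<tau>} = {}")
        case False
        then obtain x0 where x0: "x0 \<in> A1 j" "cmod (\<beta> j * Y x0 - c) \<le> \<tau>" by blast
        have "measure \<mu> {x \<in> A1 j. cmod (\<beta> j * Y x - c) \<le> \<tau>} \<le> measure \<mu> {x \<in> A. cmod (Y x - Y x0) \<le> \<tau>}"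
        proof (rule finite_measure_mono)
          have "{x \<in> A. cmod (Y x - Y x0) \<le> \<tau>} = {x \<in> space \<mu>. x \<in> A \<and> cmod (Y x - Y x0) \<le> \<tau>}"
            using AS by auto
          then show "{x \<in> A. cmod (Y x - Y x0) \<le> \<tau>} \<in> sets \<mu>" by simp
          show "{x \<in> A1 j. cmod (\<beta> j * Y x - c) \<le> \<tau>} \<subseteq> {x \<in> A. cmod (Y x - Y x0) \<le> \<tau>}"
          proof
            fix x assume x: "x \<in> {x \<in> A1 j. cmod (\<beta> j * Y x - c) \<le> \<tau>}"
            have "b * cmod (Y x - Y x0) \<le> cmod (\<beta> j) * cmod (Y x - Y x0)"
              using \<beta> j by (intro mult_right_mono) auto
            also have "\<dots> = cmod (\<beta> j * Y x - \<beta> j * Y x0)"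
              by (simp add: norm_mult[symmetric] algebra_simps)
            also have "\<dots> \<le> cmod (\<beta> j * Y x - c) + cmod (\<beta> j * Y x0 - c)"
              using norm_triangle_ineq4[of "\<beta> j * Y x - c" "\<beta> j * Y x0 - c"] by simp
            also have "\<dots> \<le> 2 * \<tau>" using x x0 by auto
            finally have "cmod (Y x - Y x0) \<le> 2 * \<tau> / b" using \<beta> by (simp add: field_simps)
            then have "cmod (Y x - Y x0) \<le> \<tau>"
              using uniq[OF j, of "Y x" "Y x0"] x x0 by (auto simp: A1_def)
            then show "x \<in> {x \<in> A. cmod (Y x - Y x0) \<le> \<tau>}" using x by (auto simp: A1_def)
          qed
        qed
        also have "\<dots> \<le> s" by (rule Suc.prems(3))
        finally show ?thesis .
      qed (use s0 in \<open>simp only: measure_empty\<close>)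
    qed measurable
    then show ?thesis by (simp add: W_def)
  qed
  \<comment> \<open>Without separation, the preimage of a \<tau>-disc is only known to lie in a disc
    of radius \<open>\<tau> / b\<close>, hence in \<open>M\<close> discs of radius \<tau>: the bound
    \<open>s\<close> becomes \<open>M * s\<close>.\<close>
  have bad: "(\<integral>x. indicator (A2 j) x * ?P n e (\<beta> j * Y x) \<partial>\<mu>) \<le> W n e * (M * s)" if j: "j \<in> J" for j e
  proof -
    have "(\<integral>x. indicator (A2 j) x * ?P n e ((\<lambda>x. \<beta> j * Y x) x) \<partial>\<mu>) \<le> 2 ^ n * real M ^ e * real M0 * (M * s)"
    proof (rule Suc.IH)
      show "A2 j \<in> sets \<mu>" using j by simp
      show "B ^ n * cmod (\<beta> j * Y x) \<le> 1" if "x \<in> A2 j" for x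
        using Bn j that by (auto simp: A2_def)
      fix c
      have \<beta>0: "\<beta> j \<noteq> 0" using \<beta> j by force
      obtain S where S: "finite S" "card S \<le> M" "cball (c / \<beta> j) (\<tau> / b) \<subseteq> (\<Union>s\<in>S. cball s \<tau>)"
        using M by blast
      show "measure \<mu> {x \<in> A2 j. cmod (\<beta> j * Y x - c) \<le> \<tau>} \<le> M * s"
      proof (rule measure_le_ball_cover[OF \<mu> Suc.prems(1,2,3) S(1,2)])
        show "{x \<in> A2 j. cmod (\<beta> j * Y x - c) \<le> \<tau>} \<subseteq> A" by (auto simp: A2_def)
        fix x assume x: "x \<in> {x \<in> A2 j. cmod (\<beta> j * Y x - c) \<le> \<tau>}"
        have "b * cmod (Y x - c / \<beta> j) \<le> cmod (\<beta> j) * cmod (Y x - c / \<beta> j)"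
          using \<beta> j by (intro mult_right_mono) auto
        also have "\<dots> = cmod (\<beta> j * Y x - c)"
          using \<beta>0 by (simp add: norm_mult[symmetric] right_diff_distrib)
        also have "\<dots> \<le> \<tau>" using x by auto
        finally have "cmod (Y x - c / \<beta> j) \<le> \<tau> / b" using \<beta> by (simp add: field_simps)
        then have "Y x \<in> cball (c / \<beta> j) (\<tau> / b)" by (simp add: dist_norm norm_minus_commute)
        then show "Y x \<in> (\<Union>s\<in>S. cball s \<tau>)" using S(3) by blast
      qed
    qed measurable
    then show ?thesis by (simp add: W_def)
  qed
  define Z where "Z j x = indicator (A1 j) x * ?P n e (\<beta> j * Y x) +
     (case e of 0 \<Rightarrow> 0 | Suc e' \<Rightarrow> indicator (A2 j) x * ?P n e' (\<beta> j * Y x))" for j x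
  have Zint: "integrable \<mu> (Z j)" if "j \<in> J" for j
    unfolding Z_def[abs_def] using int A12 that by (cases e) auto
  have Zle: "(\<integral>x. Z j x \<partial>\<mu>) \<le> W (Suc n) e * s" if j: "j \<in> J" for j
  proof (cases e)
    case 0
    have "(\<integral>x. Z j x \<partial>\<mu>) \<le> W n e * s" using good[OF j, of e] by (simp add: Z_def 0)
    also have "\<dots> \<le> W (Suc n) e * s" using s0 by (simp add: W_def)
    finally show ?thesis .
  next
    case (Suc e')
    have "(\<integral>x. Z j x \<partial>\<mu>) \<le> W n e * s + W n e' * (M * s)"
      using good[OF j, of e] bad[OF j, of e'] int A12[OF j] by (simp add: Z_def Suc)
    \<comment> \<open>Both summands equal \<open>W n e * s\<close>, since the lost factor
      \<open>M\<close> is returned by the smaller exponent. This doubling at each step is the origin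
      of \<open>2 ^ n\<close>.\<close>
    also have "\<dots> = W (Suc n) e * s" by (simp add: W_def Suc)
    finally show ?thesis .
  qed
  have "(\<integral>x. indicator A x * ?P (Suc n) e (Y x) \<partial>\<mu>) = (\<integral>x. (\<Sum>j\<in>J. q j * Z j x) \<partial>\<mu>)"
  proof (rule Bochner_Integration.integral_cong[OF refl])
    fix x
    have "indicator A x * ?P (Suc n) e (Y x) = (\<Sum>j\<in>J. q j * (indicator A x * (if X j (Y x)
        then (case e of 0 \<Rightarrow> 0 | Suc e' \<Rightarrow> ?P n e' (\<beta> j * Y x))
        else ?P n e (\<beta> j * Y x))))"
      unfolding few_prob.simps by (simp add: sum_distrib_left mult.left_commute)
    also have "\<dots> = (\<Sum>j\<in>J. q j * Z j x)"
      by (rule sum.cong[OF refl]) (auto simp: Z_def A1_def A2_def indicator_def split: nat.split)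
    finally show "indicator A x * ?P (Suc n) e (Y x) = (\<Sum>j\<in>J. q j * Z j x)" .
  qed
  also have "\<dots> = (\<Sum>j\<in>J. q j * (\<integral>x. Z j x \<partial>\<mu>))"
    using Zint by (subst Bochner_Integration.integral_sum) auto
  also have "\<dots> \<le> (\<Sum>j\<in>J. q j * (W (Suc n) e * s))"
    using Zle J by (intro sum_mono mult_left_mono) auto
  also have "\<dots> = W (Suc n) e * s" using J by (simp add: sum_distrib_right[symmetric])
  finally show ?case by (simp add: W_def)
qed

text \<open>
  Chernoff bound: a path with more than \<open>e\<close> exceptional steps either contains many bad steps,
  whose moment generating function is \<open>(1 + \<delta> (1 / \<theta> - 1)) ^ n\<close>, or gains many factors \<open>\<theta>\<close>.
\<close>

lemma le_few_prob_plus: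
  fixes F :: "complex \<Rightarrow> real"
  assumes J: "finite J" "\<And>j. j \<in> J \<Longrightarrow> 0 \<le> q j" "sum q J = 1"
    and F: "\<And>\<eta>. 0 \<le> F \<eta>" "\<And>\<eta>. F \<eta> \<le> 1"
    and step: "\<And>\<eta>. F \<eta> \<le> (\<Sum>j\<in>J. q j * ((if g j \<and> X j \<eta> then \<theta> else 1) * F (\<beta> j * \<eta>)))"
    and bad: "\<And>j \<eta>. j \<in> J \<Longrightarrow> \<not> g j \<Longrightarrow> X j \<eta>"
    and \<delta>: "sum q {j \<in> J. \<not> g j} \<le> \<delta>"
    and \<theta>: "0 < \<theta>" "\<theta> < 1"
  shows "F \<eta> \<le> few_prob J q \<beta> X n e \<eta> + \<theta> ^ e * (1 + \<delta> * (1 / \<theta> - 1)) ^ n"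
proof (induction n arbitrary: e \<eta>)
  case 0
  then show ?case using F(2)[of \<eta>] \<theta> by (simp add: add_increasing2)
next
  case (Suc n)
  let ?D = "1 + \<delta> * (1 / \<theta> - 1)" and ?P = "few_prob J q \<beta> X"
  have \<delta>0: "0 \<le> \<delta>" by (rule order_trans[OF sum_nonneg \<delta>]) (use J(2) in auto)
  have "0 \<le> 1 / \<theta> - 1" using \<theta> by simp
  then have D1: "1 \<le> ?D" using \<delta>0 by simp
  have Dn: "1 \<le> ?D ^ n" using D1 by (rule one_le_power)
  have P0: "0 \<le> ?P n e \<eta>" for n e \<eta> by (rule few_prob_nonneg) (rule J)
  define T where "T = \<theta> ^ e * ?D ^ n"
  have T0: "0 \<le> T" using \<theta> Dn by (simp add: T_def)
  \<comment> \<open>A damped exceptional step pays for lowering \<open>e\<close> with its factor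
    \<theta>; a bad step also lowers \<open>e\<close> but earns nothing, which is recorded as
    \<open>T / \<theta>\<close>. For e = 0 the trivial bound 1 on \<open>F\<close> is below
    \<open>T\<close>.\<close>
  have key: "(if g j \<and> X j \<eta> then \<theta> else 1) * F (\<beta> j * \<eta>) \<le>
      (if X j \<eta> then (case e of 0 \<Rightarrow> 0 | Suc e' \<Rightarrow> ?P n e' (\<beta> j * \<eta>)) else ?P n e (\<beta> j * \<eta>))
      + (if g j then T else T / \<theta>)" if j: "j \<in> J" for j
  proof (cases "X j \<eta>")
    case False
    then have "g j" using bad j by blast
    then show ?thesis using False Suc[of "\<beta> j * \<eta>" e] by (simp add: T_def)
  next
    case True
    show ?thesis
    proof (cases e)
      case 0
      have "T = ?D ^ n" by (simp add: T_def 0)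
      then have "1 \<le> T" using Dn by simp
      moreover have "T \<le> T / \<theta>" using T0 \<theta> by (simp add: field_simps mult_left_le)
      moreover have "\<theta> * F (\<beta> j * \<eta>) \<le> 1"
        using F[of "\<beta> j * \<eta>"] \<theta> by (intro mult_le_one) auto
      ultimately show ?thesis using F(2)[of "\<beta> j * \<eta>"] True by (auto simp: 0)
    next
      case (Suc e')
      have IH: "F (\<beta> j * \<eta>) \<le> ?P n e' (\<beta> j * \<eta>) + T / \<theta>"
        using Suc.IH[of "\<beta> j * \<eta>" e'] \<theta> by (simp add: T_def \<open>e = Suc e'\<close>)
      have "\<theta> * F (\<beta> j * \<eta>) \<le> \<theta> * (?P n e' (\<beta> j * \<eta>) + T / \<theta>)"
        using IH \<theta> by (intro mult_left_mono) auto
      also have "\<dots> \<le> ?P n e' (\<beta> j * \<eta>) + T"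
        using \<theta> P0[of n e' "\<beta> j * \<eta>"] by (simp add: distrib_left mult_left_le_one_le)
      finally show ?thesis using IH True by (simp add: \<open>e = Suc e'\<close>)
    qed
  qed
  have "F \<eta> \<le> (\<Sum>j\<in>J. q j * ((if X j \<eta> then (case e of 0 \<Rightarrow> 0 | Suc e' \<Rightarrow> ?P n e' (\<beta> j * \<eta>)) else ?P n e (\<beta> j * \<eta>))
      + (if g j then T else T / \<theta>)))"
    using step[of \<eta>] by (rule order_trans) (intro sum_mono mult_left_mono key J(2))
  also have "\<dots> = ?P (Suc n) e \<eta> + (\<Sum>j\<in>J. q j * (if g j then T else T / \<theta>))"
    by (simp add: distrib_left sum.distrib)
  also have "(\<Sum>j\<in>J. q j * (if g j then T else T / \<theta>)) =
      (\<Sum>j\<in>J. T * q j + T * (1 / \<theta> - 1) * (if \<not> g j then q j else 0))"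
    by (rule sum.cong[OF refl]) (auto simp: algebra_simps)
  also have "\<dots> = T + T * (1 / \<theta> - 1) * sum q {j \<in> J. \<not> g j}"
  proof -
    have "(\<Sum>j\<in>J. if \<not> g j then q j else 0) = sum q {j \<in> J. \<not> g j}"
      using J(1) by (intro sum.inter_filter[symmetric])
    then show ?thesis by (simp only: sum.distrib sum_distrib_left[symmetric] J(3) mult_1_right)
  qed
  also have "\<dots> \<le> T + T * (1 / \<theta> - 1) * \<delta>"
    using \<delta> T0 \<theta> by (intro add_left_mono mult_left_mono) auto
  also have "\<dots> = T * ?D" by (simp add: algebra_simps)
  finally show ?case by (simp add: T_def mult_ac)
qed

section \<open>Covering numbers of discs in the plane\<close>

lemma ball_cover:
  fixes R :: real
  assumes "0 < r"
  obtains M :: nat where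
    "1 \<le> M" "\<And>c :: complex. \<And>\<tau>. 0 < \<tau> \<Longrightarrow> \<exists>S. finite S \<and> card S \<le> M \<and> cball c (\<tau> * R) \<subseteq> (\<Union>s\<in>S. cball s (\<tau> * r))"
proof -
  have "compact (cball (0::complex) R)" by simp
  then obtain T where T: "finite T" "cball (0::complex) R \<subseteq> (\<Union>x\<in>T. ball x r)"
    using compactE_image[of "cball (0::complex) R" UNIV "\<lambda>x. ball x r"] assms
    by (metis (no_types, lifting) UNIV_I UN_iff centre_in_ball open_ball subsetI top_greatest)
  show ?thesis
  proof (rule that[of "Suc (card T)"])
    fix c :: complex and \<tau> :: real assume \<tau>: "0 < \<tau>"
    show "\<exists>S. finite S \<and> card S \<le> Suc (card T) \<and> cball c (\<tau> * R) \<subseteq> (\<Union>s\<in>S. cball s (\<tau> * r))"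
    proof (intro exI[of _ "(\<lambda>s. c + of_real \<tau> * s) ` T"] conjI)
      show "card ((\<lambda>s. c + of_real \<tau> * s) ` T) \<le> Suc (card T)"
        using card_image_le[OF T(1)] by (meson le_Suc_eq le_trans)
      show "cball c (\<tau> * R) \<subseteq> (\<Union>s\<in>(\<lambda>s. c + of_real \<tau> * s) ` T. cball s (\<tau> * r))"
      proof
        fix x assume x: "x \<in> cball c (\<tau> * R)"
        have "cmod ((x - c) / of_real \<tau>) \<le> R"
          using x \<tau> by (simp add: norm_divide dist_norm norm_minus_commute field_simps)
        then obtain t where t: "t \<in> T" "(x - c) / of_real \<tau> \<in> ball t r" using T(2) by auto
        have "x - (c + of_real \<tau> * t) = of_real \<tau> * ((x - c) / of_real \<tau> - t)"
          using \<tau> by (simp add: field_simps)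
        then have "cmod (x - (c + of_real \<tau> * t)) = \<tau> * cmod ((x - c) / of_real \<tau> - t)"
          using \<tau> by (simp add: norm_mult)
        also have "\<dots> \<le> \<tau> * r"
          using t \<tau> by (intro mult_left_mono) (auto simp: dist_norm norm_minus_commute)
        finally show "x \<in> (\<Union>s\<in>(\<lambda>s. c + of_real \<tau> * s) ` T. cball s (\<tau> * r))"
          using t by (auto simp: dist_norm norm_minus_commute)
      qed
    qed (use T in auto)
  qed auto
qed

text \<open>Covering scale by scale makes the count multiplicative: merging k steps raises
  \<open>M\<close> to the k-th power and no more, on which the choice of constants in
  \<open>damped_imp_average_decay\<close> depends.\<close>

lemma ball_cover_power:
  fixes b :: real
  assumes cov: "\<And>c :: complex. \<And>\<tau>. 0 < \<tau> \<Longrightarrow> \<exists>S. finite S \<and> card S \<le> M \<and> cball c (\<tau> * 1) \<subseteq> (\<Union>s\<in>S. cball s (\<tau> * b))"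
    and b: "0 < b" and \<tau>: "0 < \<tau>"
  shows "\<exists>S. finite S \<and> card S \<le> M ^ k \<and> cball (c::complex) (\<tau> / b ^ k) \<subseteq> (\<Union>s\<in>S. cball s \<tau>)"
proof (induction k arbitrary: c)
  case 0
  show ?case by (rule exI[of _ "{c}"]) simp
next
  case (Suc k)
  have p: "0 < \<tau> / b ^ Suc k" using \<tau> b by simp
  obtain S where S: "finite S" "card S \<le> M" "cball c (\<tau> / b ^ Suc k) \<subseteq> (\<Union>s\<in>S. cball s (\<tau> / b ^ k))"
    using cov[OF p, of c] b by auto
  obtain T where T: "\<And>s::complex. finite (T s) \<and> card (T s) \<le> M ^ k \<and> cball s (\<tau> / b ^ k) \<subseteq> (\<Union>s\<in>T s. cball s \<tau>)"
    using Suc by metis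
  show ?case
  proof (intro exI[of _ "\<Union>s\<in>S. T s"] conjI)
    have "card (\<Union>s\<in>S. T s) \<le> (\<Sum>s\<in>S. card (T s))" using S(1) by (rule card_UN_le)
    also have "\<dots> \<le> card S * M ^ k" using sum_bounded_above[of S "\<lambda>s. card (T s)" "M ^ k"] T by auto
    also have "\<dots> \<le> M ^ Suc k" using S by simp
    finally show "card (\<Union>s\<in>S. T s) \<le> M ^ Suc k" .
    show "cball c (\<tau> / b ^ Suc k) \<subseteq> (\<Union>s\<in>\<Union> (T ` S). cball s \<tau>)"
      using S T by fastforce
  qed (use S T in auto)
qed

section \<open>Frequencies close to a lattice\<close>

text \<open>The sine measures the distance of \<open>Re (\<eta> * d)\<close> to the integers. It is
  the form in which damping arises, since two unit vectors with phases \<open>2 * pi * x\<close> and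
  \<open>2 * pi * y\<close> add up to modulus
  \<open>2 * \<bar>cos (pi * (x - y))\<bar>\<close>.\<close>

definition near :: "real \<Rightarrow> complex \<Rightarrow> complex \<Rightarrow> complex \<Rightarrow> bool" where
  "near \<sigma> d d' \<eta> \<longleftrightarrow> \<bar>sin (pi * Re (\<eta> * d))\<bar> < \<sigma> \<and> \<bar>sin (pi * Re (\<eta> * d'))\<bar> < \<sigma>"

lemma near_mult: "near \<sigma> d d' (\<beta> * \<eta>) \<longleftrightarrow> near \<sigma> (\<beta> * d) (\<beta> * d') \<eta>"
  by (simp add: near_def mult_ac)

lemma near_measurable [measurable]: "Measurable.pred borel (near \<sigma> d d')"
  unfolding near_def[abs_def] by measurable

text \<open>Jordan's inequality: on [0, 1/2] the concave function \<open>sin (pi * v)\<close> lies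
  above its chord.\<close>

lemma abs_le_of_sin_pi:
  assumes "\<bar>u\<bar> \<le> 1 / 2"
  shows "\<bar>u\<bar> \<le> \<bar>sin (pi * u)\<bar> / 2"
proof -
  have "2 * v \<le> sin (pi * v)" if v: "0 \<le> v" "v \<le> 1 / 2" for v :: real
  proof -
    have "convex_on {0..pi} (\<lambda>x. - sin x)"
      by (rule f''_ge0_imp_convex[where f' = "\<lambda>x. - cos x" and f'' = sin])
         (auto intro!: derivative_eq_intros sin_ge_zero)
    from convex_onD[OF this, of "2 * v" 0 "pi / 2"] show ?thesis using v by (simp add: mult.commute)
  qed
  from this[of "\<bar>u\<bar>"] assms have "2 * \<bar>u\<bar> \<le> sin (pi * \<bar>u\<bar>)" by simp
  also have "\<dots> \<le> \<bar>sin (pi * u)\<bar>" by (cases "0 \<le> u") auto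
  finally show ?thesis by simp
qed

text \<open>Sine form of the triangle inequality for the distance to the nearest integer.\<close>

lemma sin_pi_diff_le: "\<bar>sin (pi * (x - y))\<bar> \<le> \<bar>sin (pi * x)\<bar> + \<bar>sin (pi * y)\<bar>" for x y :: real
proof -
  have "\<bar>sin (pi * (x - y))\<bar> \<le> \<bar>sin (pi * x)\<bar> * \<bar>cos (pi * y)\<bar> + \<bar>cos (pi * x)\<bar> * \<bar>sin (pi * y)\<bar>"
    unfolding right_diff_distrib sin_diff abs_mult[symmetric] by (rule abs_triangle_ineq4)
  also have "\<dots> \<le> \<bar>sin (pi * x)\<bar> * 1 + 1 * \<bar>sin (pi * y)\<bar>"
    by (intro add_mono mult_left_mono mult_right_mono) auto
  finally show ?thesis by simp
qed

text \<open>A set of \<open>\<eta>\<close> satisfying \<open>near\<close> is a small neighbourhood of the lattice dual to \<open>d, d'\<close>.\<close>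

lemma near_separated:
  assumes d: "Im (cnj d * d') \<noteq> 0"
  shows "\<exists>\<tau>0>0. \<forall>\<tau>. 0 < \<tau> \<and> \<tau> \<le> \<tau>0 \<longrightarrow> (\<exists>\<sigma>0>0. \<forall>\<sigma> \<eta> \<eta>'. \<sigma> \<le> \<sigma>0 \<longrightarrow> near \<sigma> d d' \<eta> \<longrightarrow> near \<sigma> d d' \<eta>' \<longrightarrow>
            cmod (\<eta> - \<eta>') \<le> 2 * \<tau> / b \<longrightarrow> cmod (\<eta> - \<eta>') \<le> \<tau>)"
proof -
  define R where "R = max (cmod d) (cmod d')"
  have R: "cmod d \<le> R" "cmod d' \<le> R" by (auto simp: R_def)
  have R0: "0 < R" using d by (auto simp: R_def less_max_iff_disj)
  define Q where "Q = 2 * R / \<bar>Im (cnj d * d')\<bar>"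
  have Q0: "0 < Q" using R0 d by (simp add: Q_def)
  have lin: "cmod \<zeta> \<le> Q * s" if "\<bar>Re (\<zeta> * d)\<bar> \<le> s" "\<bar>Re (\<zeta> * d')\<bar> \<le> s" for \<zeta> s
  proof -
    \<comment> \<open>Cramer's rule: \<zeta> is recovered from its pairings with the two independent
      vectors.\<close>
    have eq: "\<i> * \<zeta> * of_real (Im (cnj d * d')) = of_real (Re (\<zeta> * d')) * cnj d - of_real (Re (\<zeta> * d)) * cnj d'"
      by (auto simp: complex_eq_iff algebra_simps)
    have "cmod \<zeta> * \<bar>Im (cnj d * d')\<bar> = cmod (\<i> * \<zeta> * of_real (Im (cnj d * d')))"
      by (simp only: norm_mult norm_of_real norm_ii mult_1_left)
    also have "\<dots> \<le> \<bar>Re (\<zeta> * d')\<bar> * cmod d + \<bar>Re (\<zeta> * d)\<bar> * cmod d'"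
      unfolding eq by (rule order_trans[OF norm_triangle_ineq4]) (simp only: norm_mult norm_of_real complex_mod_cnj order_refl)
    also have "\<dots> \<le> s * R + s * R"
      using that R by (intro add_mono mult_mono) auto
    finally show ?thesis using d by (simp add: Q_def field_simps)
  qed
  show ?thesis
  \<comment> \<open>This radius keeps the pairings of the difference with both vectors below 1/2,
    where Jordan's inequality applies. For b = 0 the bound \<open>2 * \<tau> / b\<close> is 0 and
    every positive radius works, hence the summand 1.\<close>
  proof (rule exI[of _ "\<bar>b\<bar> / (4 * R) + (if b = 0 then 1 else 0)"], intro conjI allI impI)
    show "0 < \<bar>b\<bar> / (4 * R) + (if b = 0 then 1 else 0)" using R0 by auto
    fix \<tau> assume \<tau>: "0 < \<tau> \<and> \<tau> \<le> \<bar>b\<bar> / (4 * R) + (if b = 0 then 1 else 0)"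
    show "\<exists>\<sigma>0>0. \<forall>\<sigma> \<eta> \<eta>'. \<sigma> \<le> \<sigma>0 \<longrightarrow> near \<sigma> d d' \<eta> \<longrightarrow> near \<sigma> d d' \<eta>' \<longrightarrow>
            cmod (\<eta> - \<eta>') \<le> 2 * \<tau> / b \<longrightarrow> cmod (\<eta> - \<eta>') \<le> \<tau>"
    proof (rule exI[of _ "\<tau> / Q"], intro conjI allI impI)
      show "0 < \<tau> / Q" using Q0 \<tau> by simp
      fix \<sigma> \<eta> \<eta>'
      assume \<sigma>: "\<sigma> \<le> \<tau> / Q" and n: "near \<sigma> d d' \<eta>" "near \<sigma> d d' \<eta>'" and c: "cmod (\<eta> - \<eta>') \<le> 2 * \<tau> / b"
      show "cmod (\<eta> - \<eta>') \<le> \<tau>"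
      proof (cases "b = 0")
        case True
        then show ?thesis using c \<tau> by simp
      next
        case b: False
        have small: "\<bar>Re ((\<eta> - \<eta>') * e)\<bar> \<le> \<sigma>"
          if e: "cmod e \<le> R" "\<bar>sin (pi * Re (\<eta> * e))\<bar> < \<sigma>" "\<bar>sin (pi * Re (\<eta>' * e))\<bar> < \<sigma>" for e
        proof -
          have "\<bar>Re ((\<eta> - \<eta>') * e)\<bar> \<le> cmod (\<eta> - \<eta>') * cmod e"
            using abs_Re_le_cmod[of "(\<eta> - \<eta>') * e"] by (simp add: norm_mult)
          also have "\<dots> \<le> (2 * \<tau> / b) * R"
            using c e by (intro mult_mono) (auto intro: order_trans[OF norm_ge_zero])
          also have "\<dots> \<le> 2 * \<tau> / \<bar>b\<bar> * R"
            using \<tau> R0 by (intro mult_right_mono) (auto simp: divide_le_eq_1 abs_if field_simps)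
          also have "\<dots> \<le> 1 / 2" using \<tau> b R0 by (simp add: field_simps)
          finally have "\<bar>Re ((\<eta> - \<eta>') * e)\<bar> \<le> \<bar>sin (pi * Re ((\<eta> - \<eta>') * e))\<bar> / 2"
            by (rule abs_le_of_sin_pi)
          also have "\<dots> \<le> (\<bar>sin (pi * Re (\<eta> * e))\<bar> + \<bar>sin (pi * Re (\<eta>' * e))\<bar>) / 2"
            using sin_pi_diff_le[of "Re (\<eta> * e)" "Re (\<eta>' * e)"] by (simp add: left_diff_distrib)
          finally show ?thesis using e by simp
        qed
        have "cmod (\<eta> - \<eta>') \<le> Q * \<sigma>"
          using n R by (intro lin small) (auto simp: near_def)
        also have "\<dots> \<le> \<tau>" using \<sigma> Q0 by (simp add: field_simps)
        finally show ?thesis .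
      qed
    qed
  qed
qed

section \<open>Damped walks of frequencies and their products\<close>

text \<open>Arises from four unit vectors in two pairs: if one pair shrinks by
  \<open>sqrt (1 - \<sigma>\<^sup>2)\<close> and the other is bounded trivially, the average shrinks
  by the mean of the two factors.\<close>

definition damping :: "real \<Rightarrow> real" where "damping \<sigma> = (1 + sqrt (1 - \<sigma>\<^sup>2)) / 2"

lemma damping_less_1: "0 < \<sigma> \<Longrightarrow> damping \<sigma> < 1"
  by (simp add: damping_def)

lemma damping_pos: "\<sigma> \<le> 1 \<Longrightarrow> 0 < \<sigma> \<Longrightarrow> 0 < damping \<sigma>"
  by (simp add: damping_def add_pos_nonneg abs_square_le_1)

text \<open>
  One step of a multiplicative random walk of frequencies.  The steps with \<open>g j\<close> damp \<open>F\<close> away from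
  a lattice, and the other steps have total probability at most \<open>\<delta>\<close>.
\<close>

locale damped_walk =
  fixes F :: "complex \<Rightarrow> real" and b B \<delta> :: real
    and J :: "'i set" and q :: "'i \<Rightarrow> real" and \<beta> :: "'i \<Rightarrow> complex" and g :: "'i \<Rightarrow> bool" and d d' :: "'i \<Rightarrow> complex"
  assumes finite_J: "finite J" and q_nonneg: "\<And>j. j \<in> J \<Longrightarrow> 0 \<le> q j" and sum_q: "sum q J = 1"
    and \<beta>_ge: "\<And>j. j \<in> J \<Longrightarrow> b \<le> cmod (\<beta> j)" and \<beta>_le: "\<And>j. j \<in> J \<Longrightarrow> cmod (\<beta> j) \<le> B"
    and bad: "sum q {j \<in> J. \<not> g j} \<le> \<delta>"
    and indep: "\<And>j. j \<in> J \<Longrightarrow> g j \<Longrightarrow> Im (cnj (d j) * d' j) \<noteq> 0"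
    and step: "\<And>\<sigma> \<eta>. 0 < \<sigma> \<Longrightarrow> \<sigma> \<le> 1 \<Longrightarrow>
      F \<eta> \<le> (\<Sum>j\<in>J. q j * ((if g j \<and> \<not> near \<sigma> (d j) (d' j) \<eta> then damping \<sigma> else 1) * F (\<beta> j * \<eta>)))"

text \<open>The index set is hidden behind naturals so that iterating a walk, whose indices become
  pairs, stays within one type; \<open>dampedI\<close> recodes any countable index type.\<close>

definition damped :: "(complex \<Rightarrow> real) \<Rightarrow> real \<Rightarrow> real \<Rightarrow> real \<Rightarrow> bool" where
  "damped F b B \<delta> \<longleftrightarrow> (\<exists>(J::nat set) q \<beta> g d d'. damped_walk F b B \<delta> J q \<beta> g d d')"

lemma dampedI:
  fixes J :: "'i::countable set"
  assumes "damped_walk F b B \<delta> J q \<beta> g d d'"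
  shows "damped F b B \<delta>"
proof -
  interpret damped_walk F b B \<delta> J q \<beta> g d d' by (rule assms)
  let ?n = "from_nat :: nat \<Rightarrow> 'i"
  have inj: "inj_on to_nat X" for X :: "'i set" by (simp add: inj_on_def)
  have eq: "{j \<in> to_nat ` J. \<not> g (?n j)} = to_nat ` {j \<in> J. \<not> g j}" by auto
  have "damped_walk F b B \<delta> (to_nat ` J) (\<lambda>n. q (?n n)) (\<lambda>n. \<beta> (?n n)) (\<lambda>n. g (?n n)) (\<lambda>n. d (?n n)) (\<lambda>n. d' (?n n))"
  proof
    fix \<sigma> \<eta> assume "0 < (\<sigma>::real)" "\<sigma> \<le> 1"
    then show "F \<eta> \<le> (\<Sum>j\<in>to_nat ` J. q (?n j) * ((if g (?n j) \<and> \<not> near \<sigma> (d (?n j)) (d' (?n j)) \<eta> then damping \<sigma> else 1) * F (\<beta> (?n j) * \<eta>)))"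
      using step[of \<sigma> \<eta>] by (simp add: sum.reindex[OF inj])
  qed (use finite_J q_nonneg sum_q \<beta>_ge \<beta>_le bad indep in \<open>auto simp: eq sum.reindex[OF inj]\<close>)
  then show ?thesis unfolding damped_def by blast
qed

text \<open>Two steps in succession form one step that is good as soon as either of them is. It is
  bad only if both are, so the bad probabilities multiply.\<close>

lemma damped_mult:
  assumes "damped F b B \<delta>" "damped F b' B' \<delta>'" and F: "\<And>\<eta>. 0 \<le> F \<eta>"
    and b: "0 < b" "0 < b'"
  shows "damped F (b * b') (B * B') (\<delta> * \<delta>')"
proof -
  obtain J :: "nat set" and q \<beta> g d e where J: "damped_walk F b B \<delta> J q \<beta> g d e"
    using assms(1) unfolding damped_def by blast
  obtain J' :: "nat set" and q' \<beta>' g' d' e' where J': "damped_walk F b' B' \<delta>' J' q' \<beta>' g' d' e'"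
    using assms(2) unfolding damped_def by blast
  interpret L: damped_walk F b B \<delta> J q \<beta> g d e by (rule J)
  interpret R: damped_walk F b' B' \<delta>' J' q' \<beta>' g' d' e' by (rule J')
  \<comment> \<open>The second step is tested at \<open>\<beta> i * \<eta>\<close>, so its vectors
    are multiplied by \<open>\<beta> i\<close> when referred back to \<eta>. If both steps are good,
    only the first damping is kept.\<close>
  have "damped_walk F (b * b') (B * B') (\<delta> * \<delta>') (J \<times> J') (\<lambda>(i,j). q i * q' j) (\<lambda>(i,j). \<beta>' j * \<beta> i)
      (\<lambda>(i,j). g i \<or> g' j) (\<lambda>(i,j). if g i then d i else \<beta> i * d' j) (\<lambda>(i,j). if g i then e i else \<beta> i * e' j)"
  proof
    show "finite (J \<times> J')" using L.finite_J R.finite_J by simp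
    show "0 \<le> (case x of (i, j) \<Rightarrow> q i * q' j)" if "x \<in> J \<times> J'" for x using that L.q_nonneg R.q_nonneg by auto
    show "(\<Sum>(i, j)\<in>J \<times> J'. q i * q' j) = 1"
      by (simp add: sum.cartesian_product[symmetric] sum_distrib_left[symmetric] L.sum_q R.sum_q)
    show "b * b' \<le> cmod (case x of (i, j) \<Rightarrow> \<beta>' j * \<beta> i)" if "x \<in> J \<times> J'" for x
      using that L.\<beta>_ge R.\<beta>_ge b by (auto simp: norm_mult mult.commute[of "cmod (\<beta>' _)"] intro!: mult_mono)
    show "cmod (case x of (i, j) \<Rightarrow> \<beta>' j * \<beta> i) \<le> B * B'" if xJ: "x \<in> J \<times> J'" for x
    proof -
      obtain i j where x: "x = (i, j)" "i \<in> J" "j \<in> J'" using xJ by auto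
      then show ?thesis
        using mult_mono[OF L.\<beta>_le[of i] R.\<beta>_le[of j]] order_trans[OF norm_ge_zero L.\<beta>_le[of i]]
        by (simp add: norm_mult mult.commute)
    qed
    have "{x \<in> J \<times> J'. \<not> (case x of (i, j) \<Rightarrow> g i \<or> g' j)} = {j \<in> J. \<not> g j} \<times> {j \<in> J'. \<not> g' j}" by auto
    then have "(\<Sum>(i, j)\<in>{x \<in> J \<times> J'. \<not> (case x of (i, j) \<Rightarrow> g i \<or> g' j)}. q i * q' j) = sum q {j \<in> J. \<not> g j} * sum q' {j \<in> J'. \<not> g' j}"
      by (simp add: sum.cartesian_product[symmetric] sum_product)
    also have "\<dots> \<le> \<delta> * \<delta>'"
    proof (rule mult_mono[OF L.bad R.bad])
      have "0 \<le> sum q {j \<in> J. \<not> g j}" by (intro sum_nonneg) (simp add: L.q_nonneg)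
      then show "0 \<le> \<delta>" using L.bad by linarith
      show "0 \<le> sum q' {j \<in> J'. \<not> g' j}" by (intro sum_nonneg) (simp add: R.q_nonneg)
    qed
    finally show "(\<Sum>(i, j)\<in>{x \<in> J \<times> J'. \<not> (case x of (i, j) \<Rightarrow> g i \<or> g' j)}. q i * q' j) \<le> \<delta> * \<delta>'" .
    show "Im (cnj (case x of (i, j) \<Rightarrow> if g i then d i else \<beta> i * d' j) * (case x of (i, j) \<Rightarrow> if g i then e i else \<beta> i * e' j)) \<noteq> 0"
      if xJ: "x \<in> J \<times> J'" and gx: "case x of (i, j) \<Rightarrow> g i \<or> g' j" for x
    proof -
      obtain i j where x: "x = (i, j)" "i \<in> J" "j \<in> J'" using xJ by auto
      have "\<beta> i \<noteq> 0" using L.\<beta>_ge[of i] x b by auto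
      \<comment> \<open>Multiplying both vectors by \<open>\<beta> i\<close> scales their
        determinant by its squared modulus, so independence persists.\<close>
      have eq: "Im (cnj (\<beta> i * d' j) * (\<beta> i * e' j)) = (cmod (\<beta> i))\<^sup>2 * Im (cnj (d' j) * e' j)"
      proof -
        have "cnj (\<beta> i * d' j) * (\<beta> i * e' j) = (\<beta> i * cnj (\<beta> i)) * (cnj (d' j) * e' j)" by simp
        also have "\<dots> = of_real ((cmod (\<beta> i))\<^sup>2) * (cnj (d' j) * e' j)" by (simp only: complex_norm_square)
        finally show ?thesis by (simp only: Im_complex_of_real Re_complex_of_real times_complex.sel mult_zero_left add_0_right)
      qed
      show ?thesis
      proof (cases "g i")
        case True then show ?thesis using L.indep x by simp
      next
        case False
        then show ?thesis using gx R.indep[of j] \<open>\<beta> i \<noteq> 0\<close> by (simp only: x prod.case if_False eq) simp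
      qed
    qed
    fix \<sigma> \<eta> assume \<sigma>: "(0::real) < \<sigma>" "\<sigma> \<le> 1"
    note th = damping_less_1[OF \<sigma>(1)] damping_pos[OF \<sigma>(2,1)]
    let ?w = "\<lambda>i. (if g i \<and> \<not> near \<sigma> (d i) (e i) \<eta> then damping \<sigma> else 1)"
    let ?w' = "\<lambda>\<eta> i. (if g' i \<and> \<not> near \<sigma> (d' i) (e' i) \<eta> then damping \<sigma> else 1)"
    let ?v = "\<lambda>i j. (if (g i \<or> g' j) \<and> \<not> near \<sigma> (if g i then d i else \<beta> i * d' j) (if g i then e i else \<beta> i * e' j) \<eta> then damping \<sigma> else 1)"
    have "F \<eta> \<le> (\<Sum>i\<in>J. q i * (?w i * F (\<beta> i * \<eta>)))" by (rule L.step[OF \<sigma>])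
    also have "\<dots> \<le> (\<Sum>i\<in>J. q i * (?w i * (\<Sum>j\<in>J'. q' j * (?w' (\<beta> i * \<eta>) j * F (\<beta>' j * (\<beta> i * \<eta>))))))"
      using th L.q_nonneg by (intro sum_mono mult_left_mono R.step[OF \<sigma>]) auto
    also have "\<dots> = (\<Sum>i\<in>J. \<Sum>j\<in>J'. q i * q' j * (?w i * ?w' (\<beta> i * \<eta>) j * F (\<beta>' j * \<beta> i * \<eta>)))"
      by (simp add: sum_distrib_left mult_ac)
    also have "\<dots> \<le> (\<Sum>i\<in>J. \<Sum>j\<in>J'. q i * q' j * (?v i j * F (\<beta>' j * \<beta> i * \<eta>)))"
    proof (intro sum_mono mult_left_mono mult_right_mono F)
      fix i j assume "i \<in> J" "j \<in> J'"
      show "?w i * ?w' (\<beta> i * \<eta>) j \<le> ?v i j"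
        using th by (auto simp: near_mult mult_le_one mult_left_le)
      show "0 \<le> q i * q' j" using L.q_nonneg[OF \<open>i \<in> J\<close>] R.q_nonneg[OF \<open>j \<in> J'\<close>] by simp
    qed
    also have "\<dots> = (\<Sum>x\<in>J \<times> J'. (case x of (i, j) \<Rightarrow> q i * q' j) *
       ((if (case x of (i, j) \<Rightarrow> g i \<or> g' j) \<and>
            \<not> near \<sigma> (case x of (i, j) \<Rightarrow> if g i then d i else \<beta> i * d' j)
                (case x of (i, j) \<Rightarrow> if g i then e i else \<beta> i * e' j) \<eta>
         then damping \<sigma> else 1) * F ((case x of (i, j) \<Rightarrow> \<beta>' j * \<beta> i) * \<eta>)))"
      by (simp add: sum.cartesian_product case_prod_unfold)
    finally show "F \<eta> \<le> \<dots>" .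
  qed
  then show ?thesis by (rule dampedI)
qed

lemma damped_power:
  assumes "damped F b B \<delta>" "\<And>\<eta>. 0 \<le> F \<eta>" "0 < b"
  shows "damped F (b ^ Suc k) (B ^ Suc k) (\<delta> ^ Suc k)"
proof (induction k)
  case 0
  then show ?case using assms(1) by simp
next
  case (Suc k)
  have "damped F (b ^ Suc k * b) (B ^ Suc k * B) (\<delta> ^ Suc k * \<delta>)"
    using assms by (intro damped_mult Suc) auto
  then show ?case by (simp add: mult_ac)
qed

lemma finite_pos_lower_bound:
  fixes t :: "'i \<Rightarrow> real"
  assumes "finite J" "\<And>j. j \<in> J \<Longrightarrow> 0 < t j"
  shows "\<exists>u>0. u \<le> 1 \<and> (\<forall>j\<in>J. u \<le> t j)"
  using assms by (intro exI[of _ "Min (insert 1 (t ` J))"]) auto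

text \<open>The least exponent satisfying the first bound overshoots by at most one factor
  \<open>Q\<close>.\<close>

lemma power_between:
  fixes Q t :: real
  assumes "0 < Q" "Q < 1" "1 \<le> t"
  obtains e :: nat where "Q ^ e * t \<le> 1" "Q \<le> Q ^ e * t"
proof -
  define e where "e = (LEAST e. Q ^ e * t \<le> 1)"
  obtain n where "Q ^ n < 1 / t" using real_arch_pow_inv[of "1 / t" Q] assms by auto
  then have "Q ^ n * t \<le> 1" using assms by (simp add: field_simps)
  then have e: "Q ^ e * t \<le> 1" unfolding e_def by (rule LeastI)
  moreover have "Q \<le> Q ^ e * t"
  proof (cases e)
    case 0
    then show ?thesis using assms by simp
  next
    case (Suc m)
    then have "\<not> Q ^ m * t \<le> 1" using not_less_Least[of m] e_def by (metis lessI)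
    then have "Q * 1 \<le> Q * (Q ^ m * t)" using assms by (intro mult_left_mono) auto
    then show ?thesis by (simp add: Suc mult_ac)
  qed
  ultimately show ?thesis by (rule that)
qed

lemma eventually_power_mult_less:
  fixes x c \<epsilon> :: real
  assumes "0 \<le> x" "x < 1" "0 < \<epsilon>"
  shows "eventually (\<lambda>n. c * x ^ n < \<epsilon>) sequentially"
proof -
  have "(\<lambda>n. c * x ^ n) \<longlonglongrightarrow> c * 0"
    using assms by (intro tendsto_mult tendsto_const LIMSEQ_power_zero) auto
  then show ?thesis using assms by (simp add: order_tendstoD(2))
qed

text \<open>With u = 1 / \<theta> - 1 the power is at most exp (u / 2), and u \<le> 1 gives exp (u /
  2) < 1 + u = 1 / \<theta>. The condition on \<delta> and l does not mention \<theta>, so both can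
  be fixed before the damping is known.\<close>

lemma chernoff_factor:
  fixes \<delta> \<theta> :: real and l :: nat
  assumes "0 \<le> \<delta>" "\<delta> * real l \<le> 1 / 2" "1 / 2 \<le> \<theta>" "\<theta> < 1"
  shows "\<theta> * (1 + \<delta> * (1 / \<theta> - 1)) ^ l < 1"
proof -
  define u where "u = 1 / \<theta> - 1"
  have u: "0 < u" "u \<le> 1" using assms by (auto simp: u_def field_simps)
  have "(1 + \<delta> * u) ^ l \<le> exp (\<delta> * u) ^ l"
    using u assms by (intro power_mono exp_ge_add_one_self) auto
  also have "\<dots> = exp (\<delta> * real l * u)" by (simp add: exp_of_nat_mult[symmetric] mult_ac)
  also have "\<dots> \<le> exp (u / 2)"
    using mult_right_mono[OF assms(2), of u] u by simp
  also have "\<dots> \<le> 1 + u / 2 + (u / 2)\<^sup>2" using u by (intro exp_bound) auto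
  also have "\<dots> < 1 + u"
  proof -
    have "u * u \<le> 1 * u" using u by (intro mult_right_mono) auto
    moreover have "(u / 2)\<^sup>2 = u * u / 4" by (simp add: power2_eq_square)
    ultimately show ?thesis using u by linarith
  qed
  also have "1 + u = 1 / \<theta>" by (simp add: u_def)
  finally show ?thesis using assms by (simp add: u_def field_simps)
qed

section \<open>Decay of averages over a Frostman measure\<close>

text \<open>\<open>le_few_prob_plus\<close> splits \<open>F\<close> into the probability of few
  exceptional steps and a Chernoff term. The first is averaged by
  \<open>few_prob_integral_le\<close>, where the Frostman condition gives each \<tau>-disc mass
  \<open>C0 * (\<tau> / cmod \<eta>) powr s\<close>. With n = l e steps both parts decay
  geometrically in e, which is of the order of ln |\<eta>|.\<close>

lemma damped_imp_average_decay:
  fixes F :: "complex \<Rightarrow> real" and Y :: "'a \<Rightarrow> complex"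
  assumes damped: "damped F b1 B1 \<delta>0" and F: "\<And>\<eta>. 0 \<le> F \<eta>" "\<And>\<eta>. F \<eta> \<le> 1"
    and Fm: "F \<in> borel_measurable borel"
    and b1: "0 < b1" and B1: "0 < B1" "B1 < 1" and \<delta>0: "0 \<le> \<delta>0" "\<delta>0 < 1"
    and \<mu>: "prob_space \<mu>" and Y: "Y \<in> borel_measurable \<mu>" "\<And>x. x \<in> space \<mu> \<Longrightarrow> cmod (Y x) \<le> C1"
    and frostman: "\<And>c r. 0 < r \<Longrightarrow> measure \<mu> {x \<in> space \<mu>. cmod (Y x - c) \<le> r} \<le> C0 * r powr s"
    and C0: "0 \<le> C0" and s: "0 < s"
  shows "\<exists>C>0. \<exists>\<sigma>>0. \<forall>\<eta>. 1 \<le> cmod \<eta> \<longrightarrow> (\<integral>x. F (\<eta> * Y x) \<partial>\<mu>) \<le> C * cmod \<eta> powr - \<sigma>"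
proof -
  interpret prob_space \<mu> by (rule \<mu>)
  define C1' where "C1' = max 1 C1"
  have C1': "1 \<le> C1'" "\<And>x. x \<in> space \<mu> \<Longrightarrow> cmod (Y x) \<le> C1'" using Y(2) by (auto simp: C1'_def le_max_iff_disj)
  obtain M1 :: nat where M1: "1 \<le> M1" and cov: "\<And>c :: complex. \<And>\<tau>. 0 < \<tau> \<Longrightarrow>
      \<exists>S. finite S \<and> card S \<le> M1 \<and> cball c (\<tau> * 1) \<subseteq> (\<Union>s\<in>S. cball s (\<tau> * b1))"
    using ball_cover[OF b1, of 1] by metis
  \<comment> \<open>\<open>x\<close> is the Frostman gain of an elementary step, \<open>M1\<close>
    the covering loss of an exceptional one.\<close>
  define x where "x = B1 powr s"
  have x: "0 < x" "x < 1" using B1 s powr_less_mono2[of s B1 1] by (auto simp: x_def)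
  obtain l where l: "real M1 * x ^ l < 1" "0 < l"
    using eventually_conj[OF eventually_power_mult_less[of x 1 "real M1"] eventually_gt_at_top[of 0]] x
    by (auto dest!: eventually_happens)
  define y where "y = real M1 * x ^ l"
  have y: "0 < y" "y < 1" using l x M1 by (auto simp: y_def)
  \<comment> \<open>The gain of l steps beats one covering by the factor \<open>y\<close>. Its k-th
    power also beats \<open>2 ^ l\<close>, and \<open>\<delta>0 ^ k\<close> becomes small against 1
    / l.\<close>
  obtain k where k: "real l * \<delta>0 ^ k < 1 / 2" "2 ^ l * y ^ k < 1 / 2" "0 < k"
    using eventually_conj[OF eventually_power_mult_less[of \<delta>0 "1 / 2" "real l"]
       eventually_conj[OF eventually_power_mult_less[of y "1 / 2" "2 ^ l"] eventually_gt_at_top[of 0]]] y \<delta>0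
    by (auto dest!: eventually_happens)
  obtain k' where k': "k = Suc k'" using k by (cases k) auto
  define b where "b = b1 ^ k"
  define B where "B = B1 ^ k"
  define \<delta> where "\<delta> = \<delta>0 ^ k"
  have b: "0 < b" using b1 by (simp add: b_def)
  have B: "0 < B" "B < 1" using B1 k by (auto simp: B_def power_less_one_iff)
  have \<delta>: "0 \<le> \<delta>" "\<delta> * real l \<le> 1 / 2" using \<delta>0 k by (auto simp: \<delta>_def mult.commute)
  have "damped F b B \<delta>"
    unfolding b_def B_def \<delta>_def k' by (rule damped_power[OF damped F(1) b1])
  then obtain J :: "nat set" and q \<beta> g d d' where "damped_walk F b B \<delta> J q \<beta> g d d'"
    unfolding damped_def by blast
  then interpret damped_walk F b B \<delta> J q \<beta> g d d' .
  define Jg where "Jg = {j \<in> J. g j}"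
  have Jg: "finite Jg" using finite_J by (simp add: Jg_def)
  have "\<exists>\<tau>0>0. \<forall>\<tau>. 0 < \<tau> \<and> \<tau> \<le> \<tau>0 \<longrightarrow> (\<exists>\<sigma>0>0. \<forall>\<sigma> \<eta> \<eta>'. \<sigma> \<le> \<sigma>0 \<longrightarrow> near \<sigma> (d j) (d' j) \<eta> \<longrightarrow> near \<sigma> (d j) (d' j) \<eta>' \<longrightarrow>
            cmod (\<eta> - \<eta>') \<le> 2 * \<tau> / b \<longrightarrow> cmod (\<eta> - \<eta>') \<le> \<tau>)" if "j \<in> Jg" for j
    using that by (intro near_separated indep) (auto simp: Jg_def)
  then obtain t where t: "\<And>j. j \<in> Jg \<Longrightarrow> 0 < t j" "\<And>j \<tau>. j \<in> Jg \<Longrightarrow> 0 < \<tau> \<Longrightarrow> \<tau> \<le> t j \<Longrightarrow> 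
      (\<exists>\<sigma>0>0. \<forall>\<sigma> \<eta> \<eta>'. \<sigma> \<le> \<sigma>0 \<longrightarrow> near \<sigma> (d j) (d' j) \<eta> \<longrightarrow> near \<sigma> (d j) (d' j) \<eta>' \<longrightarrow>
            cmod (\<eta> - \<eta>') \<le> 2 * \<tau> / b \<longrightarrow> cmod (\<eta> - \<eta>') \<le> \<tau>)"
    by metis
  \<comment> \<open>\<open>near_separated\<close> allows any smaller \<tau>, but its tolerance
    depends on \<tau>; so a common \<tau> is fixed first and a common \<sigma> afterwards.\<close>
  obtain \<tau> where \<tau>: "0 < \<tau>" "\<And>j. j \<in> Jg \<Longrightarrow> \<tau> \<le> t j" using finite_pos_lower_bound[of Jg t] Jg t(1) by auto
  obtain sg where sg: "\<And>j. j \<in> Jg \<Longrightarrow> 0 < sg j" "\<And>j \<sigma> \<eta> \<eta>'. j \<in> Jg \<Longrightarrow> \<sigma> \<le> sg j \<Longrightarrow> near \<sigma> (d j) (d' j) \<eta> \<Longrightarrow> near \<sigma> (d j) (d' j) \<eta>' \<Longrightarrow>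
            cmod (\<eta> - \<eta>') \<le> 2 * \<tau> / b \<Longrightarrow> cmod (\<eta> - \<eta>') \<le> \<tau>"
    using t(2)[OF _ \<tau>(1) \<tau>(2)] by metis
  obtain \<sigma> where \<sigma>: "0 < \<sigma>" "\<sigma> \<le> 1" "\<And>j. j \<in> Jg \<Longrightarrow> \<sigma> \<le> sg j" using finite_pos_lower_bound[of Jg sg] Jg sg(1) by auto
  \<comment> \<open>Steps without damping count as exceptional everywhere, as
    \<open>le_few_prob_plus\<close> requires.\<close>
  define X where "X j \<eta> \<longleftrightarrow> \<not> (g j \<and> near \<sigma> (d j) (d' j) \<eta>)" for j \<eta>
  have Xm: "Measurable.pred borel (X j)" for j unfolding X_def[abs_def] by measurable
  define \<theta> where "\<theta> = max (damping \<sigma>) (1 / 2)"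
  have \<theta>: "1 / 2 \<le> \<theta>" "\<theta> < 1" "damping \<sigma> \<le> \<theta>" using damping_less_1[OF \<sigma>(1)] by (auto simp: \<theta>_def)
  define D where "D = 1 + \<delta> * (1 / \<theta> - 1)"
  define z where "z = \<theta> * D ^ l"
  have D: "1 \<le> D" using \<theta> \<delta> by (simp add: D_def)
  have z: "0 < z" "z < 1" using chernoff_factor[OF \<delta> \<theta>(1,2)] \<theta> D by (auto simp: z_def D_def)
  define M where "M = M1 ^ k"
  have covM: "\<exists>S. finite S \<and> card S \<le> M \<and> cball (c::complex) (\<tau> / b) \<subseteq> (\<Union>s\<in>S. cball s \<tau>)" for c
    unfolding M_def b_def by (rule ball_cover_power[OF cov b1 \<tau>(1)])
  obtain M0 :: nat where covM0: "\<exists>S. finite S \<and> card S \<le> M0 \<and> cball (0::complex) 1 \<subseteq> (\<Union>s\<in>S. cball s \<tau>)"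
    using ball_cover[OF \<tau>(1), of 1] by (metis mult_1_left zero_less_one)
  define Q where "Q = B ^ l"
  have Q: "0 < Q" "Q < 1" using B l by (auto simp: Q_def power_less_one_iff)
  have PF: "F \<eta> \<le> few_prob J q \<beta> X n e \<eta> + \<theta> ^ e * D ^ n" for n e \<eta>
    unfolding D_def
  proof (rule le_few_prob_plus[where g = g])
    fix \<eta>
    have "F \<eta> \<le> (\<Sum>j\<in>J. q j * ((if g j \<and> \<not> near \<sigma> (d j) (d' j) \<eta> then damping \<sigma> else 1) * F (\<beta> j * \<eta>)))"
      by (rule step[OF \<sigma>(1,2)])
    also have "\<dots> \<le> (\<Sum>j\<in>J. q j * ((if g j \<and> X j \<eta> then \<theta> else 1) * F (\<beta> j * \<eta>)))"
      using \<theta> F by (intro sum_mono mult_left_mono mult_right_mono q_nonneg) (auto simp: X_def)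
    finally show "F \<eta> \<le> \<dots>" .
  qed (use finite_J q_nonneg sum_q F bad \<theta> in \<open>auto simp: X_def\<close>)
  have int_few: "(\<integral>x. few_prob J q \<beta> X n e (\<eta> * Y x) \<partial>\<mu>) \<le> 2 ^ n * real M ^ e * real M0 * (C0 * (\<tau> / cmod \<eta>) powr s)"
    if \<eta>: "\<eta> \<noteq> 0" "B ^ n * (C1' * cmod \<eta>) \<le> 1" for n e \<eta>
  proof -
    have "(\<integral>x. indicator (space \<mu>) x * few_prob J q \<beta> X n e (\<eta> * Y x) \<partial>\<mu>) \<le> 2 ^ n * real M ^ e * real M0 * (C0 * (\<tau> / cmod \<eta>) powr s)"
    proof (rule few_prob_integral_le[where b = b and B = B and \<tau> = \<tau>])
      show "cmod (\<eta> - \<eta>') \<le> \<tau>" if "j \<in> J" "\<not> X j \<eta>" "\<not> X j \<eta>'" "cmod (\<eta> - \<eta>') \<le> 2 * \<tau> / b" for j \<eta> \<eta>'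
        using that sg(2)[of j \<sigma> \<eta> \<eta>'] \<sigma>(3)[of j] by (auto simp: X_def Jg_def)
      show "measure \<mu> {x \<in> space \<mu>. cmod (\<eta> * Y x - c) \<le> \<tau>} \<le> C0 * (\<tau> / cmod \<eta>) powr s" for c
      proof -
        have "cmod (\<eta> * Y x - c) = cmod \<eta> * cmod (Y x - c / \<eta>)" for x
          using \<eta> by (simp add: norm_mult[symmetric] right_diff_distrib)
        then have "{x \<in> space \<mu>. cmod (\<eta> * Y x - c) \<le> \<tau>} = {x \<in> space \<mu>. cmod (Y x - c / \<eta>) \<le> \<tau> / cmod \<eta>}"
          using \<eta> by (auto simp: field_simps)
        then show ?thesis using frostman[of "\<tau> / cmod \<eta>" "c / \<eta>"] \<eta> \<tau> by simp
      qed
      show "B ^ n * cmod (\<eta> * Y x) \<le> 1" if "x \<in> space \<mu>" for x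
      proof -
        have "B ^ n * cmod (\<eta> * Y x) \<le> B ^ n * (C1' * cmod \<eta>)"
          using C1'(2)[OF that] B by (auto simp: norm_mult mult.commute[of "cmod \<eta>"] intro!: mult_left_mono mult_right_mono)
        then show ?thesis using \<eta> by simp
      qed
      show "(\<lambda>x. \<eta> * Y x) \<in> borel_measurable \<mu>" using Y(1) by measurable
    qed (use finite_J q_nonneg sum_q \<beta>_ge \<beta>_le b B Xm covM covM0 \<mu> in \<open>auto intro: prob_space.finite_measure\<close>)
    moreover have "(\<integral>x. indicator (space \<mu>) x * few_prob J q \<beta> X n e (\<eta> * Y x) \<partial>\<mu>) = (\<integral>x. few_prob J q \<beta> X n e (\<eta> * Y x) \<partial>\<mu>)"
      by (rule Bochner_Integration.integral_cong) auto
    ultimately show ?thesis by simp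
  qed
  define C2 where "C2 = real M0 * C0 * (\<tau> * C1' / Q) powr s"
  have C2: "0 \<le> C2" using C0 by (simp add: C2_def)
  define w where "w = max (1 / 2) z"
  have w: "0 < w" "w < 1" using z by (auto simp: w_def)
  \<comment> \<open>Chosen so that \<open>w = Q powr \<sigma>'\<close>, which turns
    \<open>w ^ e\<close> into a power of |\<eta>| because \<open>Q ^ e\<close> is at most 1 /
    |\<eta>|.\<close>
  define \<sigma>' where "\<sigma>' = ln w / ln Q"
  have \<sigma>': "0 < \<sigma>'" using w Q by (simp add: \<sigma>'_def divide_neg_neg)
  have wQ: "w = Q powr \<sigma>'" using Q w by (simp add: powr_def \<sigma>'_def)
  show ?thesis
  proof (rule exI[of _ "C2 + 1"], intro conjI, use C2 in simp, rule exI[of _ \<sigma>'], intro conjI \<sigma>' allI impI)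
    fix \<eta> :: complex assume \<eta>: "1 \<le> cmod \<eta>"
    then have \<eta>0: "\<eta> \<noteq> 0" by auto
    have "1 * 1 \<le> C1' * cmod \<eta>" using \<eta> C1' by (intro mult_mono) auto
    then obtain e where e: "Q ^ e * (C1' * cmod \<eta>) \<le> 1" "Q \<le> Q ^ e * (C1' * cmod \<eta>)"
      using power_between[OF Q, of "C1' * cmod \<eta>"] by auto
    \<comment> \<open>One exceptional step is allowed per l steps. After n steps all frequencies lie
      in the unit disc, where one cover by \<open>M0\<close> discs suffices.\<close>
    define n where "n = l * e"
    have Qe: "B ^ n = Q ^ e" by (simp add: n_def Q_def power_mult)
    have [measurable]: "few_prob J q \<beta> X n e \<in> borel_measurable borel"
      by (rule few_prob_measurable) (rule Xm)
    note [measurable] = Y(1) Fm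
    have bnd: "\<bar>few_prob J q \<beta> X n e \<eta>\<bar> \<le> 1" for \<eta>
      using few_prob_nonneg[of J q \<beta> X n e \<eta>] few_prob_le_1[of J q \<beta> X n e \<eta>] q_nonneg sum_q by auto
    have i1: "integrable \<mu> (\<lambda>x. few_prob J q \<beta> X n e (\<eta> * Y x))"
      by (rule integrable_const_bound[where B = 1]) (use bnd in auto)
    have i2: "integrable \<mu> (\<lambda>x. F (\<eta> * Y x))"
      by (rule integrable_const_bound[where B = 1]) (use F in auto)
    have "(\<integral>x. F (\<eta> * Y x) \<partial>\<mu>) \<le> (\<integral>x. few_prob J q \<beta> X n e (\<eta> * Y x) + \<theta> ^ e * D ^ n \<partial>\<mu>)"
      using i1 i2 by (intro integral_mono PF) auto
    also have "\<dots> = (\<integral>x. few_prob J q \<beta> X n e (\<eta> * Y x) \<partial>\<mu>) + \<theta> ^ e * D ^ n"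
      using i1 by (subst Bochner_Integration.integral_add) (auto simp: prob_space)
    also have "\<dots> \<le> 2 ^ n * real M ^ e * real M0 * (C0 * (\<tau> / cmod \<eta>) powr s) + \<theta> ^ e * D ^ n"
      using int_few[OF \<eta>0, of n e] e(1) Qe by simp
    also have "\<theta> ^ e * D ^ n = z ^ e" by (simp add: z_def n_def power_mult power_mult_distrib)
    also have "2 ^ n * real M ^ e * real M0 * (C0 * (\<tau> / cmod \<eta>) powr s) \<le> C2 * (1 / 2) ^ e"
    proof -
      have "\<tau> / cmod \<eta> \<le> \<tau> * C1' / Q * Q ^ e"
      proof -
        have "\<tau> * Q \<le> \<tau> * (Q ^ e * (C1' * cmod \<eta>))" using e(2) \<tau> by (intro mult_left_mono) auto
        then show ?thesis using Q \<eta> \<eta>0 by (simp add: field_simps)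
      qed
      then have "(\<tau> / cmod \<eta>) powr s \<le> (\<tau> * C1' / Q * Q ^ e) powr s"
        using \<tau> s by (intro powr_mono2) auto
      also have "\<dots> = (\<tau> * C1' / Q) powr s * (Q powr s) ^ e"
      proof -
        have "(\<tau> * C1' / Q * Q ^ e) powr s = (\<tau> * C1' / Q) powr s * (Q ^ e) powr s"
          by (rule powr_mult)
        moreover have "(Q ^ e) powr s = (Q powr s) ^ e"
          using Q by (simp add: powr_power powr_realpow[symmetric] powr_powr mult.commute)
        ultimately show ?thesis by (simp only:)
      qed
      finally have *: "(\<tau> / cmod \<eta>) powr s \<le> (\<tau> * C1' / Q) powr s * (Q powr s) ^ e" .
      have "Q powr s = x ^ (k * l)"
        using B1 by (simp add: Q_def B_def x_def powr_power powr_realpow[symmetric] powr_powr power_mult[symmetric] mult_ac)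
      then have "2 ^ l * real M * Q powr s = 2 ^ l * y ^ k"
        by (simp add: M_def y_def power_mult_distrib power_mult[symmetric] mult.commute)
      then have h: "2 ^ l * real M * Q powr s \<le> 1 / 2" using k(2) by linarith
      have "2 ^ n * real M ^ e * real M0 * (C0 * (\<tau> / cmod \<eta>) powr s) \<le> 2 ^ n * real M ^ e * real M0 * (C0 * ((\<tau> * C1' / Q) powr s * (Q powr s) ^ e))"
        using * C0 by (intro mult_left_mono) auto
      also have "\<dots> = C2 * (2 ^ l * real M * Q powr s) ^ e"
      proof -
        have "(2::real) ^ n = (2 ^ l) ^ e" by (simp only: n_def power_mult)
        then show ?thesis by (simp add: C2_def power_mult_distrib mult_ac)
      qed
      also have "\<dots> \<le> C2 * (1 / 2) ^ e"
        using h C2 by (intro mult_left_mono power_mono) auto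
      finally show ?thesis .
    qed
    also have "C2 * (1 / 2) ^ e \<le> C2 * w ^ e"
      using C2 by (intro mult_left_mono power_mono) (auto simp: w_def)
    also have "z ^ e \<le> w ^ e" using z by (intro power_mono) (auto simp: w_def)
    also have "C2 * w ^ e + w ^ e = (C2 + 1) * w ^ e" by (simp add: algebra_simps)
    also have "\<dots> \<le> (C2 + 1) * cmod \<eta> powr - \<sigma>'"
    proof (rule mult_left_mono)
      have "w ^ e = (Q ^ e) powr \<sigma>'"
        unfolding wQ using Q by (simp add: powr_power powr_realpow[symmetric] powr_powr mult.commute)
      also have "\<dots> \<le> (1 / cmod \<eta>) powr \<sigma>'"
      proof (rule powr_mono2)
        have "Q ^ e * (1 * cmod \<eta>) \<le> Q ^ e * (C1' * cmod \<eta>)"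
          using C1' Q by (intro mult_left_mono mult_right_mono) auto
        then have "Q ^ e * cmod \<eta> \<le> 1" using e(1) by (simp only: mult_1_left)
        then show "Q ^ e \<le> 1 / cmod \<eta>" using \<eta>0 by (simp add: field_simps)
      qed (use \<sigma>' Q in auto)
      also have "\<dots> = cmod \<eta> powr - \<sigma>'" by (simp add: powr_minus_divide powr_divide)
      finally show "w ^ e \<le> cmod \<eta> powr - \<sigma>'" .
    qed (use C2 in simp)
    finally show "(\<integral>x. F (\<eta> * Y x) \<partial>\<mu>) \<le> (C2 + 1) * cmod \<eta> powr - \<sigma>'" by simp
  qed
qed


section \<open>Fourier transforms of self-similar measures\<close>

lemma norm_cis_add: "cmod (cis x + cis y) = 2 * \<bar>cos ((x - y) / 2)\<bar>"
proof -
  have "cis x + cis y = cis ((x + y) / 2) * (cis ((x - y) / 2) + cis (- ((x - y) / 2)))"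
    by (simp add: distrib_left cis_mult field_simps)
  also have "cis ((x - y) / 2) + cis (- ((x - y) / 2)) = of_real (2 * cos ((x - y) / 2))"
    by (simp add: complex_eq_iff)
  finally show ?thesis by (simp add: norm_mult abs_mult)
qed

locale self_similar_measure = prob_space \<mu> for \<mu> :: "complex measure" +
  fixes I :: "nat set" and p :: "nat \<Rightarrow> real" and a t :: "nat \<Rightarrow> complex" and L :: "complex set"
  assumes finite_I: "finite I" and p_pos: "\<And>i. i \<in> I \<Longrightarrow> 0 < p i" and sum_p: "sum p I = 1"
    and a: "\<And>i. i \<in> I \<Longrightarrow> a i \<noteq> 0" "\<And>i. i \<in> I \<Longrightarrow> cmod (a i) < 1"
    and sets_\<mu> [measurable_cong]: "sets \<mu> = sets borel"
    and compact_L: "compact L" and AE_L: "AE x in \<mu>. x \<in> L"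
    and L_invariant: "\<And>i x. i \<in> I \<Longrightarrow> x \<in> L \<Longrightarrow> a i * x + t i \<in> L"
    and measure_invariant: "\<And>B. B \<in> sets borel \<Longrightarrow> measure \<mu> B = (\<Sum>i\<in>I. p i * measure \<mu> {x. a i * x + t i \<in> B})"
begin

lemma space_\<mu> [simp]: "space \<mu> = UNIV"
  using sets_eq_imp_space_eq[OF sets_\<mu>] by simp

lemma p_nonneg: "i \<in> I \<Longrightarrow> 0 \<le> p i"
  using p_pos by (simp add: less_imp_le)

text \<open>\<mu> is the image of the product of the weights on \<open>I\<close> with \<mu> itself
  under \<open>(i, x) \<mapsto> a i * x + t i\<close>; the formula is then Fubini's theorem.\<close>

lemma integral_invariant:
  fixes h :: "complex \<Rightarrow> 'b::{banach, second_countable_topology}"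
  assumes h [measurable]: "h \<in> borel_measurable borel" and bnd: "\<And>x. norm (h x) \<le> C"
  shows "(\<integral>x. h x \<partial>\<mu>) = (\<Sum>i\<in>I. p i *\<^sub>R (\<integral>x. h (a i * x + t i) \<partial>\<mu>))"
proof -
  note pair_alt = emeasure_pair_measure_alt and em = emeasure_eq_measure
  define PM where "PM = point_measure I (\<lambda>i. ennreal (p i))"
  have PM: "prob_space PM"
    by (rule prob_spaceI) (use finite_I p_nonneg sum_p in \<open>simp add: PM_def emeasure_point_measure_finite space_point_measure sum_ennreal\<close>)
  interpret PM: prob_space PM by (rule PM)
  interpret pair_prob_space PM \<mu> ..
  have cI: "countable I" using finite_I by (rule countable_finite)
  have [measurable]: "(\<lambda>(i, x). a i * x + t i) \<in> borel_measurable (PM \<Otimes>\<^sub>M \<mu>)"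
  proof -
    have s: "sets PM = sets (count_space I)" by (simp add: PM_def sets_point_measure)
    have "(\<lambda>(i, x). a i * x + t i) \<in> borel_measurable (count_space I \<Otimes>\<^sub>M \<mu>)"
      by (rule measurable_pair_measure_countable1[OF cI]) simp
    then show ?thesis
      by (subst measurable_cong_sets[OF sets_pair_measure_cong[OF s refl] refl])
  qed
  define N where "N = distr (PM \<Otimes>\<^sub>M \<mu>) borel (\<lambda>(i, x). a i * x + t i)"
  have "\<mu> = N"
  proof (rule measure_eqI)
    show "sets \<mu> = sets N" by (simp add: N_def sets_\<mu>)
    fix B assume "B \<in> sets \<mu>"
    then have B [measurable]: "B \<in> sets borel" by (simp add: sets_\<mu>)
    have m: "{x. a i * x + t i \<in> B} \<in> sets \<mu>" for i
    proof -
      have "(\<lambda>x. a i * x + t i) -` B \<inter> space \<mu> \<in> sets \<mu>" by measurable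
      then show ?thesis by (simp add: vimage_def)
    qed
    have "emeasure N B = emeasure (PM \<Otimes>\<^sub>M \<mu>) ((\<lambda>(i, x). a i * x + t i) -` B \<inter> space (PM \<Otimes>\<^sub>M \<mu>))"
      unfolding N_def by (rule emeasure_distr) measurable
    also have "\<dots> = (\<integral>\<^sup>+ i. emeasure \<mu> (Pair i -` ((\<lambda>(i, x). a i * x + t i) -` B \<inter> space (PM \<Otimes>\<^sub>M \<mu>))) \<partial>PM)"
      by (rule pair_alt) measurable
    also have "\<dots> = (\<integral>\<^sup>+ i. emeasure \<mu> {x. a i * x + t i \<in> B} \<partial>PM)"
      by (rule nn_integral_cong) (auto simp: space_pair_measure intro!: arg_cong[where f = "emeasure \<mu>"])
    also have "\<dots> = (\<Sum>i\<in>I. ennreal (p i) * emeasure \<mu> {x. a i * x + t i \<in> B})"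
      unfolding PM_def by (subst nn_integral_point_measure_finite[OF finite_I]) (simp add: mult.commute)
    also have "\<dots> = ennreal (\<Sum>i\<in>I. p i * measure \<mu> {x. a i * x + t i \<in> B})"
      by (subst sum_ennreal[symmetric]) (auto simp: p_nonneg em ennreal_mult)
    also have "\<dots> = emeasure \<mu> B" using measure_invariant[OF B] by (simp add: em)
    finally show "emeasure \<mu> B = emeasure N B" by simp
  qed
  have hm: "(\<lambda>x. h ((\<lambda>(i, x). a i * x + t i) x)) \<in> borel_measurable (PM \<Otimes>\<^sub>M \<mu>)" by measurable
  have int: "integrable (PM \<Otimes>\<^sub>M \<mu>) (\<lambda>x. h ((\<lambda>(i, x). a i * x + t i) x))"
    by (rule integrable_const_bound[where B = C]) (use bnd hm in auto)
  have "(\<integral>x. h x \<partial>\<mu>) = (\<integral>x. h x \<partial>N)" using \<open>\<mu> = N\<close> by simp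
  also have "\<dots> = (\<integral>x. h ((\<lambda>(i, x). a i * x + t i) x) \<partial>(PM \<Otimes>\<^sub>M \<mu>))"
    unfolding N_def by (rule integral_distr) measurable
  also have "\<dots> = (\<integral>i. (\<integral>x. h (a i * x + t i) \<partial>\<mu>) \<partial>PM)"
    using integral_fst'[OF int] by simp
  also have "\<dots> = (\<Sum>i\<in>I. p i *\<^sub>R (\<integral>x. h (a i * x + t i) \<partial>\<mu>))"
    unfolding PM_def by (rule lebesgue_integral_point_measure_finite[OF finite_I p_nonneg])
  finally show ?thesis .
qed

text \<open>Fourier transform in the complex bilinear pairing \<open>Re (\<zeta> * x)\<close>, for
  which multiplying x by \<open>a i\<close> amounts to multiplying \<zeta> by \<open>a i\<close>,
  without conjugation.\<close>

definition E :: "complex \<Rightarrow> complex" where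
  "E \<zeta> = (\<integral>x. cis (2 * pi * Re (\<zeta> * x)) \<partial>\<mu>)"

definition F :: "complex \<Rightarrow> real" where
  "F \<zeta> = cmod (E \<zeta>)"

lemma F_nonneg: "0 \<le> F \<zeta>"
  by (simp add: F_def)

lemma integral_norm_le_1:
  fixes h :: "complex \<Rightarrow> complex"
  assumes "\<And>x. cmod (h x) \<le> 1"
  shows "cmod (\<integral>x. h x \<partial>\<mu>) \<le> 1"
proof (cases "integrable \<mu> h")
  case True
  have "cmod (\<integral>x. h x \<partial>\<mu>) \<le> (\<integral>x. cmod (h x) \<partial>\<mu>)" by (rule integral_norm_bound)
  also have "\<dots> \<le> (\<integral>x. 1 \<partial>\<mu>)" using True assms by (intro integral_mono) auto
  finally show ?thesis by (simp add: prob_space[simplified])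
qed (simp add: not_integrable_integral_eq)

lemma F_le_1: "F \<zeta> \<le> 1"
  unfolding F_def E_def by (rule integral_norm_le_1) simp

lemma cis_measurable [measurable]: "cis \<in> borel_measurable borel"
  by (intro borel_measurable_continuous_onI continuous_intros)

lemma F_measurable [measurable]: "F \<in> borel_measurable borel"
  unfolding F_def[abs_def] E_def[abs_def] by measurable

lemma E_step: "E \<zeta> = (\<Sum>i\<in>I. p i * (cis (2 * pi * Re (\<zeta> * t i)) * E (a i * \<zeta>)))"
proof -
  have "E \<zeta> = (\<Sum>i\<in>I. p i *\<^sub>R (\<integral>x. cis (2 * pi * Re (\<zeta> * (a i * x + t i))) \<partial>\<mu>))"
    unfolding E_def by (rule integral_invariant[where C = 1]) auto
  also have "\<dots> = (\<Sum>i\<in>I. p i *\<^sub>R (\<integral>x. cis (2 * pi * Re (\<zeta> * t i)) * cis (2 * pi * Re (a i * \<zeta> * x)) \<partial>\<mu>))"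
    by (simp add: cis_mult algebra_simps)
  also have "\<dots> = (\<Sum>i\<in>I. p i * (cis (2 * pi * Re (\<zeta> * t i)) * E (a i * \<zeta>)))"
    by (simp add: E_def scaleR_conv_of_real)
  finally show ?thesis .
qed

definition word_a :: "nat \<times> nat \<times> nat \<Rightarrow> complex" where
  "word_a = (\<lambda>(i, j, k). a i * a j * a k)"

definition word_t :: "nat \<times> nat \<times> nat \<Rightarrow> complex" where
  "word_t = (\<lambda>(i, j, k). t i + a i * t j + a i * a j * t k)"

definition word_p :: "nat \<times> nat \<times> nat \<Rightarrow> real" where
  "word_p = (\<lambda>(i, j, k). p i * p j * p k)"

lemma E_step3:
  "E \<zeta> = (\<Sum>w\<in>I \<times> I \<times> I. word_p w * (cis (2 * pi * Re (\<zeta> * word_t w)) * E (word_a w * \<zeta>)))"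
proof -
  have "E \<zeta> = (\<Sum>i\<in>I. p i * (cis (2 * pi * Re (\<zeta> * t i)) * (\<Sum>j\<in>I. p j * (cis (2 * pi * Re (a i * \<zeta> * t j)) *
    (\<Sum>k\<in>I. p k * (cis (2 * pi * Re (a j * (a i * \<zeta>) * t k)) * E (a k * (a j * (a i * \<zeta>)))))))))"
    by (simp only: E_step[symmetric])
  also have "\<dots> = (\<Sum>i\<in>I. \<Sum>j\<in>I. \<Sum>k\<in>I. word_p (i, j, k) * (cis (2 * pi * Re (\<zeta> * word_t (i, j, k))) * E (word_a (i, j, k) * \<zeta>)))"
  proof (simp only: sum_distrib_left, intro sum.cong refl)
    fix i j k
    have "cis (2 * pi * Re (\<zeta> * word_t (i, j, k))) = cis (2 * pi * Re (\<zeta> * t i)) * cis (2 * pi * Re (a i * \<zeta> * t j)) * cis (2 * pi * Re (a j * (a i * \<zeta>) * t k))"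
      by (simp add: cis_mult word_t_def algebra_simps)
    then show "p i * (cis (2 * pi * Re (\<zeta> * t i)) * (p j * (cis (2 * pi * Re (a i * \<zeta> * t j)) *
                (p k * (cis (2 * pi * Re (a j * (a i * \<zeta>) * t k)) * E (a k * (a j * (a i * \<zeta>)))))))) =
       word_p (i, j, k) * (cis (2 * pi * Re (\<zeta> * word_t (i, j, k))) * E (word_a (i, j, k) * \<zeta>))"
      by (simp add: word_p_def word_a_def mult_ac)
  qed
  finally show ?thesis by (simp add: sum.cartesian_product)
qed

text \<open>If \<open>near\<close> fails, one of the two pairs has a sine of modulus at least
  \<sigma>, hence a cosine of modulus at most \<open>sqrt (1 - \<sigma>\<^sup>2)\<close>.\<close>

lemma norm_cis_sum4_le:
  assumes "0 < \<sigma>" "\<sigma> \<le> 1"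
  shows "cmod (cis (2 * pi * Re (\<zeta> * x)) + cis (2 * pi * Re (\<zeta> * x')) + (cis (2 * pi * Re (\<zeta> * y)) + cis (2 * pi * Re (\<zeta> * y'))))
     \<le> 4 * (if \<not> near \<sigma> (x - x') (y - y') \<zeta> then damping \<sigma> else 1)" (is "?l \<le> _")
proof -
  have half: "cmod (cis (2 * pi * Re (\<zeta> * x)) + cis (2 * pi * Re (\<zeta> * x'))) = 2 * \<bar>cos (pi * Re (\<zeta> * (x - x')))\<bar>" for x x'
  proof -
    have "cmod (cis (2 * pi * r) + cis (2 * pi * r')) = 2 * \<bar>cos (pi * (r - r'))\<bar>" for r r'
      by (subst norm_cis_add) (simp add: algebra_simps diff_divide_distrib)
    from this[of "Re (\<zeta> * x)" "Re (\<zeta> * x')"] show ?thesis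
      by (simp only: right_diff_distrib minus_complex.sel)
  qed
  have cos_le: "\<bar>cos u\<bar> \<le> sqrt (1 - \<sigma>\<^sup>2)" if "\<not> \<bar>sin u\<bar> < \<sigma>" for u
  proof -
    have "\<sigma>\<^sup>2 \<le> \<bar>sin u\<bar>\<^sup>2" using that assms by (intro power_mono) auto
    then have "(cos u)\<^sup>2 \<le> 1 - \<sigma>\<^sup>2" by (simp add: cos_squared_eq)
    then show ?thesis by (rule real_le_rsqrt[of "\<bar>cos u\<bar>", simplified power2_abs])
  qed
  have "?l \<le> 2 * \<bar>cos (pi * Re (\<zeta> * (x - x')))\<bar> + 2 * \<bar>cos (pi * Re (\<zeta> * (y - y')))\<bar>"
    using norm_triangle_ineq half by metis
  moreover have "\<bar>cos (pi * Re (\<zeta> * (x - x')))\<bar> \<le> 1" "\<bar>cos (pi * Re (\<zeta> * (y - y')))\<bar> \<le> 1" by auto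
  ultimately have *: "?l \<le> 4" "\<not> near \<sigma> (x - x') (y - y') \<zeta> \<Longrightarrow> ?l \<le> 2 + 2 * sqrt (1 - \<sigma>\<^sup>2)"
    using cos_le[of "pi * Re (\<zeta> * (x - x'))"] cos_le[of "pi * Re (\<zeta> * (y - y'))"]
    unfolding near_def by linarith+
  show ?thesis
  proof (cases "near \<sigma> (x - x') (y - y') \<zeta>")
    case True
    then show ?thesis using *(1) by (simp only: not_True_eq_False if_False mult_1_right)
  next
    case False
    then have "4 * (if \<not> near \<sigma> (x - x') (y - y') \<zeta> then damping \<sigma> else 1) = 2 + 2 * sqrt (1 - \<sigma>\<^sup>2)"
      by (simp add: damping_def)
    then show ?thesis using *(2)[OF False] by (simp only:)
  qed
qed

lemma word_p_pos: "w \<in> I \<times> I \<times> I \<Longrightarrow> 0 < word_p w"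
  by (auto simp: word_p_def p_pos)

lemma sum_word_p: "sum word_p (I \<times> I \<times> I) = 1"
proof -
  have "sum word_p (I \<times> I \<times> I) = (\<Sum>i\<in>I. p i * (\<Sum>j\<in>I. p j * sum p I))"
    by (simp add: sum.cartesian_product[symmetric] word_p_def sum_distrib_left mult_ac)
  then show ?thesis by (simp add: sum_p)
qed

text \<open>The four words contribute the same \<open>E (word_a u * \<zeta>)\<close> with four
  phases. Splitting off an equal mass m for each creates one artificial damped step of weight 4 m;
  what remains of the words is estimated by the triangle inequality and counted as bad.\<close>

lemma damped_F:
  assumes W: "u \<in> I \<times> I \<times> I" "u' \<in> I \<times> I \<times> I" "v \<in> I \<times> I \<times> I" "v' \<in> I \<times> I \<times> I"
    and same: "word_a u' = word_a u" "word_a v = word_a u" "word_a v' = word_a u"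
    and indep: "Im (cnj (word_t u - word_t u') * (word_t v - word_t v')) \<noteq> 0"
  shows "\<exists>b B \<delta>. damped F b B \<delta> \<and> 0 < b \<and> 0 < B \<and> B < 1 \<and> 0 \<le> \<delta> \<and> \<delta> < 1"
proof -
  let ?W = "I \<times> I \<times> I"
  have fin: "finite ?W" using finite_I by simp
  \<comment> \<open>The quarter is a safeguard: if some of the four words coincide, a single one may
    have to supply m up to four times.\<close>
  define m where "m = Min (word_p ` {u, u', v, v'}) / 4"
  have m0: "0 < m" using W word_p_pos by (auto simp: m_def)
  have m_le: "4 * m \<le> word_p w" if "w \<in> {u, u', v, v'}" for w
    using that by (auto simp: m_def intro!: Min_le)
  define occ :: "nat \<times> nat \<times> nat \<Rightarrow> real" where
    "occ w = of_bool (w = u) + of_bool (w = u') + of_bool (w = v) + of_bool (w = v')" for w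
  define r where "r w = word_p w - m * occ w" for w
  have r0: "0 \<le> r w" if "w \<in> ?W" for w
  proof (cases "w \<in> {u, u', v, v'}")
    case True
    have "m * occ w \<le> m * 4" using m0 by (intro mult_left_mono) (auto simp: occ_def)
    then show ?thesis using m_le[OF True] by (simp add: r_def)
  next
    case False
    then show ?thesis using word_p_pos[OF that] by (simp add: r_def occ_def)
  qed
  have occ_sum: "(\<Sum>w\<in>?W. of_real (occ w) * h w) = h u + h u' + h v + h v'" for h :: "_ \<Rightarrow> complex"
  proof -
    have "(\<Sum>w\<in>?W. of_real (of_bool (w = x)) * h w) = h x" if "x \<in> ?W" for x
    proof -
      have "(\<Sum>w\<in>?W. of_real (of_bool (w = x)) * h w) = (\<Sum>w\<in>?W. if w = x then h w else 0)"
        by (rule sum.cong) auto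
      then show ?thesis using fin that by simp
    qed
    then show ?thesis using W by (simp add: occ_def distrib_right sum.distrib)
  qed
  have occ_sum1: "sum occ ?W = 4"
  proof -
    have "of_real (sum occ ?W) = (4 :: complex)" using occ_sum[of "\<lambda>_. 1"] by simp
    then show ?thesis by (metis of_real_eq_iff of_real_numeral)
  qed
  have sum_r: "sum r ?W = 1 - 4 * m"
    by (simp add: r_def sum_subtractf sum_distrib_left[symmetric] sum_word_p occ_sum1)
  obtain b0 where b0: "0 < b0" "\<And>i. i \<in> I \<Longrightarrow> b0 \<le> cmod (a i)"
    using finite_pos_lower_bound[of I "\<lambda>i. cmod (a i)"] finite_I a by auto
  obtain c0 where c0: "0 < c0" "c0 \<le> 1" "\<And>i. i \<in> I \<Longrightarrow> c0 \<le> 1 - cmod (a i)"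
    using finite_pos_lower_bound[of I "\<lambda>i. 1 - cmod (a i)"] finite_I a by auto
  \<comment> \<open>The half keeps \<open>B0\<close> positive even for c0 = 1.\<close>
  define B0 where "B0 = 1 - c0 / 2"
  have B0: "0 < B0" "B0 < 1" "\<And>i. i \<in> I \<Longrightarrow> cmod (a i) \<le> B0" using c0 by (auto simp: B0_def dest!: c0(3))
  have word_a_bound: "b0 ^ 3 \<le> cmod (word_a w)" "cmod (word_a w) \<le> B0 ^ 3" if wW: "w \<in> ?W" for w
  proof -
    obtain i j k where w: "w = (i, j, k)" "i \<in> I" "j \<in> I" "k \<in> I" using wW by auto
    have "b0 * b0 * b0 \<le> cmod (a i) * cmod (a j) * cmod (a k)"
      using b0 w by (intro mult_mono) auto
    then show "b0 ^ 3 \<le> cmod (word_a w)" by (simp add: w word_a_def norm_mult power3_eq_cube)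
    have "cmod (a i) * cmod (a j) * cmod (a k) \<le> B0 * B0 * B0"
      using B0 w by (intro mult_mono) auto
    then show "cmod (word_a w) \<le> B0 ^ 3" by (simp add: w word_a_def norm_mult power3_eq_cube)
  qed
  define d where "d = word_t u - word_t u'"
  define d' where "d' = word_t v - word_t v'"
  \<comment> \<open>\<open>None\<close> is the merged damped step, \<open>Some w\<close> the
    remainder \<open>r w\<close> of a word.\<close>
  define J :: "(nat \<times> nat \<times> nat) option set" where "J = insert None (Some ` ?W)"
  have sumJ: "sum h J = h None + (\<Sum>w\<in>?W. h (Some w))" for h :: "_ \<Rightarrow> real"
    using fin by (simp add: J_def sum.reindex)
  have "damped_walk F (b0 ^ 3) (B0 ^ 3) (1 - 4 * m) J (case_option (4 * m) r)
     (case_option (word_a u) word_a) (\<lambda>x. x = None) (\<lambda>_. d) (\<lambda>_. d')"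
  proof
    show "finite J" using fin by (simp add: J_def)
    show "0 \<le> case_option (4 * m) r j" if "j \<in> J" for j using that m0 r0 by (auto simp: J_def)
    show "sum (case_option (4 * m) r) J = 1" by (simp add: sumJ sum_r)
    show "b0 ^ 3 \<le> cmod (case_option (word_a u) word_a j)" "cmod (case_option (word_a u) word_a j) \<le> B0 ^ 3" if "j \<in> J" for j
      using that word_a_bound W by (auto simp: J_def)
    have "{j \<in> J. j \<noteq> None} = Some ` ?W" by (auto simp: J_def)
    then show "sum (case_option (4 * m) r) {j \<in> J. j \<noteq> None} \<le> 1 - 4 * m"
      by (simp add: sum.reindex sum_r)
    show "Im (cnj d * d') \<noteq> 0" using indep by (simp add: d_def d'_def)
    fix \<sigma> \<zeta> assume \<sigma>: "(0::real) < \<sigma>" "\<sigma> \<le> 1"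
    define th where "th = (if \<not> near \<sigma> d d' \<zeta> then damping \<sigma> else 1)"
    let ?e = "\<lambda>w. cis (2 * pi * Re (\<zeta> * word_t w))"
    have "E \<zeta> = (\<Sum>w\<in>?W. of_real (r w) * (?e w * E (word_a w * \<zeta>)) + m * (of_real (occ w) * (?e w * E (word_a w * \<zeta>))))"
      by (subst E_step3) (auto simp: r_def algebra_simps intro!: sum.cong)
    also have "\<dots> = (\<Sum>w\<in>?W. of_real (r w) * (?e w * E (word_a w * \<zeta>))) + m * ((?e u + ?e u' + (?e v + ?e v')) * E (word_a u * \<zeta>))"
      by (simp only: sum.distrib sum_distrib_left[symmetric] occ_sum same) (simp add: algebra_simps)
    finally have "F \<zeta> \<le> cmod (\<Sum>w\<in>?W. of_real (r w) * (?e w * E (word_a w * \<zeta>))) + cmod (m * ((?e u + ?e u' + (?e v + ?e v')) * E (word_a u * \<zeta>)))"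
      unfolding F_def by (simp only: norm_triangle_ineq)
    also have "cmod (\<Sum>w\<in>?W. of_real (r w) * (?e w * E (word_a w * \<zeta>))) \<le> (\<Sum>w\<in>?W. r w * F (word_a w * \<zeta>))"
      by (rule order_trans[OF norm_sum]) (use r0 in \<open>auto simp: norm_mult F_def intro!: sum_mono\<close>)
    also have "cmod (m * ((?e u + ?e u' + (?e v + ?e v')) * E (word_a u * \<zeta>))) = m * (cmod (?e u + ?e u' + (?e v + ?e v')) * F (word_a u * \<zeta>))"
      using m0 by (simp only: norm_mult norm_of_real F_def abs_of_pos)
    also have "\<dots> \<le> m * ((4 * th) * F (word_a u * \<zeta>))"
      unfolding th_def d_def d'_def
      using m0 by (intro mult_left_mono mult_right_mono norm_cis_sum4_le[OF \<sigma>] F_nonneg) auto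
    finally show "F \<zeta> \<le> (\<Sum>j\<in>J. case_option (4 * m) r j * ((if j = None \<and> \<not> near \<sigma> d d' \<zeta> then damping \<sigma> else 1) * F (case_option (word_a u) word_a j * \<zeta>)))"
      by (simp add: sumJ th_def algebra_simps)
  qed
  then have "damped F (b0 ^ 3) (B0 ^ 3) (1 - 4 * m)" by (rule dampedI)
  moreover have "0 \<le> 1 - 4 * m" using sum_r r0 by (metis sum_nonneg)
  ultimately show ?thesis
    using m0 b0 B0 by (intro exI[of _ "b0 ^ 3"] exI[of _ "B0 ^ 3"] exI[of _ "1 - 4 * m"]) (auto simp: power_less_one_iff)
qed

end

lemma norm_cis_diff_le: "cmod (cis x - cis y) \<le> \<bar>x - y\<bar>"
proof -
  have "cmod (cis x - cis y) = cmod (cis x + cis (y + pi))" by (simp add: cis_mult[symmetric])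
  also have "\<dots> = 2 * \<bar>cos ((x - (y + pi)) / 2)\<bar>" by (rule norm_cis_add)
  also have "(x - (y + pi)) / 2 = (x - y) / 2 - pi / 2" by (simp add: field_simps)
  also have "cos \<dots> = sin ((x - y) / 2)" by (simp add: cos_diff)
  also have "2 * \<bar>sin ((x - y) / 2)\<bar> \<le> \<bar>x - y\<bar>"
    using abs_sin_x_le_abs_x[of "(x - y) / 2"] by (simp add: abs_divide field_simps)
  finally show ?thesis .
qed

section \<open>Frostman condition for self-similar measures\<close>

context self_similar_measure begin

text \<open>Levy's concentration function; the supremum over centres absorbs the change of centre
  under a similarity.\<close>

definition max_ball :: "real \<Rightarrow> real" where
  "max_ball r = (SUP c. measure \<mu> {x. cmod (x - c) \<le> r})"

lemma measure_ball_le_max_ball: "measure \<mu> {x. cmod (x - c) \<le> r} \<le> max_ball r"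
  unfolding max_ball_def by (rule cSUP_upper) (auto intro!: bdd_aboveI2[where M = 1])

lemma max_ball_least: "(\<And>c. measure \<mu> {x. cmod (x - c) \<le> r} \<le> m) \<Longrightarrow> max_ball r \<le> m"
  unfolding max_ball_def by (rule cSUP_least) auto

lemma max_ball_nonneg: "0 \<le> max_ball r"
  using measure_ball_le_max_ball[of 0 r] measure_nonneg order_trans by blast

lemma ball_sets [simp]: "{x. cmod (x - c) \<le> r} \<in> sets \<mu>"
proof -
  have "{x. cmod (x - c) \<le> r} = cball c r" by (auto simp: dist_norm norm_minus_commute)
  then show ?thesis by (simp add: sets_\<mu>)
qed

lemma max_ball_mono: "r \<le> r' \<Longrightarrow> max_ball r \<le> max_ball r'"
proof (rule max_ball_least)
  fix c assume "r \<le> r'"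
  then have "measure \<mu> {x. cmod (x - c) \<le> r} \<le> measure \<mu> {x. cmod (x - c) \<le> r'}"
    by (intro finite_measure_mono) auto
  then show "measure \<mu> {x. cmod (x - c) \<le> r} \<le> max_ball r'"
    using measure_ball_le_max_ball order_trans by blast
qed

lemma preimage_ball:
  assumes "c' \<noteq> 0"
  shows "{x. cmod (c' * x + d - c) \<le> r} = {x. cmod (x - (c - d) / c') \<le> r / cmod c'}"
proof -
  have "c' * x + d - c = c' * (x - (c - d) / c')" for x using assms by (simp add: field_simps)
  then have "cmod (c' * x + d - c) = cmod c' * cmod (x - (c - d) / c')" for x by (simp only: norm_mult)
  then show ?thesis using assms by (simp add: field_simps)
qed

text \<open>Only the branch that applies map i k times is followed exactly; all words leaving it are
  bounded by the concentration function at the expanded radius. \<open>z + a i ^ k * (x - z)\<close>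
  is the k-th iterate written around its fixed point.\<close>

lemma ball_iterate_le:
  assumes i: "i \<in> I" and z: "a i * z + t i = z" and b: "0 < b" "b \<le> 1" "\<And>j. j \<in> I \<Longrightarrow> b \<le> cmod (a j)" and r: "0 \<le> r"
  shows "measure \<mu> {x. cmod (x - c) \<le> r} \<le>
     p i ^ k * measure \<mu> {x. cmod (z + a i ^ k * (x - z) - c) \<le> r} + (1 - p i ^ k) * max_ball (r / b ^ k)"
proof (induction k)
  case 0
  then show ?case by simp
next
  case (Suc k)
  have pi: "0 < p i" "p i \<le> 1"
  proof -
    show "0 < p i" using i p_pos by simp
    have "p i \<le> sum p I" using finite_I i p_nonneg by (intro member_le_sum) auto
    then show "p i \<le> 1" by (simp add: sum_p)
  qed
  have ak: "a i ^ k \<noteq> 0" using a i by simp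
  define c' where "c' = (c - (z - a i ^ k * z)) / a i ^ k"
  define r' where "r' = r / cmod (a i ^ k)"
  have eq: "{x. cmod (z + a i ^ k * (x - z) - c) \<le> r} = {x. cmod (x - c') \<le> r'}"
  proof -
    have "z + a i ^ k * (x - z) - c = a i ^ k * x + (z - a i ^ k * z) - c" for x by (simp add: algebra_simps)
    then show ?thesis by (simp only: preimage_ball[OF ak] c'_def r'_def)
  qed
  have r': "r' \<le> r / b ^ k" "0 \<le> r'"
    using b i r ak by (auto simp: r'_def norm_power intro!: divide_left_mono power_mono mult_pos_pos)
  have rj: "measure \<mu> {x. a j * x + t j \<in> {x. cmod (x - c') \<le> r'}} \<le> max_ball (r / b ^ Suc k)" if j: "j \<in> I" for j
  proof -
    have "measure \<mu> {x. a j * x + t j \<in> {x. cmod (x - c') \<le> r'}} \<le> max_ball (r' / cmod (a j))"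
      using preimage_ball[OF a(1)[OF j], of "t j" c' r'] measure_ball_le_max_ball by simp
    also have "\<dots> \<le> max_ball (r / b ^ Suc k)"
    proof (rule max_ball_mono)
      have "r' / cmod (a j) \<le> (r / b ^ k) / b"
        using r' b j a(1)[OF j] by (intro frac_le) auto
      then show "r' / cmod (a j) \<le> r / b ^ Suc k" by (simp add: field_simps)
    qed
    finally show ?thesis .
  qed
  let ?G = "max_ball (r / b ^ Suc k)"
  have "measure \<mu> {x. cmod (x - c') \<le> r'} = (\<Sum>j\<in>I. p j * measure \<mu> {x. a j * x + t j \<in> {x. cmod (x - c') \<le> r'}})"
    by (rule measure_invariant) (use ball_sets in \<open>simp add: sets_\<mu>\<close>)
  also have "\<dots> = p i * measure \<mu> {x. a i * x + t i \<in> {x. cmod (x - c') \<le> r'}} +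
       (\<Sum>j\<in>I - {i}. p j * measure \<mu> {x. a j * x + t j \<in> {x. cmod (x - c') \<le> r'}})"
    using finite_I i by (simp add: sum.remove)
  also have "(\<Sum>j\<in>I - {i}. p j * measure \<mu> {x. a j * x + t j \<in> {x. cmod (x - c') \<le> r'}}) \<le> (\<Sum>j\<in>I - {i}. p j * ?G)"
    using rj p_nonneg by (intro sum_mono mult_left_mono) auto
  also have "\<dots> = (1 - p i) * ?G"
  proof -
    have "sum p (I - {i}) = 1 - p i" using finite_I i sum_p by (simp add: sum_diff1)
    then show ?thesis by (simp add: sum_distrib_right[symmetric])
  qed
  also have "{x. a i * x + t i \<in> {x. cmod (x - c') \<le> r'}} = {x. cmod (z + a i ^ Suc k * (x - z) - c) \<le> r}"
  proof -
    have "a i * x + t i \<in> {x. cmod (x - c') \<le> r'} \<longleftrightarrow> cmod (z + a i ^ k * ((a i * x + t i) - z) - c) \<le> r" for x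
      using eq by blast
    moreover have "(a i * x + t i) - z = a i * (x - z)" for x using z by (simp add: algebra_simps)
    ultimately show ?thesis by (simp add: mult_ac)
  qed
  finally have *: "measure \<mu> {x. cmod (x - c') \<le> r'} \<le> p i * measure \<mu> {x. cmod (z + a i ^ Suc k * (x - z) - c) \<le> r} + (1 - p i) * ?G" by simp
  have le: "max_ball (r / b ^ k) \<le> ?G"
    using b r by (intro max_ball_mono divide_left_mono mult_pos_pos) (auto simp: mult_le_cancel_right1)
  have "measure \<mu> {x. cmod (x - c) \<le> r} \<le> p i ^ k * (p i * measure \<mu> {x. cmod (z + a i ^ Suc k * (x - z) - c) \<le> r} + (1 - p i) * ?G) + (1 - p i ^ k) * ?G"
    using Suc * le pi unfolding eq
    by (elim order_trans, intro add_mono mult_left_mono) (auto simp: power_le_one)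
  also have "\<dots> = p i ^ Suc k * measure \<mu> {x. cmod (z + a i ^ Suc k * (x - z) - c) \<le> r} + (1 - p i ^ Suc k) * ?G"
    by (simp add: algebra_simps)
  finally show ?case .
qed

text \<open>A small ball misses one of the images of \<open>L\<close> under high powers of two maps with distinct
  fixed points, so that a definite proportion of the mass is lost.\<close>

lemma frostman:
  assumes i: "i \<in> I" "a i * z + t i = z" and j: "j \<in> I" "a j * w + t j = w" and zw: "z \<noteq> w"
  shows "\<exists>C s. 0 \<le> C \<and> 0 < s \<and> (\<forall>c r. 0 < r \<longrightarrow> measure \<mu> {x. cmod (x - c) \<le> r} \<le> C * r powr s)"
proof -
  obtain b where b: "0 < b" "b \<le> 1" "\<And>l. l \<in> I \<Longrightarrow> b \<le> cmod (a l)"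
    using finite_pos_lower_bound[of I "\<lambda>i. cmod (a i)"] finite_I a by auto
  have b1: "b < 1" using b(3)[OF i(1)] a(2)[OF i(1)] by simp
  \<comment> \<open>With |z - w| / 8, four errors of size \<rho> add up to only half the distance of
    the fixed points.\<close>
  define \<rho> where "\<rho> = cmod (z - w) / 8"
  have \<rho>: "0 < \<rho>" using zw by (simp add: \<rho>_def)
  obtain D where D: "\<And>x. x \<in> L \<Longrightarrow> cmod x \<le> D"
    using compact_imp_bounded[OF compact_L] by (auto simp: bounded_iff)
  define D' where "D' = \<bar>D\<bar> + cmod z + cmod w"
  have ev: "eventually (\<lambda>k. D' * cmod (a l) ^ k < \<rho>) sequentially" if "l \<in> I" for l
    using a that \<rho> by (intro eventually_power_mult_less) auto
  obtain k where k: "D' * cmod (a i) ^ k < \<rho>" "D' * cmod (a j) ^ k < \<rho>" "0 < k"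
    using eventually_conj[OF ev[OF i(1)] eventually_conj[OF ev[OF j(1)] eventually_gt_at_top[of 0]]]
    by (auto dest!: eventually_happens)
  have near_fix: "cmod (z + a i ^ k * (x - z) - z) \<le> \<rho>" "cmod (w + a j ^ k * (x - w) - w) \<le> \<rho>" if "x \<in> L" for x
  proof -
    have "cmod (x - z) \<le> D'"
      using norm_triangle_ineq4[of x z] D[OF that] norm_ge_zero[of w] unfolding D'_def by linarith
    moreover have "cmod (x - w) \<le> D'"
      using norm_triangle_ineq4[of x w] D[OF that] norm_ge_zero[of z] unfolding D'_def by linarith
    ultimately have "cmod (x - z) * cmod (a i) ^ k \<le> D' * cmod (a i) ^ k" "cmod (x - w) * cmod (a j) ^ k \<le> D' * cmod (a j) ^ k"
      by (auto intro!: mult_right_mono)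
    then show "cmod (z + a i ^ k * (x - z) - z) \<le> \<rho>" "cmod (w + a j ^ k * (x - w) - w) \<le> \<rho>"
      using k by (auto simp: norm_mult norm_power mult.commute)
  qed
  have null: "measure \<mu> S = 0" if "S \<inter> L = {}" for S
  proof (cases "S \<in> sets \<mu>")
    case True
    have "AE x in \<mu>. x \<notin> S" by (rule AE_mp[OF AE_L]) (use that in auto)
    then show ?thesis using True prob_eq_0 by simp
  qed (simp add: measure_notin_sets)
  have p1: "0 < p l \<and> p l \<le> 1" if "l \<in> I" for l
    using p_pos[OF that] member_le_sum[of l I p] finite_I p_nonneg that by (simp add: sum_p)
  \<comment> \<open>The lower bound 1 / 2 keeps \<kappa> positive, so that its logarithm can define
    the exponent \<open>s\<close>.\<close>
  define \<kappa> where "\<kappa> = max (1 / 2) (1 - min (p i ^ k) (p j ^ k))"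
  have \<kappa>: "0 < \<kappa>" "\<kappa> < 1" using p1 i j by (auto simp: \<kappa>_def min_def)
  define \<beta> where "\<beta> = b ^ k"
  have \<beta>: "0 < \<beta>" "\<beta> < 1" using b b1 k by (auto simp: \<beta>_def power_less_one_iff)
  have contr: "max_ball r \<le> \<kappa> * max_ball (r / \<beta>)" if r: "0 \<le> r" "r \<le> \<rho>" for r
  proof (rule max_ball_least)
    fix c
    have "{x. cmod (z + a i ^ k * (x - z) - c) \<le> r} \<inter> L = {} \<or> {x. cmod (w + a j ^ k * (x - w) - c) \<le> r} \<inter> L = {}"
    proof (rule ccontr)
      assume "\<not> ?thesis"
      then obtain x y where x: "x \<in> L" "cmod (z + a i ^ k * (x - z) - c) \<le> r" and y: "y \<in> L" "cmod (w + a j ^ k * (y - w) - c) \<le> r"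
        by blast
      have "cmod (z - w) = cmod ((z + a i ^ k * (x - z) - c) - (z + a i ^ k * (x - z) - z) - ((w + a j ^ k * (y - w) - c) - (w + a j ^ k * (y - w) - w)))"
        by simp
      also have "\<dots> \<le> (cmod (z + a i ^ k * (x - z) - c) + cmod (z + a i ^ k * (x - z) - z)) + (cmod (w + a j ^ k * (y - w) - c) + cmod (w + a j ^ k * (y - w) - w))"
        by (intro order_trans[OF norm_triangle_ineq4] add_mono norm_triangle_ineq4)
      also have "\<dots> \<le> (\<rho> + \<rho>) + (\<rho> + \<rho>)"
        using x y r near_fix[OF x(1)] near_fix[OF y(1)] by (intro add_mono) auto
      finally show False using \<rho> by (simp add: \<rho>_def)
    qed
    then have "measure \<mu> {x. cmod (x - c) \<le> r} \<le> (1 - p i ^ k) * max_ball (r / b ^ k) \<or>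
               measure \<mu> {x. cmod (x - c) \<le> r} \<le> (1 - p j ^ k) * max_ball (r / b ^ k)"
      using ball_iterate_le[OF i b r(1), of c k] ball_iterate_le[OF j b r(1), of c k] null by auto
    moreover have "1 - p i ^ k \<le> \<kappa>" "1 - p j ^ k \<le> \<kappa>"
      by (auto simp: \<kappa>_def le_max_iff_disj min_def)
    then have "(1 - p i ^ k) * max_ball (r / b ^ k) \<le> \<kappa> * max_ball (r / b ^ k)" "(1 - p j ^ k) * max_ball (r / b ^ k) \<le> \<kappa> * max_ball (r / b ^ k)"
      by (auto intro: mult_right_mono max_ball_nonneg)
    ultimately show "measure \<mu> {x. cmod (x - c) \<le> r} \<le> \<kappa> * max_ball (r / \<beta>)" by (auto simp: \<beta>_def)
  qed
  have iter: "max_ball r \<le> \<kappa> ^ n" if "0 \<le> r" "r \<le> \<rho> * \<beta> ^ n" for r n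
    using that
  proof (induction n arbitrary: r)
    case 0
    show ?case by (rule max_ball_least) simp
  next
    case (Suc n)
    have "\<rho> * \<beta> ^ Suc n \<le> \<rho> * 1" using \<beta> \<rho> by (intro mult_left_mono power_le_one) auto
    then have "max_ball r \<le> \<kappa> * max_ball (r / \<beta>)" using Suc by (intro contr) auto
    also have "\<dots> \<le> \<kappa> * \<kappa> ^ n" using Suc \<beta> \<kappa> by (intro mult_left_mono Suc.IH) (auto simp: field_simps)
    finally show ?case by simp
  qed
  define s where "s = ln \<kappa> / ln \<beta>"
  have s: "0 < s" using \<kappa> \<beta> by (simp add: s_def divide_neg_neg)
  have \<kappa>\<beta>: "\<kappa> = \<beta> powr s" using \<kappa> \<beta> by (simp add: powr_def s_def)
  define C where "C = (1 / \<rho>) powr s / \<kappa>"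
  have "measure \<mu> {x. cmod (x - c) \<le> r} \<le> C * r powr s" if r: "0 < r" for c r
  proof (cases "\<rho> \<le> r")
    case True
    have "1 \<le> (r / \<rho>) powr s" using True \<rho> s by (intro ge_one_powr_ge_zero) auto
    also have "\<dots> \<le> (r / \<rho>) powr s / \<kappa>" using \<kappa> by (simp add: field_simps mult_left_le_one_le)
    also have "\<dots> = C * r powr s" using r \<rho> by (simp add: C_def powr_divide field_simps)
    finally show ?thesis using prob_le_1 order_trans by blast
  next
    case False
    then have "1 \<le> \<rho> / r" using r by simp
    then obtain e where e: "\<beta> ^ e * (\<rho> / r) \<le> 1" "\<beta> \<le> \<beta> ^ e * (\<rho> / r)" using power_between[OF \<beta>] by metis
    \<comment> \<open>The lower bound on \<open>\<beta> ^ e\<close> only gives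
      \<open>r \<le> \<rho> * \<beta> ^ (e - 1)\<close>, so one factor \<kappa> is lost into
      \<open>C\<close>. For e = 0 the truncated exponent yields the trivial bound 1.\<close>
    have "measure \<mu> {x. cmod (x - c) \<le> r} \<le> \<kappa> ^ (e - 1)"
    proof (cases e)
      case (Suc m)
      have "r \<le> \<rho> * \<beta> ^ m" using e(2) r \<beta> by (simp add: Suc field_simps)
      then show ?thesis using iter[of r m] r measure_ball_le_max_ball[of c r] by (simp add: Suc)
    qed simp
    also have "\<dots> \<le> \<kappa> ^ e / \<kappa>" using \<kappa> by (cases e) auto
    also have "\<kappa> ^ e = (\<beta> ^ e) powr s"
      unfolding \<kappa>\<beta> using \<beta> by (simp add: powr_power powr_realpow[symmetric] powr_powr mult.commute)
    also have "(\<beta> ^ e) powr s \<le> (r / \<rho>) powr s"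
      using e(1) r \<rho> s \<beta> by (intro powr_mono2) (auto simp: field_simps)
    also have "(r / \<rho>) powr s / \<kappa> = C * r powr s" using r \<rho> by (simp add: C_def powr_divide field_simps)
    finally show ?thesis using \<kappa> by (simp add: divide_right_mono)
  qed
  moreover have "0 \<le> C" using \<kappa> by (simp add: C_def)
  ultimately show ?thesis using s by blast
qed

section \<open>Words with equal linear part and independent translations\<close>

text \<open>Exchanging i and j at the front of a word changes its translation by
  \<open>(1 - a i) * (1 - a j) * (z i - z j)\<close>, and a letter k put in front multiplies this by
  \<open>a k\<close>. A non-real \<open>a k\<close> thus gives two independent differences. If all
  \<open>a l\<close> are real, so are the factors, and non-collinear fixed points give independent
  differences for the pairs i, j and i, k. Both cases use two exchanges of the same three letters,
  hence words of length three.\<close>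

lemma exists_independent_words:
  assumes z: "\<And>i. i \<in> I \<Longrightarrow> a i * z i + t i = z i"
    and distinct: "\<exists>i\<in>I. \<exists>j\<in>I. z i \<noteq> z j"
    and not_line: "(\<exists>i\<in>I. Im (a i) \<noteq> 0) \<or> \<not> (\<exists>c u. \<forall>i\<in>I. \<exists>x::real. z i = c + of_real x * u)"
  shows "\<exists>u\<in>I \<times> I \<times> I. \<exists>u'\<in>I \<times> I \<times> I. \<exists>v\<in>I \<times> I \<times> I. \<exists>v'\<in>I \<times> I \<times> I.
    word_a u' = word_a u \<and> word_a v = word_a u \<and> word_a v' = word_a u \<and>
    Im (cnj (word_t u - word_t u') * (word_t v - word_t v')) \<noteq> 0"
proof -
  obtain i j where ij: "i \<in> I" "j \<in> I" "z i \<noteq> z j" using distinct by blast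
  define d where "d i j = (1 - a i) * (1 - a j) * (z i - z j)" for i j
  have t: "t l = (1 - a l) * z l" if "l \<in> I" for l using z[OF that] by (simp add: algebra_simps)
  have d: "word_t (i, j, k) - word_t (j, i, k) = d i j" "word_t (k, i, j) - word_t (k, j, i) = a k * d i j"
    if "i \<in> I" "j \<in> I" for i j k
    unfolding word_t_def d_def prod.case t[OF that(1)] t[OF that(2)] by (simp_all add: algebra_simps)
  have a1: "a l \<noteq> 1" if "l \<in> I" for l using a(2)[OF that] by auto
  have d0: "d i j \<noteq> 0" using ij a1 by (simp add: d_def)
  show ?thesis
  proof (cases "\<exists>k\<in>I. Im (a k) \<noteq> 0")
    case True
    then obtain k where k: "k \<in> I" "Im (a k) \<noteq> 0" by blast
    have "cnj (d i j) * (a k * d i j) = of_real ((cmod (d i j))\<^sup>2) * a k"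
      by (simp only: complex_norm_square mult_ac)
    then have "Im (cnj (d i j) * (a k * d i j)) = (cmod (d i j))\<^sup>2 * Im (a k)"
      by (simp only: times_complex.sel Re_complex_of_real Im_complex_of_real mult_zero_left add_0_right)
    then have "Im (cnj (word_t (i, j, k) - word_t (j, i, k)) * (word_t (k, i, j) - word_t (k, j, i))) \<noteq> 0"
      using d[OF ij(1,2)] k d0 by simp
    then show ?thesis using ij k
      by (intro bexI[of _ "(i, j, k)"] bexI[of _ "(j, i, k)"] bexI[of _ "(k, i, j)"] bexI[of _ "(k, j, i)"])
         (auto simp: word_a_def mult_ac)
  next
    case False
    then have real: "Im (a l) = 0" if "l \<in> I" for l using that by blast
    have "\<exists>k\<in>I. Im (cnj (z i - z j) * (z i - z k)) \<noteq> 0"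
    proof (rule ccontr)
      assume *: "\<not> ?thesis"
      have "\<exists>x::real. z k = z i + of_real x * (z i - z j)" if "k \<in> I" for k
      proof -
        define u where "u = z i - z j"
        have u0: "u \<noteq> 0" using ij by (simp add: u_def)
        have "Im (cnj u * (z i - z k)) = 0" using * that by (auto simp: u_def)
        then have "cnj u * (z i - z k) = of_real (Re (cnj u * (z i - z k)))" by (simp add: complex_eq_iff)
        then have "u * cnj u * (z i - z k) = of_real (Re (cnj u * (z i - z k))) * u" by (simp add: mult_ac)
        then have "of_real ((cmod u)\<^sup>2) * (z i - z k) = of_real (Re (cnj u * (z i - z k))) * u"
          by (simp only: complex_norm_square)
        then have "z k = z i + of_real (- Re (cnj u * (z i - z k)) / (cmod u)\<^sup>2) * u"
          using u0 by (simp add: field_simps)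
        then show ?thesis unfolding u_def by blast
      qed
      then show False using not_line False by blast
    qed
    then obtain k where k: "k \<in> I" "Im (cnj (z i - z j) * (z i - z k)) \<noteq> 0" by blast
    define al where "al l = Re (a l)" for l
    have ar: "a l = of_real (al l)" if "l \<in> I" for l using real[OF that] by (simp add: complex_eq_iff al_def)
    have "cnj (d i j) * d i k = of_real ((1 - al i) * (1 - al j) * ((1 - al i) * (1 - al k))) * (cnj (z i - z j) * (z i - z k))"
      unfolding d_def ar[OF ij(1)] ar[OF ij(2)] ar[OF k(1)] by (simp add: mult_ac)
    then have "Im (cnj (d i j) * d i k) = (1 - al i) * (1 - al j) * ((1 - al i) * (1 - al k)) * Im (cnj (z i - z j) * (z i - z k))"
      by (simp only: times_complex.sel(2)[of "of_real _"] Re_complex_of_real Im_complex_of_real mult_zero_left add_0_right)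
    moreover have "1 - al l \<noteq> 0" if "l \<in> I" for l using a1[OF that] ar[OF that] by auto
    ultimately have "Im (cnj (d i j) * d i k) \<noteq> 0" using k ij by simp
    then have "Im (cnj (word_t (i, j, k) - word_t (j, i, k)) * (word_t (i, k, j) - word_t (k, i, j))) \<noteq> 0"
      using d(1)[OF ij(1,2), of k] d(1)[OF ij(1) k(1), of j] by simp
    then show ?thesis using ij k
      by (intro bexI[of _ "(i, j, k)"] bexI[of _ "(j, i, k)"] bexI[of _ "(i, k, j)"] bexI[of _ "(k, i, j)"])
         (auto simp: word_a_def mult_ac)
  qed
qed

end

section \<open>Subdivision into pieces and linearisation\<close>

context self_similar_measure begin

text \<open>The linear part of a word of length at most m depends only on how often each letter
  occurs. Bounding every multiplicity by m separately overcounts, but the cardinality stays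
  polynomial in m.\<close>

definition products :: "nat \<Rightarrow> complex set" where
  "products m = (\<lambda>e. \<Prod>i\<in>I. a i ^ e i) ` (I \<rightarrow>\<^sub>E {..m})"

lemma finite_products: "finite (products m)"
  unfolding products_def by (intro finite_imageI finite_PiE finite_I) auto

lemma card_products_le: "card (products m) \<le> (m + 1) ^ card I"
proof -
  have "card (products m) \<le> card (I \<rightarrow>\<^sub>E {..m})"
    unfolding products_def by (intro card_image_le finite_PiE finite_I) auto
  then show ?thesis by (simp add: card_PiE finite_I)
qed

lemma one_in_products: "1 \<in> products m"
  unfolding products_def by (rule image_eqI[of _ _ "\<lambda>i\<in>I. 0"]) auto

lemma products_mono: "m \<le> n \<Longrightarrow> products m \<subseteq> products n"
  unfolding products_def by (intro image_mono PiE_mono) auto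

lemma products_step:
  assumes "A \<in> products m" "i \<in> I"
  shows "A * a i \<in> products (Suc m)"
proof -
  obtain e where e: "e \<in> I \<rightarrow>\<^sub>E {..m}" "A = (\<Prod>i\<in>I. a i ^ e i)"
    using assms by (auto simp: products_def)
  define e' where "e' = e(i := Suc (e i))"
  have "(\<Prod>j\<in>I. a j ^ e' j) = a i ^ e' i * (\<Prod>j\<in>I - {i}. a j ^ e' j)"
    using finite_I assms by (simp add: prod.remove)
  also have "(\<Prod>j\<in>I - {i}. a j ^ e' j) = (\<Prod>j\<in>I - {i}. a j ^ e j)"
    by (rule prod.cong) (auto simp: e'_def)
  also have "a i ^ e' i * \<dots> = a i * (a i ^ e i * (\<Prod>j\<in>I - {i}. a j ^ e j))" by (simp add: e'_def)
  also have "\<dots> = a i * A"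
    unfolding e(2) using finite_I assms(2) by (simp add: prod.remove[of I i])
  finally have "A * a i = (\<Prod>j\<in>I. a j ^ e' j)" by simp
  moreover have "e' \<in> I \<rightarrow>\<^sub>E {..Suc m}"
  proof (rule PiE_I)
    fix x assume "x \<in> I"
    then have "e x \<le> m" using e(1) by auto
    moreover have "e i \<le> m" using e(1) assms(2) by auto
    ultimately show "e' x \<in> {..Suc m}" by (simp add: e'_def)
  next
    fix x assume x: "x \<notin> I"
    then have "x \<noteq> i" using assms(2) by blast
    then show "e' x = undefined" using PiE_arb[OF e(1) x] by (simp add: e'_def)
  qed
  ultimately show ?thesis unfolding products_def by blast
qed

text \<open>\<open>h\<close> stands for the derivative of \<open>f\<close>. The Taylor estimate is
  demanded on \<open>L\<close> alone, so that both functions may be cut off outside \<open>L\<close>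
  to make them Borel.\<close>

context
  fixes f h :: "complex \<Rightarrow> complex" and C D :: real
  assumes f [measurable]: "f \<in> borel_measurable borel" and h [measurable]: "h \<in> borel_measurable borel"
    and taylor: "\<And>x y. x \<in> L \<Longrightarrow> y \<in> L \<Longrightarrow> cmod (f y - f x - h x * (y - x)) \<le> C * (cmod (y - x))\<^sup>2"
    and C: "0 \<le> C"
    and diam: "\<And>x y. x \<in> L \<Longrightarrow> y \<in> L \<Longrightarrow> cmod (y - x) \<le> D"
begin

definition lin_err :: "complex \<Rightarrow> real \<Rightarrow> real" where
  "lin_err \<zeta> r = 2 * pi * cmod \<zeta> * C * r\<^sup>2 * D\<^sup>2"

lemma integrable_cis: 
  assumes [measurable]: "g \<in> borel_measurable borel"
  shows "integrable \<mu> (\<lambda>x. cis (g x))"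
  by (rule integrable_const_bound[where B = 1]) auto

lemma integrable_F: 
  assumes [measurable]: "g \<in> borel_measurable borel"
  shows "integrable \<mu> (\<lambda>x. F (g x))"
  by (rule integrable_const_bound[where B = 1]) (auto simp: F_nonneg F_le_1)

text \<open>Freezing the derivative at one point y of \<open>L\<close> turns the integral, up to a
  unimodular factor, into \<open>E\<close> at the frequency
  \<open>\<zeta> * A * h (A * y + T)\<close>. The bound holds for every such y, so it may be
  averaged over \<mu>, which replaces a fixed frequency by a random one.\<close>

lemma linearise:
  assumes A: "\<And>x. x \<in> L \<Longrightarrow> A * x + T \<in> L"
  shows "cmod (\<integral>x. cis (2 * pi * Re (\<zeta> * f (A * x + T))) \<partial>\<mu>)
    \<le> (\<integral>y. F (\<zeta> * A * h (A * y + T)) \<partial>\<mu>) + lin_err \<zeta> (cmod A)" (is "cmod ?I \<le> _")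
proof -
  have pt: "cmod ?I \<le> F (\<zeta> * A * h (A * y + T)) + lin_err \<zeta> (cmod A)" if y: "y \<in> L" for y
  proof -
    let ?g = "\<lambda>x. f (A * y + T) + h (A * y + T) * (A * x - A * y)"
    let ?J = "\<integral>x. cis (2 * pi * Re (\<zeta> * ?g x)) \<partial>\<mu>"
    have i: "integrable \<mu> (\<lambda>x. cis (2 * pi * Re (\<zeta> * f (A * x + T))))" "integrable \<mu> (\<lambda>x. cis (2 * pi * Re (\<zeta> * ?g x)))"
      by (intro integrable_cis; measurable)+
    have "?J = (\<integral>x. cis (2 * pi * Re (\<zeta> * (f (A * y + T) - h (A * y + T) * (A * y)))) * cis (2 * pi * Re (\<zeta> * A * h (A * y + T) * x)) \<partial>\<mu>)"
      by (rule Bochner_Integration.integral_cong) (simp_all add: cis_mult algebra_simps)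
    also have "\<dots> = cis (2 * pi * Re (\<zeta> * (f (A * y + T) - h (A * y + T) * (A * y)))) * E (\<zeta> * A * h (A * y + T))"
      by (simp add: E_def)
    finally have J: "cmod ?J = F (\<zeta> * A * h (A * y + T))" by (simp only: norm_mult norm_cis mult_1_left F_def)
    have "cmod (?I - ?J) = cmod (\<integral>x. cis (2 * pi * Re (\<zeta> * f (A * x + T))) - cis (2 * pi * Re (\<zeta> * ?g x)) \<partial>\<mu>)"
      by (simp only: Bochner_Integration.integral_diff[OF i])
    also have "\<dots> \<le> (\<integral>x. cmod (cis (2 * pi * Re (\<zeta> * f (A * x + T))) - cis (2 * pi * Re (\<zeta> * ?g x))) \<partial>\<mu>)"
      by (rule integral_norm_bound)
    also have "\<dots> \<le> (\<integral>x. lin_err \<zeta> (cmod A) \<partial>\<mu>)"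
    proof (rule integral_mono_AE)
      show "integrable \<mu> (\<lambda>x. cmod (cis (2 * pi * Re (\<zeta> * f (A * x + T))) - cis (2 * pi * Re (\<zeta> * ?g x))))"
        using i by auto
      show "AE x in \<mu>. cmod (cis (2 * pi * Re (\<zeta> * f (A * x + T))) - cis (2 * pi * Re (\<zeta> * ?g x))) \<le> lin_err \<zeta> (cmod A)"
      proof (rule AE_mp[OF AE_L], rule AE_I2, rule impI)
        fix x assume x: "x \<in> L"
        have tl: "cmod (f (A * x + T) - ?g x) \<le> C * (cmod A * D)\<^sup>2"
        proof -
          have e: "f (A * x + T) - ?g x = f (A * x + T) - f (A * y + T) - h (A * y + T) * ((A * x + T) - (A * y + T))"
            by (simp add: algebra_simps)
          have "cmod (f (A * x + T) - ?g x) \<le> C * (cmod ((A * x + T) - (A * y + T)))\<^sup>2"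
            unfolding e by (rule taylor) (use A x y in auto)
          also have "(A * x + T) - (A * y + T) = A * (x - y)" by (simp add: algebra_simps)
          also have "C * (cmod (A * (x - y)))\<^sup>2 \<le> C * (cmod A * D)\<^sup>2"
            using C diam[OF y x] by (auto simp: norm_mult intro!: mult_left_mono power_mono)
          finally show ?thesis .
        qed
        have "cmod (cis (2 * pi * Re (\<zeta> * f (A * x + T))) - cis (2 * pi * Re (\<zeta> * ?g x))) \<le>
            \<bar>2 * pi * Re (\<zeta> * f (A * x + T)) - 2 * pi * Re (\<zeta> * ?g x)\<bar>" by (rule norm_cis_diff_le)
        also have "\<dots> = 2 * pi * \<bar>Re (\<zeta> * (f (A * x + T) - ?g x))\<bar>"
          by (simp only: right_diff_distrib[symmetric] minus_complex.sel(1)[symmetric] abs_mult) simp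
        also have "\<dots> \<le> 2 * pi * (cmod \<zeta> * cmod (f (A * x + T) - ?g x))"
          using abs_Re_le_cmod[of "\<zeta> * (f (A * x + T) - ?g x)"] by (simp only: norm_mult) (intro mult_left_mono; simp)
        also have "\<dots> \<le> 2 * pi * (cmod \<zeta> * (C * (cmod A * D)\<^sup>2))"
          by (intro mult_left_mono tl) auto
        also have "2 * pi * (cmod \<zeta> * (C * (cmod A * D)\<^sup>2)) = lin_err \<zeta> (cmod A)"
          by (simp add: lin_err_def power_mult_distrib)
        finally show "cmod (cis (2 * pi * Re (\<zeta> * f (A * x + T))) - cis (2 * pi * Re (\<zeta> * ?g x))) \<le> lin_err \<zeta> (cmod A)" .
      qed
    qed simp
    also have "\<dots> = lin_err \<zeta> (cmod A)" by (simp add: prob_space[simplified])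
    finally have "cmod (?I - ?J) \<le> lin_err \<zeta> (cmod A)" .
    then show ?thesis using J norm_triangle_ineq2[of ?I ?J] by linarith
  qed
  have iF: "integrable \<mu> (\<lambda>y. F (\<zeta> * A * h (A * y + T)))" by (rule integrable_F) measurable
  have "cmod ?I = (\<integral>y. cmod ?I \<partial>\<mu>)" by (simp add: prob_space[simplified])
  also have "\<dots> \<le> (\<integral>y. F (\<zeta> * A * h (A * y + T)) + lin_err \<zeta> (cmod A) \<partial>\<mu>)"
  proof (rule integral_mono_AE)
    show "AE y in \<mu>. cmod ?I \<le> F (\<zeta> * A * h (A * y + T)) + lin_err \<zeta> (cmod A)"
      by (rule AE_mp[OF AE_L], rule AE_I2, rule impI, rule pt)
  qed (use iF in auto)
  also have "\<dots> = (\<integral>y. F (\<zeta> * A * h (A * y + T)) \<partial>\<mu>) + lin_err \<zeta> (cmod A)"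
    using iF by (simp add: prob_space[simplified])
  finally show ?thesis .
qed

text \<open>
  Subdivision along the stopping time \<open>cmod A \<le> r\<close>.  Since the linear parts commute, only
  polynomially many values of \<open>A\<close> occur, and for each fixed value the average over the pieces
  recombines to an integral over \<open>\<mu>\<close>.
\<close>

lemma subdivide:
  assumes b: "0 < b" "\<And>i. i \<in> I \<Longrightarrow> b \<le> cmod (a i)" and B: "\<And>i. i \<in> I \<Longrightarrow> cmod (a i) \<le> B" "0 \<le> B"
    and r: "0 < r"
    and A: "\<And>x. x \<in> L \<Longrightarrow> A * x + T \<in> L" "b * r \<le> cmod A" "A \<in> products m" "m + k \<le> K" "cmod A * B ^ k \<le> r"
  shows "cmod (\<integral>x. cis (2 * pi * Re (\<zeta> * f (A * x + T))) \<partial>\<mu>)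
    \<le> (\<Sum>A'\<in>{A'\<in>products K. b * r \<le> cmod A'}. \<integral>y. F (\<zeta> * A' * h (A * y + T)) \<partial>\<mu>) + lin_err \<zeta> r"
proof -
  let ?S = "{A'\<in>products K. b * r \<le> cmod A'}"
  have fS: "finite ?S" using finite_products by simp
  \<comment> \<open>For a stopped piece the term is one summand in a sum of nonnegative integrals
    and is enlarged to the whole sum over \<open>?S\<close>.\<close>
  have base: "cmod (\<integral>x. cis (2 * pi * Re (\<zeta> * f (A * x + T))) \<partial>\<mu>)
      \<le> (\<Sum>A'\<in>?S. \<integral>y. F (\<zeta> * A' * h (A * y + T)) \<partial>\<mu>) + lin_err \<zeta> r"
    if A: "\<And>x. x \<in> L \<Longrightarrow> A * x + T \<in> L" "b * r \<le> cmod A" "A \<in> products m" "m \<le> K" "cmod A \<le> r" for A T m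
  proof -
    have "cmod (\<integral>x. cis (2 * pi * Re (\<zeta> * f (A * x + T))) \<partial>\<mu>)
        \<le> (\<integral>y. F (\<zeta> * A * h (A * y + T)) \<partial>\<mu>) + lin_err \<zeta> (cmod A)"
      by (rule linearise) (rule A)
    moreover have "(\<integral>y. F (\<zeta> * A * h (A * y + T)) \<partial>\<mu>) \<le> (\<Sum>A'\<in>?S. \<integral>y. F (\<zeta> * A' * h (A * y + T)) \<partial>\<mu>)"
      using fS A products_mono[of m K] F_nonneg
      by (intro member_le_sum) (auto intro!: integral_nonneg_AE)
    moreover have "lin_err \<zeta> (cmod A) \<le> lin_err \<zeta> r"
      unfolding lin_err_def using A C by (intro mult_right_mono mult_left_mono power_mono) auto
    ultimately show ?thesis by linarith
  qed
  show ?thesis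
    using A
  proof (induction k arbitrary: A T m)
    case 0
    then show ?case by (intro base[of A T m]) auto
  next
    case (Suc k)
    show ?case
    proof (cases "cmod A \<le> r")
      case True
      then show ?thesis using Suc.prems by (intro base[of A T m]) auto
    next
      case False
      let ?Q = "\<lambda>A T. cmod (\<integral>x. cis (2 * pi * Re (\<zeta> * f (A * x + T))) \<partial>\<mu>)"
      have split: "A * (a i * x + t i) + T = (A * a i) * x + (A * t i + T)" for i x by (simp add: algebra_simps)
      have "(\<integral>x. cis (2 * pi * Re (\<zeta> * f (A * x + T))) \<partial>\<mu>) =
         (\<Sum>i\<in>I. p i *\<^sub>R (\<integral>x. cis (2 * pi * Re (\<zeta> * f (A * (a i * x + t i) + T))) \<partial>\<mu>))"
        by (rule integral_invariant[where C = 1]) auto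
      then have "?Q A T \<le> (\<Sum>i\<in>I. p i * ?Q (A * a i) (A * t i + T))"
        unfolding split using norm_sum[of "\<lambda>i. p i *\<^sub>R (\<integral>x. cis (2 * pi * Re (\<zeta> * f (A * a i * x + (A * t i + T)))) \<partial>\<mu>)" I]
        by (simp add: p_nonneg)
      also have "\<dots> \<le> (\<Sum>i\<in>I. p i * ((\<Sum>A'\<in>?S. \<integral>y. F (\<zeta> * A' * h ((A * a i) * y + (A * t i + T))) \<partial>\<mu>) + lin_err \<zeta> r))"
      proof (intro sum_mono mult_left_mono p_nonneg)
        fix i assume i: "i \<in> I"
        show "?Q (A * a i) (A * t i + T) \<le> (\<Sum>A'\<in>?S. \<integral>y. F (\<zeta> * A' * h ((A * a i) * y + (A * t i + T))) \<partial>\<mu>) + lin_err \<zeta> r"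
        proof (rule Suc.IH)
          show "A * a i * x + (A * t i + T) \<in> L" if "x \<in> L" for x
            using Suc.prems(1)[OF L_invariant[OF i that]] by (simp only: split)
          show "A * a i \<in> products (Suc m)" by (rule products_step[OF Suc.prems(3) i])
          show "Suc m + k \<le> K" using Suc.prems by simp
          \<comment> \<open>A piece is split only while |A| > r, so its children cannot fall below b
            r.\<close>
          have "b * r \<le> cmod (a i) * cmod A" using b i r False by (intro mult_mono) auto
          then show "b * r \<le> cmod (A * a i)" by (simp add: norm_mult mult.commute)
          have "cmod (A * a i) * B ^ k \<le> cmod A * B * B ^ k"
            unfolding norm_mult using B i by (intro mult_right_mono mult_left_mono) auto
          then show "cmod (A * a i) * B ^ k \<le> r" using Suc.prems(5) by (simp add: mult.assoc)
        qed
      qed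
      also have "\<dots> = (\<Sum>A'\<in>?S. \<Sum>i\<in>I. p i * (\<integral>y. F (\<zeta> * A' * h (A * (a i * y + t i) + T)) \<partial>\<mu>)) + lin_err \<zeta> r"
        unfolding split unfolding distrib_left sum.distrib sum_distrib_right[symmetric] sum_p
        by (simp add: sum_distrib_left sum.swap[of _ I])
      also have "(\<Sum>A'\<in>?S. \<Sum>i\<in>I. p i * (\<integral>y. F (\<zeta> * A' * h (A * (a i * y + t i) + T)) \<partial>\<mu>)) = (\<Sum>A'\<in>?S. \<integral>y. F (\<zeta> * A' * h (A * y + T)) \<partial>\<mu>)"
      proof (rule sum.cong[OF refl])
        fix A'
        have "(\<integral>y. F (\<zeta> * A' * h (A * y + T)) \<partial>\<mu>) = (\<Sum>i\<in>I. p i *\<^sub>R (\<integral>y. F (\<zeta> * A' * h (A * (a i * y + t i) + T)) \<partial>\<mu>))"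
          by (rule integral_invariant[where C = 1]) (auto simp: F_nonneg F_le_1)
        then show "(\<Sum>i\<in>I. p i * (\<integral>y. F (\<zeta> * A' * h (A * (a i * y + t i) + T)) \<partial>\<mu>)) = (\<integral>y. F (\<zeta> * A' * h (A * y + T)) \<partial>\<mu>)"
          by simp
      qed
      finally show ?thesis .
    qed
  qed
qed

text \<open>With z = |\<zeta>| and r = z powr (-2/3), each average sees a frequency of modulus at
  least \<open>b * z powr (1 / 3)\<close>, and the linearisation error is of order z powr (-1/3).
  The number of linear parts is at most a power of ln z up to constants and is absorbed by part of
  the gained exponent.\<close>

lemma image_fourier_decay_aux:
  assumes avg: "\<And>\<eta>. 1 \<le> cmod \<eta> \<Longrightarrow> (\<integral>x. F (\<eta> * h x) \<partial>\<mu>) \<le> C' * cmod \<eta> powr - \<sigma>"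
    and C': "0 \<le> C'" and \<sigma>: "0 < \<sigma>"
  shows "\<exists>c>0. \<exists>s>0. \<forall>\<zeta>. \<zeta> \<noteq> 0 \<longrightarrow> cmod (\<integral>x. cis (2 * pi * Re (\<zeta> * f x)) \<partial>\<mu>) \<le> c * cmod \<zeta> powr - s"
proof -
  obtain b where b: "0 < b" "b \<le> 1" "\<And>i. i \<in> I \<Longrightarrow> b \<le> cmod (a i)"
    using finite_pos_lower_bound[of I "\<lambda>i. cmod (a i)"] finite_I a by auto
  obtain c0 where c0: "0 < c0" "c0 \<le> 1" "\<And>i. i \<in> I \<Longrightarrow> c0 \<le> 1 - cmod (a i)"
    using finite_pos_lower_bound[of I "\<lambda>i. 1 - cmod (a i)"] finite_I a by auto
  define B where "B = 1 - c0 / 2"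
  have B: "0 < B" "B < 1" "\<And>i. i \<in> I \<Longrightarrow> cmod (a i) \<le> B" using c0 by (auto simp: B_def dest!: c0(3))
  define N where "N = card I"
  have N: "0 < N" using finite_I sum_p by (auto simp: N_def card_gt_0_iff)
  \<comment> \<open>The N-th power of \<open>z powr \<epsilon>\<close> is
    \<open>z powr (min \<sigma> 1 / 6)\<close>, which costs at most half of the gain \<sigma> /
    3.\<close>
  define \<epsilon> where "\<epsilon> = min \<sigma> 1 / (6 * real N)"
  have \<epsilon>: "0 < \<epsilon>" using \<sigma> N by (simp add: \<epsilon>_def)
  define lB where "lB = - ln B"
  have lB: "0 < lB" using B by (simp add: lB_def)
  define c2 where "c2 = 1 / (lB * \<epsilon>) + 2"
  have c2: "0 < c2" using lB \<epsilon> by (simp add: c2_def add_pos_pos)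
  define s where "s = min \<sigma> 1 / 6"
  have s: "0 < s" using \<sigma> by (simp add: s_def)
  \<comment> \<open>Above this threshold \<open>b * z powr (1 / 3)\<close> is at least 1, as
    \<open>avg\<close> requires; below it the trivial bound 1 on the integral is used.\<close>
  define Z0 where "Z0 = (1 / b) powr 3"
  have Z0: "1 \<le> Z0" using b by (auto simp: Z0_def intro!: ge_one_powr_ge_zero)
  define c3 where "c3 = c2 ^ N * (C' * b powr - \<sigma>)"
  define c4 where "c4 = 2 * pi * C * D\<^sup>2"
  have c34: "0 \<le> c3" "0 \<le> c4" using c2 C' C by (auto simp: c3_def c4_def)
  define c where "c = c3 + c4 + Z0 powr s"
  have main: "cmod (\<integral>x. cis (2 * pi * Re (\<zeta> * f x)) \<partial>\<mu>) \<le> (c3 + c4) * cmod \<zeta> powr - s"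
    if \<zeta>: "Z0 \<le> cmod \<zeta>" for \<zeta>
  proof -
    define z where "z = cmod \<zeta>"
    have z: "1 \<le> z" "0 < z" using \<zeta> Z0 by (auto simp: z_def)
    define r where "r = z powr - (2 / 3)"
    have r: "0 < r" "r \<le> 1" using z powr_mono[of "- (2 / 3)" 0 z] by (auto simp: r_def)
    have "1 \<le> 1 / r" using r by simp
    then obtain K where K: "B ^ K * (1 / r) \<le> 1" "B \<le> B ^ K * (1 / r)" using power_between[OF B(1,2)] by metis
    let ?S = "{A'\<in>products K. b * r \<le> cmod A'}"
    have "cmod (\<integral>x. cis (2 * pi * Re (\<zeta> * f (1 * x + 0))) \<partial>\<mu>)
      \<le> (\<Sum>A'\<in>?S. \<integral>y. F (\<zeta> * A' * h (1 * y + 0)) \<partial>\<mu>) + lin_err \<zeta> r"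
    proof (rule subdivide[where B = B and m = 0 and k = K])
      show "b * r \<le> cmod 1" using b r mult_le_one[of b r] by simp
      show "cmod 1 * B ^ K \<le> r" using K r by (simp add: field_simps)
    qed (use b B r one_in_products in auto)
    also have "(\<Sum>A'\<in>?S. \<integral>y. F (\<zeta> * A' * h (1 * y + 0)) \<partial>\<mu>) \<le> (\<Sum>A'\<in>?S. C' * (b * z powr (1 / 3)) powr - \<sigma>)"
    proof (rule sum_mono)
      fix A' assume A': "A' \<in> ?S"
      have zr: "z * r = z powr (1 / 3)"
      proof -
        have "z * r = z powr 1 * z powr - (2 / 3)" using z by (simp add: r_def)
        also have "\<dots> = z powr (1 / 3)" by (simp only: powr_add[symmetric]) simp
        finally show ?thesis .
      qed
      have "b * z powr (1 / 3) = z * (b * r)" using zr by (simp add: mult.left_commute)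
      also have "\<dots> \<le> z * cmod A'" using A' z by (intro mult_left_mono) auto
      finally have le: "b * z powr (1 / 3) \<le> cmod (\<zeta> * A')" by (simp add: norm_mult z_def)
      have "1 \<le> b * z powr (1 / 3)"
      proof -
        have "1 / b = Z0 powr (1 / 3)" unfolding Z0_def powr_powr using b by simp
        also have "\<dots> \<le> z powr (1 / 3)" using \<zeta> Z0 by (intro powr_mono2) (auto simp: z_def)
        finally show ?thesis using b by (simp add: field_simps)
      qed
      then have "(\<integral>y. F (\<zeta> * A' * h y) \<partial>\<mu>) \<le> C' * cmod (\<zeta> * A') powr - \<sigma>"
        using le by (intro avg) linarith
      also have "\<dots> \<le> C' * (b * z powr (1 / 3)) powr - \<sigma>"
        using le C' \<sigma> b z by (intro mult_left_mono powr_mono2') auto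
      finally show "(\<integral>y. F (\<zeta> * A' * h (1 * y + 0)) \<partial>\<mu>) \<le> C' * (b * z powr (1 / 3)) powr - \<sigma>" by simp
    qed
    also have "\<dots> = real (card ?S) * (C' * b powr - \<sigma> * z powr - (\<sigma> / 3))"
      by (simp add: powr_mult powr_powr)
    also have "\<dots> \<le> (c2 ^ N * z powr (min \<sigma> 1 / 6)) * (C' * b powr - \<sigma> * z powr - (\<sigma> / 3))"
    proof (rule mult_right_mono)
      have "card ?S \<le> card (products K)" by (intro card_mono finite_products) auto
      then have "real (card ?S) \<le> real ((K + 1) ^ N)" using card_products_le[of K] unfolding N_def by linarith
      also have "\<dots> = (real K + 1) ^ N" by (simp add: add.commute)
      also have "\<dots> \<le> (c2 * z powr \<epsilon>) ^ N"
      proof (rule power_mono)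
        have "ln B \<le> ln (B ^ K * (1 / r))" using K B r by simp
        also have "\<dots> = real K * ln B + 2 / 3 * ln z"
          using B r z by (simp add: ln_mult ln_div ln_realpow r_def ln_powr)
        finally have "real K * lB \<le> lB + 2 / 3 * ln z" by (simp add: lB_def)
        then have "real K \<le> 1 + (2 / 3 * ln z) / lB" using lB by (simp add: field_simps)
        also have "\<dots> \<le> 1 + ln z / lB" using z lB by (intro add_left_mono divide_right_mono) auto
        also have "\<dots> \<le> 1 + (z powr \<epsilon> / \<epsilon>) / lB"
          using z \<epsilon> lB by (intro add_left_mono divide_right_mono ln_powr_bound) auto
        finally have "real K + 1 \<le> 2 + 1 / (lB * \<epsilon>) * z powr \<epsilon>" by (simp add: field_simps)
        also have "\<dots> \<le> 2 * z powr \<epsilon> + 1 / (lB * \<epsilon>) * z powr \<epsilon>"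
          using z \<epsilon> by (intro add_right_mono) (auto intro!: ge_one_powr_ge_zero)
        finally show "real K + 1 \<le> c2 * z powr \<epsilon>" by (simp add: c2_def algebra_simps)
      qed simp
      also have "\<dots> = c2 ^ N * z powr (min \<sigma> 1 / 6)"
        using N z by (simp add: power_mult_distrib powr_power \<epsilon>_def field_simps)
      finally show "real (card ?S) \<le> c2 ^ N * z powr (min \<sigma> 1 / 6)" .
    qed (use C' in simp)
    also have "\<dots> = c3 * z powr (min \<sigma> 1 / 6 - \<sigma> / 3)"
    proof -
      have "z powr (min \<sigma> 1 / 6 - \<sigma> / 3) = z powr (min \<sigma> 1 / 6) * z powr - (\<sigma> / 3)"
        by (simp only: powr_add[symmetric] diff_conv_add_uminus)
      then show ?thesis by (simp only: c3_def mult_ac)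
    qed
    also have "\<dots> \<le> c3 * z powr - s"
      using c34 z \<sigma> by (intro mult_left_mono powr_mono) (auto simp: s_def min_def)
    also have "lin_err \<zeta> r = c4 * (z * (r * r))" by (simp add: lin_err_def c4_def z_def power2_eq_square)
    also have "z * (r * r) = z powr - (1 / 3)"
    proof -
      have "z * (r * r) = z powr 1 * (z powr - (2 / 3) * z powr - (2 / 3))" using z by (simp add: r_def)
      also have "\<dots> = z powr - (1 / 3)" by (simp only: powr_add[symmetric]) simp
      finally show ?thesis .
    qed
    also have "c4 * z powr - (1 / 3) \<le> c4 * z powr - s"
      using c34 z by (intro mult_left_mono powr_mono) (auto simp: s_def min_def)
    finally show ?thesis by (simp add: z_def algebra_simps)
  qed
  show ?thesis
  proof (rule exI[of _ c], intro conjI, use c34 Z0 in \<open>simp add: c_def add_nonneg_pos\<close>, rule exI[of _ s], intro conjI s allI impI)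
    fix \<zeta> :: complex assume "\<zeta> \<noteq> 0"
    then have z: "0 < cmod \<zeta>" by simp
    show "cmod (\<integral>x. cis (2 * pi * Re (\<zeta> * f x)) \<partial>\<mu>) \<le> c * cmod \<zeta> powr - s"
    proof (cases "Z0 \<le> cmod \<zeta>")
      case True
      have "(c3 + c4) * cmod \<zeta> powr - s \<le> c * cmod \<zeta> powr - s"
        by (intro mult_right_mono) (auto simp: c_def)
      then show ?thesis using main[OF True] by linarith
    next
      case False
      have "cmod (\<integral>x. cis (2 * pi * Re (\<zeta> * f x)) \<partial>\<mu>) \<le> 1" by (rule integral_norm_le_1) simp
      also have "1 \<le> (Z0 / cmod \<zeta>) powr s" using False s z by (intro ge_one_powr_ge_zero) auto
      also have "\<dots> = Z0 powr s * cmod \<zeta> powr - s" by (simp add: powr_divide powr_minus_divide)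
      also have "\<dots> \<le> c * cmod \<zeta> powr - s" using c34 by (intro mult_right_mono) (auto simp: c_def)
      finally show ?thesis .
    qed
  qed
qed

lemma image_fourier_decay:
  assumes frostman_h: "\<And>c r. 0 < r \<Longrightarrow> measure \<mu> {x. cmod (h x - c) \<le> r} \<le> C0 * r powr s" "0 \<le> C0" "0 < s"
    and h_bound: "\<And>x. cmod (h x) \<le> H"
    and z: "\<And>i. i \<in> I \<Longrightarrow> a i * z i + t i = z i"
    and distinct: "\<exists>i\<in>I. \<exists>j\<in>I. z i \<noteq> z j"
    and not_line: "(\<exists>i\<in>I. Im (a i) \<noteq> 0) \<or> \<not> (\<exists>c u. \<forall>i\<in>I. \<exists>x::real. z i = c + of_real x * u)"
  shows "\<exists>c>0. \<exists>s>0. \<forall>\<zeta>. \<zeta> \<noteq> 0 \<longrightarrow> cmod (\<integral>x. cis (2 * pi * Re (\<zeta> * f x)) \<partial>\<mu>) \<le> c * cmod \<zeta> powr - s"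
proof -
  have "\<exists>u\<in>I \<times> I \<times> I. \<exists>u'\<in>I \<times> I \<times> I. \<exists>v\<in>I \<times> I \<times> I. \<exists>v'\<in>I \<times> I \<times> I.
    word_a u' = word_a u \<and> word_a v = word_a u \<and> word_a v' = word_a u \<and>
    Im (cnj (word_t u - word_t u') * (word_t v - word_t v')) \<noteq> 0"
    by (rule exists_independent_words[OF _ distinct not_line]) (rule z)
  then obtain u u' v v' where w: "u \<in> I \<times> I \<times> I" "u' \<in> I \<times> I \<times> I" "v \<in> I \<times> I \<times> I" "v' \<in> I \<times> I \<times> I"
    "word_a u' = word_a u" "word_a v = word_a u" "word_a v' = word_a u"
    "Im (cnj (word_t u - word_t u') * (word_t v - word_t v')) \<noteq> 0"
    by (elim bexE conjE) (rule that; assumption)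
  obtain b B \<delta> where d: "damped F b B \<delta>" "0 < b" "0 < B" "B < 1" "0 \<le> \<delta>" "\<delta> < 1"
    using damped_F[OF w] by blast
  have "\<exists>C>0. \<exists>\<sigma>>0. \<forall>\<eta>. 1 \<le> cmod \<eta> \<longrightarrow> (\<integral>x. F (\<eta> * h x) \<partial>\<mu>) \<le> C * cmod \<eta> powr - \<sigma>"
  proof (rule damped_imp_average_decay[OF d(1) F_nonneg F_le_1 F_measurable d(2-) prob_space_axioms _ h_bound])
    show "h \<in> borel_measurable \<mu>" by measurable
    show "measure \<mu> {x \<in> space \<mu>. cmod (h x - c) \<le> r} \<le> C0 * r powr s" if "0 < r" for c r
      using frostman_h(1)[OF that, of c] by simp
  qed (rule frostman_h(2), rule frostman_h(3))
  then obtain C' \<sigma> where C': "0 < C'" "0 < \<sigma>"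
    "\<forall>\<eta>. 1 \<le> cmod \<eta> \<longrightarrow> (\<integral>x. F (\<eta> * h x) \<partial>\<mu>) \<le> C' * cmod \<eta> powr - \<sigma>"
    by (elim exE conjE) (rule that)
  show ?thesis
    by (rule image_fourier_decay_aux[OF C'(3)[rule_format] less_imp_le[OF C'(1)] C'(2)])
qed

end

end


section \<open>Sublevel sets and images of lines under holomorphic maps\<close>

text \<open>\<open>\<zeta> ^ n - w\<close> splits into n linear factors, and a product of n moduli
  that is at most \<open>r ^ n\<close> contains one that is at most r.\<close>

lemma power_diff_root_near:
  fixes w :: complex
  assumes n: "0 < n"
  obtains root :: "nat \<Rightarrow> complex" where
    "\<And>\<zeta> r. 0 \<le> r \<Longrightarrow> cmod (\<zeta> ^ n - w) \<le> r ^ n \<Longrightarrow> \<exists>i<n. cmod (\<zeta> - root i) \<le> r"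
proof -
  define P where "P = monom (1::complex) n + [:- w:]"
  have deg: "degree P = n" using n unfolding P_def by (subst degree_add_eq_left) (auto simp: degree_monom_eq)
  have lead: "lead_coeff P = 1" unfolding deg using n by (auto simp: P_def coeff_pCons split: nat.split)
  obtain root where "smult (lead_coeff P) (\<Prod>i<degree P. [:- root i, 1:]) = P"
    by (rule complex_poly_decompose')
  then have P: "P = (\<Prod>i<n. [:- root i, 1:])" using lead by (simp add: deg)
  have eval: "\<zeta> ^ n - w = (\<Prod>i<n. \<zeta> - root i)" for \<zeta>
  proof -
    have "poly P \<zeta> = \<zeta> ^ n - w" by (simp add: P_def poly_monom)
    moreover have "poly P \<zeta> = (\<Prod>i<n. \<zeta> - root i)" by (simp add: P poly_prod)
    ultimately show ?thesis by simp
  qed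
  show ?thesis
  proof (rule that)
    fix \<zeta> and r :: real assume r: "0 \<le> r" "cmod (\<zeta> ^ n - w) \<le> r ^ n"
    show "\<exists>i<n. cmod (\<zeta> - root i) \<le> r"
    proof (rule ccontr)
      assume "\<not> ?thesis"
      then have lt: "r < cmod (\<zeta> - root i)" if "i < n" for i using that by (meson not_le)
      have "(\<Prod>i<n. r) < (\<Prod>i<n. cmod (\<zeta> - root i))"
      proof (rule prod_mono_strict[of 0])
        show "0 \<le> r \<and> r \<le> cmod (\<zeta> - root i)" if "i \<in> {..<n}" for i using lt[of i] r that by simp
        show "0 < cmod (\<zeta> - root i)" if "i \<in> {..<n}" for i
          by (rule le_less_trans[OF r(1) lt]) (use that in simp)
      qed (use lt[of 0] n in simp_all)
      then show False using r(2) unfolding eval prod_norm by simp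
    qed
  qed
qed

text \<open>With n the order of vanishing of \<open>h - h \<xi>\<close> at \<xi>, this difference is
  the n-th power of a holomorphic function with a simple zero. Such a function is a local
  coordinate, which gives the lower Lipschitz bound.\<close>

lemma holomorphic_locally_power:
  assumes h: "h holomorphic_on ball \<xi> \<epsilon>" "0 < \<epsilon>" and nc: "\<not> h constant_on ball \<xi> \<epsilon>"
  obtains \<rho> \<kappa> \<zeta> n where "0 < \<rho>" "0 < \<kappa>" "0 < n"
    "\<And>x. x \<in> ball \<xi> \<rho> \<Longrightarrow> h x - h \<xi> = \<zeta> x ^ n"
    "\<And>x y. x \<in> ball \<xi> \<rho> \<Longrightarrow> y \<in> ball \<xi> \<rho> \<Longrightarrow> \<kappa> * cmod (x - y) \<le> cmod (\<zeta> x - \<zeta> y)"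
proof -
  have "\<exists>n>0. (deriv ^^ n) h \<xi> \<noteq> 0"
  proof (rule ccontr)
    assume "\<not> ?thesis"
    then have z: "(deriv ^^ n) h \<xi> = 0" if "0 < n" for n using that by blast
    have "h w = h \<xi>" if "w \<in> ball \<xi> \<epsilon>" for w
      by (rule holomorphic_fun_eq_const_on_connected[OF h(1) open_ball connected_ball]) (use z that h in auto)
    then show False using nc by (auto simp: constant_on_def)
  qed
  then obtain n where n: "0 < n \<and> (deriv ^^ n) h \<xi> \<noteq> 0" "\<And>i. i < n \<Longrightarrow> \<not> (0 < i \<and> (deriv ^^ i) h \<xi> \<noteq> 0)"
    using exists_least_iff[of "\<lambda>n. 0 < n \<and> (deriv ^^ n) h \<xi> \<noteq> 0"] by blast
  obtain g r where r: "0 < r" and g: "g holomorphic_on ball \<xi> r"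
    and eq: "\<And>w. w \<in> ball \<xi> r \<Longrightarrow> h w - h \<xi> = ((w - \<xi>) * g w) ^ n"
    and gnz: "\<And>w. w \<in> ball \<xi> r \<Longrightarrow> g w \<noteq> 0"
    by (rule holomorphic_factor_order_of_zero_strong[OF h(1) open_ball, of \<xi> n]) (use n h in auto)
  define \<zeta> where "\<zeta> w = (w - \<xi>) * g w" for w
  have hol: "\<zeta> holomorphic_on ball \<xi> r" unfolding \<zeta>_def by (intro holomorphic_intros g)
  have d\<xi>: "deriv \<zeta> \<xi> = g \<xi>"
  proof -
    have "(g has_field_derivative deriv g \<xi>) (at \<xi>)"
      using g r by (intro holomorphic_derivI[of g "ball \<xi> r"]) auto
    then have "(\<zeta> has_field_derivative g \<xi>) (at \<xi>)"
      unfolding \<zeta>_def[abs_def] by (auto intro!: derivative_eq_intros)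
    then show ?thesis by (rule DERIV_imp_deriv)
  qed
  \<comment> \<open>While \<open>deriv \<zeta>\<close> stays within \<kappa> of
    \<open>g \<xi>\<close>, the function \<open>\<zeta> w - g \<xi> * w\<close> is
    \<kappa>-Lipschitz; of the modulus \<open>2 * \<kappa>\<close> of \<open>g \<xi>\<close> half
    survives as a lower bound.\<close>
  define \<kappa> where "\<kappa> = cmod (g \<xi>) / 2"
  have \<kappa>: "0 < \<kappa>" using gnz r by (simp add: \<kappa>_def)
  have "continuous_on (ball \<xi> r) (deriv \<zeta>)"
    using hol by (intro holomorphic_on_imp_continuous_on holomorphic_deriv) auto
  then have "isCont (deriv \<zeta>) \<xi>" using r by (simp add: continuous_on_eq_continuous_at)
  then obtain e where e: "0 < e" "\<And>w. dist w \<xi> < e \<Longrightarrow> dist (deriv \<zeta> w) (deriv \<zeta> \<xi>) < \<kappa>"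
    using \<kappa> unfolding continuous_at_eps_delta by (auto simp: dist_norm)
  define \<rho> where "\<rho> = min e r"
  have \<rho>: "0 < \<rho>" "\<rho> \<le> e" "\<rho> \<le> r" using e r by (auto simp: \<rho>_def)
  show ?thesis
  proof (rule that[OF \<rho>(1) \<kappa>])
    show "0 < n" using n by simp
    show "h x - h \<xi> = \<zeta> x ^ n" if "x \<in> ball \<xi> \<rho>" for x using eq[of x] that \<rho> by (simp add: \<zeta>_def)
    fix x y assume xy: "x \<in> ball \<xi> \<rho>" "y \<in> ball \<xi> \<rho>"
    have "cmod ((\<zeta> x - g \<xi> * x) - (\<zeta> y - g \<xi> * y)) \<le> \<kappa> * cmod (x - y)"
    proof (rule field_differentiable_bound[where S = "ball \<xi> \<rho>" and f' = "\<lambda>w. deriv \<zeta> w - g \<xi>"])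
      fix z assume z: "z \<in> ball \<xi> \<rho>"
      have "(\<zeta> has_field_derivative deriv \<zeta> z) (at z)"
        using hol z \<rho> by (intro holomorphic_derivI[of \<zeta> "ball \<xi> r"]) auto
      then have "((\<lambda>w. \<zeta> w - g \<xi> * w) has_field_derivative deriv \<zeta> z - g \<xi>) (at z)"
        by (auto intro!: derivative_eq_intros)
      then show "((\<lambda>w. \<zeta> w - g \<xi> * w) has_field_derivative deriv \<zeta> z - g \<xi>) (at z within ball \<xi> \<rho>)"
        by (rule has_field_derivative_at_within)
      show "cmod (deriv \<zeta> z - g \<xi>) \<le> \<kappa>"
        using e(2)[of z] z \<rho> d\<xi> by (simp add: dist_norm norm_minus_commute)
    qed (use xy in auto)
    moreover have "(\<zeta> x - g \<xi> * x) - (\<zeta> y - g \<xi> * y) = (\<zeta> x - \<zeta> y) - g \<xi> * (x - y)" by (simp add: algebra_simps)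
    moreover have "cmod (g \<xi> * (x - y)) = 2 * (\<kappa> * cmod (x - y))" by (simp add: \<kappa>_def norm_mult)
    moreover have "cmod (g \<xi> * (x - y)) \<le> cmod ((\<zeta> x - \<zeta> y) - g \<xi> * (x - y)) + cmod (\<zeta> x - \<zeta> y)"
      using norm_triangle_ineq3[of "\<zeta> x - \<zeta> y" "g \<xi> * (x - y)"] norm_triangle_sub[of "g \<xi> * (x - y)" "\<zeta> x - \<zeta> y"]
      by (simp add: norm_minus_commute add.commute)
    ultimately show "\<kappa> * cmod (x - y) \<le> cmod (\<zeta> x - \<zeta> y)" by simp
  qed
qed

text \<open>In the coordinate of \<open>holomorphic_locally_power\<close> a sublevel set lies near n
  roots. Pulling back through the lower Lipschitz bound gives n discs, at the price of the exponent
  1 / n.\<close>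

lemma sublevel_cover:
  assumes h: "h holomorphic_on ball \<xi> \<epsilon>" "0 < \<epsilon>" and nc: "\<not> h constant_on ball \<xi> \<epsilon>"
  shows "\<exists>\<rho>>0. \<exists>R>0. \<exists>n::nat. 0 < n \<and>
    (\<forall>c r. 0 < r \<longrightarrow> (\<exists>s. {x \<in> ball \<xi> \<rho>. cmod (h x - c) \<le> r} \<subseteq> (\<Union>i<n. cball (s i) (R * r powr (1 / real n)))))"
proof -
  obtain \<rho> \<kappa> \<zeta> n where 1: "0 < \<rho>" "0 < \<kappa>" "0 < n"
    and 2: "\<And>x. x \<in> ball \<xi> \<rho> \<Longrightarrow> h x - h \<xi> = \<zeta> x ^ n"
    and 3: "\<And>x y. x \<in> ball \<xi> \<rho> \<Longrightarrow> y \<in> ball \<xi> \<rho> \<Longrightarrow> \<kappa> * cmod (x - y) \<le> cmod (\<zeta> x - \<zeta> y)"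
    using holomorphic_locally_power[OF h nc] by metis
  show ?thesis
  proof (rule exI[of _ \<rho>], rule conjI[OF 1(1)], rule exI[of _ "2 / \<kappa>"], rule conjI, use 1 in simp,
      rule exI[of _ n], rule conjI[OF 1(3)], intro allI impI)
    fix c and r :: real assume r: "0 < r"
    define r' where "r' = r powr (1 / n)"
    have r': "0 \<le> r'" "r' ^ n = r" using r 1 by (auto simp: r'_def powr_power)
    obtain root where root: "\<And>\<zeta> r. 0 \<le> r \<Longrightarrow> cmod (\<zeta> ^ n - (c - h \<xi>)) \<le> r ^ n \<Longrightarrow> \<exists>i<n. cmod (\<zeta> - root i) \<le> r"
      using power_diff_root_near[OF 1(3), of "c - h \<xi>"] by metis
    \<comment> \<open>The roots need not lie in the range of the coordinate, so each disc is centred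
      at some point whose coordinate is close to the root, which doubles the radius. Where no such
      point exists, no x is assigned to that root and any centre will do.\<close>
    define s where "s i = (SOME x. x \<in> ball \<xi> \<rho> \<and> cmod (\<zeta> x - root i) \<le> r')" for i
    show "\<exists>s. {x \<in> ball \<xi> \<rho>. cmod (h x - c) \<le> r} \<subseteq> (\<Union>i<n. cball (s i) (2 / \<kappa> * r powr (1 / n)))"
    proof (intro exI[of _ s] subsetI)
      fix x assume x: "x \<in> {x \<in> ball \<xi> \<rho>. cmod (h x - c) \<le> r}"
      have "\<zeta> x ^ n - (c - h \<xi>) = h x - c" using 2[of x] x by (simp add: algebra_simps)
      moreover have "cmod (h x - c) \<le> r' ^ n" using x r' by simp
      ultimately have "cmod (\<zeta> x ^ n - (c - h \<xi>)) \<le> r' ^ n" by (simp only:)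
      then obtain i where i: "i < n" "cmod (\<zeta> x - root i) \<le> r'" using root[OF r'(1)] by blast
      have "s i \<in> ball \<xi> \<rho> \<and> cmod (\<zeta> (s i) - root i) \<le> r'"
        unfolding s_def by (rule someI[of _ x]) (use x i in auto)
      then have s: "s i \<in> ball \<xi> \<rho>" "cmod (\<zeta> (s i) - root i) \<le> r'" by auto
      have "\<kappa> * cmod (s i - x) \<le> cmod (\<zeta> (s i) - \<zeta> x)" using 3 s x by blast
      also have "\<dots> \<le> cmod (\<zeta> (s i) - root i) + cmod (\<zeta> x - root i)"
        using norm_triangle_ineq4[of "\<zeta> (s i) - root i" "\<zeta> x - root i"] by simp
      also have "\<dots> \<le> 2 * r'" using s i by simp
      finally have "cmod (s i - x) \<le> 2 / \<kappa> * r'" using 1 by (simp add: field_simps)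
      then show "x \<in> (\<Union>i<n. cball (s i) (2 / \<kappa> * r powr (1 / n)))"
        using i by (auto simp: dist_norm r'_def)
    qed
  qed
qed

text \<open>Each point of \<open>L\<close> has a neighbourhood in which sublevel sets of
  \<open>h\<close> are covered by discs whose radius is a power of r. Compactness leaves finitely
  many neighbourhoods, and the least exponent serves for r \<le> 1.\<close>

lemma frostman_holomorphic:
  assumes \<mu>: "prob_space \<mu>" "sets \<mu> = sets borel" and L: "compact L" "L \<subseteq> V" and V: "open V"
    and h: "h holomorphic_on V"
    and nc: "\<And>\<xi> \<epsilon>. \<xi> \<in> L \<Longrightarrow> 0 < \<epsilon> \<Longrightarrow> ball \<xi> \<epsilon> \<subseteq> V \<Longrightarrow> \<not> h constant_on ball \<xi> \<epsilon>"
    and frostman: "\<And>c r. 0 < r \<Longrightarrow> measure \<mu> {x. cmod (x - c) \<le> r} \<le> C0 * r powr s" "0 \<le> C0" "0 < s"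
  shows "\<exists>C s. 0 \<le> C \<and> 0 < s \<and> (\<forall>c r. 0 < r \<longrightarrow> measure \<mu> {x \<in> L. cmod (h x - c) \<le> r} \<le> C * r powr s)"
proof -
  interpret prob_space \<mu> by (rule \<mu>)
  \<comment> \<open>The bound is stated through a measurable superset \<open>T\<close>, the form
    that monotonicity of the measure can use directly.\<close>
  define P where "P \<xi> \<rho> C \<sigma> \<longleftrightarrow> (\<forall>c r. 0 < r \<longrightarrow> (\<exists>T. {x \<in> ball \<xi> \<rho>. cmod (h x - c) \<le> r} \<subseteq> T \<and> T \<in> sets \<mu> \<and>
    measure \<mu> T \<le> C * r powr \<sigma>))" for \<xi> \<rho> C \<sigma>
  have "\<exists>\<rho>>0. \<exists>C\<ge>0. \<exists>\<sigma>>0. P \<xi> \<rho> C \<sigma>"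
    if \<xi>: "\<xi> \<in> L" for \<xi>
  proof -
    obtain \<epsilon> where \<epsilon>: "0 < \<epsilon>" "ball \<xi> \<epsilon> \<subseteq> V" using \<xi> L(2) V unfolding open_contains_ball by blast
    have "\<exists>\<rho>>0. \<exists>R>0. \<exists>n::nat. 0 < n \<and>
      (\<forall>c r. 0 < r \<longrightarrow> (\<exists>s. {x \<in> ball \<xi> \<rho>. cmod (h x - c) \<le> r} \<subseteq> (\<Union>i<n. cball (s i) (R * r powr (1 / real n)))))"
      by (rule sublevel_cover[OF holomorphic_on_subset[OF h \<epsilon>(2)] \<epsilon>(1) nc[OF \<xi> \<epsilon>]])
    then obtain \<rho> R n where 1: "0 < \<rho>" "0 < R" "0 < (n::nat)" and
      2: "\<forall>c r. 0 < r \<longrightarrow> (\<exists>s. {x \<in> ball \<xi> \<rho>. cmod (h x - c) \<le> r} \<subseteq> (\<Union>i<n. cball (s i) (R * r powr (1 / real n))))"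
      by (elim exE conjE) (rule that)
    show ?thesis
      unfolding P_def
    proof (rule exI[of _ \<rho>], rule conjI[OF 1(1)], rule exI[of _ "real n * (C0 * R powr s)"], rule conjI,
        use frostman in simp, rule exI[of _ "s / n"], intro conjI allI impI)
      fix c and r :: real assume r: "0 < r"
      obtain u where u: "{x \<in> ball \<xi> \<rho>. cmod (h x - c) \<le> r} \<subseteq> (\<Union>i<n. cball (u i) (R * r powr (1 / n)))"
        using 2[rule_format, OF r, of c] by (elim exE) (rule that)
      have "measure \<mu> (\<Union>i<n. cball (u i) (R * r powr (1 / n))) \<le> (\<Sum>i<n. measure \<mu> (cball (u i) (R * r powr (1 / n))))"
        by (rule finite_measure_subadditive_finite) (auto simp: \<mu>(2))
      also have "\<dots> \<le> (\<Sum>i<n. C0 * (R * r powr (1 / n)) powr s)"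
      proof (rule sum_mono)
        fix i
        have "cball (u i) (R * r powr (1 / n)) = {x. cmod (x - u i) \<le> R * r powr (1 / n)}"
          by (auto simp: dist_norm norm_minus_commute)
        then show "measure \<mu> (cball (u i) (R * r powr (1 / n))) \<le> C0 * (R * r powr (1 / n)) powr s"
          using frostman(1)[of "R * r powr (1 / n)" "u i"] 1 r by simp
      qed
      also have "\<dots> = real n * (C0 * R powr s) * r powr (s / n)" by (simp add: powr_mult powr_powr)
      finally show "\<exists>T. {x \<in> ball \<xi> \<rho>. cmod (h x - c) \<le> r} \<subseteq> T \<and> T \<in> sets \<mu> \<and> measure \<mu> T \<le> real n * (C0 * R powr s) * r powr (s / n)"
        using u \<mu> by (intro exI[of _ "\<Union>i<n. cball (u i) (R * r powr (1 / n))"]) auto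
    qed (use frostman 1 in simp)
  qed
  then obtain \<rho> C \<sigma> where \<rho>: "\<And>\<xi>. \<xi> \<in> L \<Longrightarrow> 0 < \<rho> \<xi>" "\<And>\<xi>. \<xi> \<in> L \<Longrightarrow> 0 \<le> C \<xi>" "\<And>\<xi>. \<xi> \<in> L \<Longrightarrow> 0 < \<sigma> \<xi>"
    "\<And>\<xi>. \<xi> \<in> L \<Longrightarrow> P \<xi> (\<rho> \<xi>) (C \<xi>) (\<sigma> \<xi>)"
    by metis
  obtain X where X: "X \<subseteq> L" "finite X" "L \<subseteq> (\<Union>\<xi>\<in>X. ball \<xi> (\<rho> \<xi>))"
    by (rule compactE_image[OF L(1), of L "\<lambda>\<xi>. ball \<xi> (\<rho> \<xi>)"]) (use \<rho>(1) in auto)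
  define \<sigma>0 where "\<sigma>0 = Min (insert 1 (\<sigma> ` X))"
  have \<sigma>0: "0 < \<sigma>0" "\<And>\<xi>. \<xi> \<in> X \<Longrightarrow> \<sigma>0 \<le> \<sigma> \<xi>" using X \<rho> by (auto simp: \<sigma>0_def)
  \<comment> \<open>The summand 1 makes the bound trivial for r > 1.\<close>
  define C' where "C' = sum C X + 1"
  have sC: "0 \<le> sum C X" using X \<rho> by (intro sum_nonneg) auto
  have "measure \<mu> {x \<in> L. cmod (h x - c) \<le> r} \<le> C' * r powr \<sigma>0" if r: "0 < r" for c r
  proof (cases "r \<le> 1")
    case False
    then have "1 \<le> r powr \<sigma>0" using \<sigma>0 by (intro ge_one_powr_ge_zero) auto
    then have "1 * 1 \<le> C' * r powr \<sigma>0" using sC by (intro mult_mono) (auto simp: C'_def)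
    then show ?thesis using prob_le_1 order_trans by (metis mult_1)
  next
    case True
    define Q where "Q \<xi> T \<longleftrightarrow> {x \<in> ball \<xi> (\<rho> \<xi>). cmod (h x - c) \<le> r} \<subseteq> T \<and> T \<in> sets \<mu> \<and> measure \<mu> T \<le> C \<xi> * r powr (\<sigma> \<xi>)" for \<xi> T
    have "\<exists>T. Q \<xi> T" if "\<xi> \<in> X" for \<xi>
      using \<rho>(4)[of \<xi>] that X(1) r unfolding P_def Q_def by (simp add: subset_eq)
    then obtain T where "\<And>\<xi>. \<xi> \<in> X \<Longrightarrow> Q \<xi> (T \<xi>)" by metis
    then have T: "{x \<in> ball \<xi> (\<rho> \<xi>). cmod (h x - c) \<le> r} \<subseteq> T \<xi>" "T \<xi> \<in> sets \<mu>" "measure \<mu> (T \<xi>) \<le> C \<xi> * r powr (\<sigma> \<xi>)"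
      if "\<xi> \<in> X" for \<xi> using that by (simp_all add: Q_def)
    have "measure \<mu> {x \<in> L. cmod (h x - c) \<le> r} \<le> measure \<mu> (\<Union>\<xi>\<in>X. T \<xi>)"
    proof (rule finite_measure_mono)
      show "(\<Union>\<xi>\<in>X. T \<xi>) \<in> sets \<mu>" using X T by auto
      show "{x \<in> L. cmod (h x - c) \<le> r} \<subseteq> (\<Union>\<xi>\<in>X. T \<xi>)"
        using X(3) T by fastforce
    qed
    also have "\<dots> \<le> (\<Sum>\<xi>\<in>X. measure \<mu> (T \<xi>))" by (rule finite_measure_subadditive_finite[OF X(2)]) (use T(2) in blast)
    also have "\<dots> \<le> (\<Sum>\<xi>\<in>X. C \<xi> * r powr \<sigma>0)"
    proof (rule sum_mono)
      fix \<xi> assume \<xi>: "\<xi> \<in> X"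
      have "measure \<mu> (T \<xi>) \<le> C \<xi> * r powr (\<sigma> \<xi>)" using T \<xi> by blast
      also have "\<dots> \<le> C \<xi> * r powr \<sigma>0"
        using \<rho>(2) \<xi> X r True \<sigma>0 by (intro mult_left_mono powr_mono') auto
      finally show "measure \<mu> (T \<xi>) \<le> C \<xi> * r powr \<sigma>0" .
    qed
    also have "\<dots> \<le> C' * r powr \<sigma>0" by (simp add: C'_def sum_distrib_right[symmetric] algebra_simps)
    finally show ?thesis .
  qed
  moreover have "0 \<le> C'" using sC by (simp add: C'_def)
  ultimately show ?thesis using \<sigma>0 by blast
qed

text \<open>\<open>L\<close> may fail to be convex, so Taylor's formula serves only pairs at
  distance at most \<delta>, whose discs stay in \<open>V\<close>. For distant pairs the left side
  is bounded by \<open>B\<close> and \<open>cmod (y - x)\<close> exceeds \<delta>, whence the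
  summand \<open>B / \<delta>\<^sup>2\<close>.\<close>

lemma taylor_bound_compact:
  assumes L: "compact L" "L \<subseteq> V" and V: "open V" and f: "f holomorphic_on V"
  shows "\<exists>C\<ge>0. \<forall>x\<in>L. \<forall>y\<in>L. cmod (f y - f x - deriv f x * (y - x)) \<le> C * (cmod (y - x))\<^sup>2"
proof -
  obtain \<delta> where \<delta>: "0 < \<delta>" "(\<Union>x\<in>L. cball x \<delta>) \<subseteq> V"
    using compact_subset_open_imp_cball_epsilon_subset[OF L(1) V L(2)] by metis
  let ?N = "\<Union>x\<in>L. cball x \<delta>"
  have N: "compact ?N" by (rule compact_minkowski_sum_cball[OF L(1)])
  have d1: "deriv f holomorphic_on V" and d2: "deriv (deriv f) holomorphic_on V"
    using f V by (auto intro: holomorphic_deriv)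
  have bnd: "\<exists>b. \<forall>x\<in>S. cmod (k x) \<le> b" if "compact S" "S \<subseteq> V" "k holomorphic_on V" for S and k :: "complex \<Rightarrow> complex"
  proof -
    have "compact (k ` S)"
      by (rule compact_continuous_image[OF holomorphic_on_imp_continuous_on[OF holomorphic_on_subset[OF that(3,2)]] that(1)])
    then have "\<exists>b. \<forall>y\<in>k ` S. cmod y \<le> b" using compact_imp_bounded bounded_iff by metis
    then show ?thesis by simp
  qed
  obtain b2 where b2: "\<forall>x\<in>?N. cmod (deriv (deriv f) x) \<le> b2" using bnd[OF N \<delta>(2) d2] by (elim exE) (rule that)
  obtain b0 where b0: "\<forall>x\<in>L. cmod (f x) \<le> b0" using bnd[OF L f] by (elim exE) (rule that)
  obtain b1 where b1: "\<forall>x\<in>L. cmod (deriv f x) \<le> b1" using bnd[OF L d1] by (elim exE) (rule that)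
  obtain D where D: "\<forall>x\<in>L. cmod x \<le> D" using bnd[OF L holomorphic_on_id] by (auto simp: id_def)
  define B where "B = 2 * \<bar>b0\<bar> + \<bar>b1\<bar> * (2 * \<bar>D\<bar>)"
  have B0: "0 \<le> B" by (simp add: B_def)
  show ?thesis
  proof (intro exI[of _ "\<bar>b2\<bar> + B / \<delta>\<^sup>2"] conjI ballI)
    show "0 \<le> \<bar>b2\<bar> + B / \<delta>\<^sup>2" using B0 by simp
    fix x y assume xy: "x \<in> L" "y \<in> L"
    show "cmod (f y - f x - deriv f x * (y - x)) \<le> (\<bar>b2\<bar> + B / \<delta>\<^sup>2) * (cmod (y - x))\<^sup>2"
    proof (cases "cmod (y - x) \<le> \<delta>")
      case True
      have sub: "cball x \<delta> \<subseteq> V" using \<delta>(2) xy(1) by (simp only: UN_subset_iff)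
      define k where "k = (\<lambda>i::nat. (deriv ^^ i) f)"
      have "cmod (k 0 y - (\<Sum>i\<le>1. k i x * (y - x) ^ i / (fact i))) \<le> \<bar>b2\<bar> * cmod (y - x) ^ (Suc 1) / fact 1"
      proof (rule complex_Taylor[where S = "cball x \<delta>"])
        fix i z assume z: "z \<in> cball x \<delta>"
        have "(deriv ^^ i) f holomorphic_on V" by (rule holomorphic_higher_deriv[OF f V])
        then show "(k i has_field_derivative k (Suc i) z) (at z within cball x \<delta>)"
          using holomorphic_derivI[OF _ V, of "(deriv ^^ i) f" z] sub z
          by (auto simp: k_def intro: has_field_derivative_at_within)
        have "z \<in> ?N" using z xy(1) by (rule UN_I[rotated])
        then have "cmod (deriv (deriv f) z) \<le> b2" using b2 by (rule bspec[rotated])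
        then show "cmod (k (Suc 1) z) \<le> \<bar>b2\<bar>" by (simp add: k_def)
      qed (use True \<delta> in \<open>auto simp: dist_norm norm_minus_commute\<close>)
      then have "cmod (f y - f x - deriv f x * (y - x)) \<le> \<bar>b2\<bar> * (cmod (y - x))\<^sup>2"
        by (simp add: k_def algebra_simps power2_eq_square)
      also have "\<dots> \<le> (\<bar>b2\<bar> + B / \<delta>\<^sup>2) * (cmod (y - x))\<^sup>2" using B0 by (intro mult_right_mono) auto
      finally show ?thesis .
    next
      case False
      have "cmod (f y - f x - deriv f x * (y - x)) \<le> cmod (f y) + cmod (f x) + cmod (deriv f x) * cmod (y - x)"
        by (simp only: norm_mult[symmetric]) (intro order_trans[OF norm_triangle_ineq4] add_mono norm_triangle_ineq4 order_refl)
      also have "\<dots> \<le> \<bar>b0\<bar> + \<bar>b0\<bar> + \<bar>b1\<bar> * (2 * \<bar>D\<bar>)"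
      proof (intro add_mono mult_mono)
        show "cmod (y - x) \<le> 2 * \<bar>D\<bar>"
          using norm_triangle_ineq4[of y x] bspec[OF D xy(1)] bspec[OF D xy(2)] by linarith
      qed (use bspec[OF b0 xy(1)] bspec[OF b0 xy(2)] bspec[OF b1 xy(1)] in auto)
      also have "\<dots> = B / \<delta>\<^sup>2 * \<delta>\<^sup>2" using \<delta> by (simp add: B_def)
      also have "\<dots> \<le> B / \<delta>\<^sup>2 * (cmod (y - x))\<^sup>2"
        using False \<delta> B0 by (intro mult_left_mono power_mono) auto
      also have "\<dots> \<le> (\<bar>b2\<bar> + B / \<delta>\<^sup>2) * (cmod (y - x))\<^sup>2" by (intro mult_right_mono) auto
      finally show ?thesis .
    qed
  qed
qed

text \<open>Near each point the curve is \<open>f\<close> composed with an affine parametrisation of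
  a chord: the Taylor series of \<open>f\<close> gives analyticity, its injectivity a nonzero
  derivative, and \<open>g\<close> a continuous inverse. Taking \<open>W\<close> as the image of a
  disc makes the curve embedded, since injectivity keeps other parts of the line out of
  \<open>W\<close>.\<close>

lemma analytic_curve_image_line:
  assumes V: "open V" and f: "f holomorphic_on V" "inj_on f V" and g: "g holomorphic_on f ` V" "\<And>x. x \<in> V \<Longrightarrow> g (f x) = x"
    and W0: "open W0" "W0 \<subseteq> V" and u: "u \<noteq> 0" and ne: "W0 \<inter> range (\<lambda>x::real. c + of_real x * u) \<noteq> {}"
  shows "analytic_curve (f ` (W0 \<inter> range (\<lambda>x::real. c + of_real x * u)))"
proof -
  let ?l = "range (\<lambda>x::real. c + of_real x * u)"
  show ?thesis
    unfolding analytic_curve_def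
  proof (intro conjI ballI)
    show "f ` (W0 \<inter> ?l) \<noteq> {}" using ne by simp
    fix z0 assume "z0 \<in> f ` (W0 \<inter> ?l)"
    then obtain x0 s0 where x0: "z0 = f x0" "x0 \<in> W0" "x0 = c + of_real s0 * u" by blast
    obtain r where r: "0 < r" "ball x0 r \<subseteq> W0" using W0(1) x0(2) unfolding open_contains_ball by blast
    have rV: "ball x0 r \<subseteq> V" using r W0 by blast
    \<comment> \<open>\<open>v\<close> has length r, so t in (0, 1) runs through the diameter of
      \<open>ball x0 r\<close> in the direction u.\<close>
    define v where "v = of_real (r / cmod u) * u"
    have v: "cmod v = r" unfolding v_def norm_mult norm_of_real using r u by simp
    have v0: "v \<noteq> 0" using v r by auto
    define W where "W = f ` ball x0 r"
    define ln where "ln t = x0 + of_real (2 * t - 1) * v" for t :: real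
    define \<gamma> where "\<gamma> t = f (ln t)" for t
    define inv where "inv z = (1 + Re ((g z - x0) / v)) / 2" for z
    have W: "open W" unfolding W_def
      by (rule open_mapping_thm3) (use f rV in \<open>auto intro: holomorphic_on_subset inj_on_subset\<close>)
    have ln_ball: "ln t \<in> ball x0 r" if "t \<in> {0<..<1}" for t
    proof -
      have "cmod (of_real (2 * t - 1) * v) = \<bar>2 * t - 1\<bar> * r" by (simp only: norm_mult norm_of_real v)
      also have "\<dots> < 1 * r" using that r by (intro mult_strict_right_mono) (auto simp: abs_if)
      finally show ?thesis by (simp add: ln_def dist_norm)
    qed
    have ln_line: "ln t \<in> ?l" for t
      by (rule range_eqI[of _ _ "s0 + (2 * t - 1) * (r / cmod u)"]) (use u in \<open>simp add: ln_def x0 v_def field_simps\<close>)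
    have line_ball: "\<exists>t\<in>{0<..<1}. x = ln t" if xl: "x \<in> ?l" and xb: "x \<in> ball x0 r" for x
    proof -
      obtain s where s: "x = c + of_real s * u" using xl by blast
      define q where "q = (s - s0) * cmod u / r"
      have "x - x0 = of_real (s - s0) * u" by (simp add: s x0 algebra_simps)
      also have "s - s0 = q * (r / cmod u)" using r u by (simp add: q_def)
      finally have e: "x - x0 = of_real q * v" by (simp only: v_def of_real_mult mult.assoc)
      have "cmod (x - x0) = \<bar>q\<bar> * r" by (simp only: e norm_mult norm_of_real v)
      then have "\<bar>q\<bar> * r < 1 * r" using xb by (simp add: dist_norm norm_minus_commute)
      then have "\<bar>q\<bar> < 1" using r by (simp only: mult_less_cancel_right_pos)
      then have "(1 + q) / 2 \<in> {0<..<1}" by (simp add: abs_less_iff)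
      moreover have "x = ln ((1 + q) / 2)"
      proof -
        have "2 * ((1 + q) / 2) - 1 = q" by (simp add: field_simps)
        then show ?thesis unfolding ln_def by (simp only: e[symmetric]) simp
      qed
      ultimately show ?thesis by (rule bexI[rotated])
    qed
    have \<Gamma>W: "f ` (W0 \<inter> ?l) \<inter> W = \<gamma> ` {0<..<1}"
    proof
      show "\<gamma> ` {0<..<1} \<subseteq> f ` (W0 \<inter> ?l) \<inter> W"
      proof
        fix z assume "z \<in> \<gamma> ` {0<..<1}"
        then obtain t where t: "t \<in> {0<..<1}" "z = f (ln t)" by (auto simp: \<gamma>_def)
        have "ln t \<in> W0 \<inter> ?l" using ln_line[of t] r(2) ln_ball[OF t(1)] by (intro IntI) auto
        then show "z \<in> f ` (W0 \<inter> ?l) \<inter> W"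
          unfolding t(2) W_def using ln_ball[OF t(1)] by (simp only: Int_iff imageI simp_thms)
      qed
      show "f ` (W0 \<inter> ?l) \<inter> W \<subseteq> \<gamma> ` {0<..<1}"
      proof
        fix z assume "z \<in> f ` (W0 \<inter> ?l) \<inter> W"
        then have z: "z \<in> f ` (W0 \<inter> ?l)" "z \<in> f ` ball x0 r" by (simp_all only: Int_iff W_def)
        obtain x where x: "z = f x" "x \<in> W0 \<inter> ?l" using z(1) by (rule imageE)
        obtain y where y: "z = f y" "y \<in> ball x0 r" using z(2) by (rule imageE)
        have xy: "x \<in> W0" "x \<in> ?l" "z = f x" "y \<in> ball x0 r" "z = f y"
          using x y by (simp_all only: Int_iff)
        have "x = y"
          by (rule inj_onD[OF f(2)]) (use xy W0(2) rV in auto)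
        then have "\<exists>t\<in>{0<..<1}. x = ln t" using line_ball[OF xy(2)] xy(4) by simp
        then obtain t where "t \<in> {0<..<1}" "x = ln t" by (elim bexE) (rule that)
        then show "z \<in> \<gamma> ` {0<..<1}" using xy by (auto simp: \<gamma>_def)
      qed
    qed
    have inv: "inv (\<gamma> t) = t" if "t \<in> {0<..<1}" for t
    proof -
      have "g (\<gamma> t) = ln t" unfolding \<gamma>_def using g(2) ln_ball[OF that] rV by blast
      then have "(g (\<gamma> t) - x0) / v = of_real (2 * t - 1)" using v0 by (simp add: ln_def)
      then show ?thesis by (simp add: inv_def)
    qed
    have deriv_ln: "(ln has_vector_derivative 2 * v) (at t)" for t
      unfolding ln_def[abs_def] by (auto intro!: derivative_eq_intros)
    have deriv_\<gamma>: "(\<gamma> has_vector_derivative 2 * v * deriv f (ln t)) (at t)" if "t \<in> {0<..<1}" for t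
    proof -
      have "(f has_field_derivative deriv f (ln t)) (at (ln t))"
        using holomorphic_derivI[OF f(1) V] ln_ball[OF that] rV by blast
      from field_vector_diff_chain_at[OF deriv_ln this] show ?thesis by (simp add: \<gamma>_def[abs_def] o_def)
    qed
    have powser: "\<exists>\<rho>>0. \<exists>a. \<forall>t. \<bar>t - t0\<bar> < \<rho> \<longrightarrow> (\<lambda>n. a n * of_real ((t - t0) ^ n)) sums \<gamma> t" if t0: "t0 \<in> {0<..<1}" for t0
    proof -
      obtain \<rho> where \<rho>: "0 < \<rho>" "ball (ln t0) \<rho> \<subseteq> ball x0 r" using ln_ball[OF t0] open_ball[of x0 r] unfolding open_contains_ball by blast
      have hf: "f holomorphic_on ball (ln t0) \<rho>" using f(1) \<rho> rV by (meson holomorphic_on_subset order_trans)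
      have ser: "(\<lambda>n. (deriv ^^ n) f (ln t0) / fact n * (2 * v) ^ n * of_real ((t - t0) ^ n)) sums \<gamma> t" if t: "\<bar>t - t0\<bar> < \<rho> / (2 * r)" for t
      proof -
        have e: "ln t - ln t0 = 2 * v * of_real (t - t0)" by (simp add: ln_def algebra_simps)
        have "cmod (ln t - ln t0) = 2 * r * \<bar>t - t0\<bar>" unfolding e by (simp only: norm_mult norm_of_real v) simp
        also have "\<dots> < \<rho>" using t r by (simp add: field_simps)
        finally have "ln t \<in> ball (ln t0) \<rho>" by (simp add: dist_norm norm_minus_commute)
        from holomorphic_power_series[OF hf this] show ?thesis
          unfolding e by (simp add: \<gamma>_def power_mult_distrib mult.assoc)
      qed
      show ?thesis
        by (rule exI[of _ "\<rho> / (2 * r)"], rule conjI, use \<rho> r in simp,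
            rule exI[of _ "\<lambda>n. (deriv ^^ n) f (ln t0) / fact n * (2 * v) ^ n"], intro allI impI ser)
    qed
    have powser': "\<exists>\<rho>>0. \<exists>a. \<forall>t. \<bar>t - t0\<bar> < \<rho> \<longrightarrow> (\<lambda>n. a n * (t - t0) ^ n) sums P (\<gamma> t)"
      if P: "P = Re \<or> P = Im" and t0: "t0 \<in> {0<..<1}" for P t0
    proof -
      obtain \<rho> a where \<rho>: "0 < \<rho>" "\<And>t. \<bar>t - t0\<bar> < \<rho> \<Longrightarrow> (\<lambda>n. a n * of_real ((t - t0) ^ n)) sums \<gamma> t" using powser[OF t0] by blast
      have ser: "(\<lambda>n. P (a n) * (t - t0) ^ n) sums P (\<gamma> t)" if "\<bar>t - t0\<bar> < \<rho>" for t
      proof -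
        have "bounded_linear P" using P bounded_linear_Re bounded_linear_Im by blast
        from bounded_linear.sums[OF this \<rho>(2)[OF that]]
        have "(\<lambda>n. P (a n * of_real ((t - t0) ^ n))) sums P (\<gamma> t)" .
        moreover have "P (a n * of_real ((t - t0) ^ n)) = P (a n) * (t - t0) ^ n" for n
          using P by (auto simp del: of_real_power)
        ultimately show ?thesis by simp
      qed
      show ?thesis
        by (rule exI[of _ \<rho>], rule conjI[OF \<rho>(1)], rule exI[of _ "\<lambda>n. P (a n)"], intro allI impI ser)
    qed
    show "\<exists>W \<gamma>. open W \<and> z0 \<in> W \<and> (\<lambda>t. Re (\<gamma> t)) real_analytic_on {0<..<1} \<and> (\<lambda>t. Im (\<gamma> t)) real_analytic_on {0<..<1} \<and>
          (\<exists>g. homeomorphism {0<..<1} (f ` (W0 \<inter> ?l) \<inter> W) \<gamma> g) \<and> (\<forall>t\<in>{0<..<1}. vector_derivative \<gamma> (at t) \<noteq> 0)"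
    proof (intro exI[of _ W] exI[of _ \<gamma>] exI[of _ inv] conjI ballI)
      show "open W" by (rule W)
      show "z0 \<in> W" using x0 r by (auto simp: W_def)
      show "(\<lambda>t. Re (\<gamma> t)) real_analytic_on {0<..<1}"
        unfolding real_analytic_on_def by (rule ballI, rule powser'[of Re]) simp_all
      show "(\<lambda>t. Im (\<gamma> t)) real_analytic_on {0<..<1}"
        unfolding real_analytic_on_def by (rule ballI, rule powser'[of Im]) simp_all
      show "homeomorphism {0<..<1} (f ` (W0 \<inter> ?l) \<inter> W) \<gamma> inv"
        unfolding \<Gamma>W
      proof (rule homeomorphismI)
        show "continuous_on {0<..<1} \<gamma>"
          using deriv_\<gamma> by (meson continuous_at_imp_continuous_on has_vector_derivative_continuous)
        have "\<gamma> ` {0<..<1} \<subseteq> f ` V"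
          unfolding \<gamma>_def by (intro image_subsetI imageI subsetD[OF rV] ln_ball)
        then have "continuous_on (\<gamma> ` {0<..<1}) g"
          using g(1) by (meson continuous_on_subset holomorphic_on_imp_continuous_on)
        then show "continuous_on (\<gamma> ` {0<..<1}) inv"
          unfolding inv_def[abs_def] using v0 by (intro continuous_intros) auto
      qed (use inv in auto)
      show "vector_derivative \<gamma> (at t) \<noteq> 0" if "t \<in> {0<..<1}" for t
      proof -
        have "deriv f (ln t) \<noteq> 0"
          by (rule holomorphic_injective_imp_regular[OF f(1) V f(2) subsetD[OF rV ln_ball[OF that]]])
        then show ?thesis using vector_derivative_at[OF deriv_\<gamma>[OF that]] v0 by simp
      qed
    qed
  qed
qed


section \<open>Holomorphic conjugacy to a self-similar system\<close>

text \<open>The distance to an invariant set is contracted by each of the maps, hence it vanishes on \<open>K'\<close>.\<close>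

lemma contraction_invariant_subset:
  fixes K K' U :: "complex set"
  assumes contr: "\<And>i x y. i \<in> I \<Longrightarrow> x \<in> U \<Longrightarrow> y \<in> U \<Longrightarrow> dist (\<phi> i x) (\<phi> i y) \<le> \<rho> * dist x y"
    and \<rho>: "0 \<le> \<rho>" "\<rho> < 1"
    and K: "closed K" "K \<noteq> {}" "K \<subseteq> U" "\<And>i x. i \<in> I \<Longrightarrow> x \<in> K \<Longrightarrow> \<phi> i x \<in> K"
    and K': "compact K'" "K' \<subseteq> U" "K' \<subseteq> (\<Union>i\<in>I. \<phi> i ` K')"
  shows "K' \<subseteq> K"
proof (cases "K' = {}")
  case False
  have le: "infdist (\<phi> i x) K \<le> \<rho> * infdist x K" if "i \<in> I" "x \<in> U" for i x
  proof -
    obtain y where y: "y \<in> K" "infdist x K = dist x y"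
      using infdist_attains_inf[OF K(1) K(2)] by blast
    have "infdist (\<phi> i x) K \<le> dist (\<phi> i x) (\<phi> i y)" by (rule infdist_le) (rule K(4)[OF that(1) y(1)])
    also have "\<dots> \<le> \<rho> * dist x y" using contr that y K(3) by blast
    finally show ?thesis by (simp add: y)
  qed
  have "continuous_on K' (\<lambda>x. infdist x K)" by (intro continuous_intros)
  then obtain x0 where x0: "x0 \<in> K'" "\<And>x. x \<in> K' \<Longrightarrow> infdist x K \<le> infdist x0 K"
    using continuous_attains_sup[OF K'(1) False] by blast
  obtain i y where y: "i \<in> I" "y \<in> K'" "x0 = \<phi> i y" using K'(3) x0(1) by blast
  have "infdist x0 K \<le> \<rho> * infdist y K" using le[OF y(1), of y] y K'(2) by auto
  also have "\<dots> \<le> \<rho> * infdist x0 K" using x0(2)[OF y(2)] \<rho> by (intro mult_left_mono) auto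
  finally have "(1 - \<rho>) * infdist x0 K \<le> 0" by (simp add: algebra_simps)
  then have "infdist x0 K \<le> 0" using \<rho> by (simp add: mult_le_0_iff)
  then have "infdist x K = 0" if "x \<in> K'" for x using x0(2)[OF that] infdist_nonneg[of x K] by linarith
  then show ?thesis using in_closed_iff_infdist_zero[OF K(1) K(2)] by blast
qed simp

text \<open>At a point of complex differentiability the real derivative \<open>r *\<^sub>R T\<close>
  is multiplication by a complex number, which excludes reflections; evaluating at 1 shows that its
  modulus is r.\<close>

lemma contracting_similarity_complex_linear:
  assumes "contracting_similarity \<psi>" and diff: "\<psi> field_differentiable at x0"
  obtains a t where "a \<noteq> 0" "cmod a < 1" "\<And>x. \<psi> x = a * x + t"
proof -
  obtain r T t where r: "0 < r" "r < 1" and T: "orthogonal_transformation T" and \<psi>: "\<And>x. \<psi> x = r *\<^sub>R T x + t"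
    using assms(1) unfolding contracting_similarity_def by blast
  have lin: "linear T" using T by (simp add: orthogonal_transformation_def)
  then have "bounded_linear T" by (rule linear_conv_bounded_linear[THEN iffD1])
  then have 1: "(\<psi> has_derivative (\<lambda>h. r *\<^sub>R T h)) (at x0)"
    unfolding \<psi>[abs_def] by (auto intro!: derivative_eq_intros bounded_linear_imp_has_derivative)
  obtain d where "(\<psi> has_field_derivative d) (at x0)" using diff unfolding field_differentiable_def by blast
  then have "(\<psi> has_derivative (\<lambda>h. d * h)) (at x0)" by (simp add: has_field_derivative_def)
  with 1 have "(\<lambda>h. r *\<^sub>R T h) = (\<lambda>h. d * h)" by (rule has_derivative_unique)
  then have eq: "r *\<^sub>R T h = d * h" for h by metis
  have "cmod (T 1) = 1" using T by (simp add: orthogonal_transformation)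
  then have "cmod d = r" using eq[of 1] r by (metis abs_of_pos mult_1_right norm_scaleR)
  then show ?thesis using that[of d t] r \<psi> eq by (metis less_irrefl norm_zero)
qed

section \<open>Systems conjugate to complex linear maps\<close>

locale linear_conjugacy =
  fixes U V :: "complex set" and I :: "nat set" and \<phi> :: "nat \<Rightarrow> complex \<Rightarrow> complex" and \<rho> :: real
    and a t :: "nat \<Rightarrow> complex" and f g :: "complex \<Rightarrow> complex" and L :: "complex set"
  assumes U: "open U" "convex U"
    and finite_I: "finite I" "I \<noteq> {}"
    and \<phi>: "\<And>i. i \<in> I \<Longrightarrow> \<phi> i holomorphic_on U" "\<And>i. i \<in> I \<Longrightarrow> inj_on (\<phi> i) U" "\<And>i x. i \<in> I \<Longrightarrow> x \<in> U \<Longrightarrow> \<phi> i x \<in> U"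
    and a: "\<And>i. i \<in> I \<Longrightarrow> a i \<noteq> 0" "\<And>i. i \<in> I \<Longrightarrow> cmod (a i) \<le> \<rho>" and \<rho>: "0 \<le> \<rho>" "\<rho> < 1"
    and V: "open V" "L \<subseteq> V" and f: "f holomorphic_on V" "inj_on f V" "f ` V \<subseteq> U"
    and g: "g holomorphic_on f ` V" "\<And>x. x \<in> V \<Longrightarrow> g (f x) = x"
    and L: "compact L" "L \<noteq> {}" "L = (\<Union>i\<in>I. (\<lambda>x. a i * x + t i) ` L)"
    and conj: "\<And>i x. i \<in> I \<Longrightarrow> x \<in> V \<Longrightarrow> a i * x + t i \<in> V \<Longrightarrow> \<phi> i (f x) = f (a i * x + t i)"
begin

lemma L_invariant: "i \<in> I \<Longrightarrow> x \<in> L \<Longrightarrow> a i * x + t i \<in> L"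
  using L(3) by blast

text \<open>Contractions preserving \<open>L\<close> map each metric neighbourhood of
  \<open>L\<close> into itself. Inside \<open>V\<close> the conjugacy can therefore be iterated
  without leaving its domain.\<close>

definition nbhd :: "real \<Rightarrow> complex set" where
  "nbhd \<delta> = (\<Union>x\<in>L. ball x \<delta>)"

lemma nbhd_invariant: "i \<in> I \<Longrightarrow> x \<in> nbhd \<delta> \<Longrightarrow> a i * x + t i \<in> nbhd \<delta>"
proof -
  assume i: "i \<in> I" and "x \<in> nbhd \<delta>"
  then obtain y where y: "y \<in> L" "dist y x < \<delta>" by (auto simp: nbhd_def)
  have "dist (a i * y + t i) (a i * x + t i) = cmod (a i) * dist y x"
    by (simp add: dist_norm norm_mult[symmetric] right_diff_distrib)
  also have "\<dots> \<le> 1 * dist y x" using a(2)[OF i] \<rho> by (intro mult_right_mono) auto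
  also have "\<dots> < \<delta>" using y by simp
  finally have d: "dist (a i * y + t i) (a i * x + t i) < \<delta>" .
  show ?thesis unfolding nbhd_def by (rule UN_I[OF L_invariant[OF i y(1)]]) (use d in simp)
qed

lemma nbhd_subset: obtains \<delta> where "0 < \<delta>" "nbhd \<delta> \<subseteq> V"
  using compact_subset_open_imp_ball_epsilon_subset[OF L(1) V(1) V(2)] unfolding nbhd_def by metis

lemma open_nbhd: "open (nbhd \<delta>)"
  by (auto simp: nbhd_def)

lemma L_subset_nbhd: "0 < \<delta> \<Longrightarrow> L \<subseteq> nbhd \<delta>"
  unfolding nbhd_def by force

text \<open>Follows an address of \<open>x0\<close> for n letters: \<open>A * x + T\<close> is the
  composed similarity and \<Theta> the matching composition of the \<phi>. The purpose is to carry a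
  whole neighbourhood of \<open>L\<close> close to \<open>x0\<close> by a map that is defined on all
  of \<open>U\<close>.\<close>

lemma word_map:
  assumes \<delta>: "nbhd \<delta> \<subseteq> V" "0 < \<delta>" and x0: "x0 \<in> L"
  shows "\<exists>\<Theta> A T l. A \<noteq> 0 \<and> cmod A \<le> \<rho> ^ n \<and> l \<in> L \<and> x0 = A * l + T \<and> \<Theta> holomorphic_on U \<and> inj_on \<Theta> U \<and>
     (\<forall>x\<in>U. \<Theta> x \<in> U) \<and> (\<forall>x\<in>nbhd \<delta>. A * x + T \<in> nbhd \<delta> \<and> \<Theta> (f x) = f (A * x + T))"
  using x0
proof (induction n arbitrary: x0)
  case 0
  show ?case
    by (rule exI[of _ id], rule exI[of _ 1], rule exI[of _ 0], rule exI[of _ x0]) (use 0 in auto)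
next
  case (Suc n)
  obtain i x1 where i: "i \<in> I" "x1 \<in> L" "x0 = a i * x1 + t i" using L(3) Suc.prems by blast
  obtain \<Theta> A T l where IH: "A \<noteq> 0" "cmod A \<le> \<rho> ^ n" "l \<in> L" "x1 = A * l + T" "\<Theta> holomorphic_on U" "inj_on \<Theta> U"
     "\<forall>x\<in>U. \<Theta> x \<in> U" "\<forall>x\<in>nbhd \<delta>. A * x + T \<in> nbhd \<delta> \<and> \<Theta> (f x) = f (A * x + T)"
    using Suc.IH[OF i(2)] by blast
  show ?case
  proof (intro exI conjI ballI)
    show "a i * A \<noteq> 0" using IH a i by simp
    show "cmod (a i * A) \<le> \<rho> ^ Suc n" using IH a(2)[OF i(1)] \<rho> by (auto simp: norm_mult intro!: mult_mono)
    show "l \<in> L" by (rule IH)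
    show "x0 = a i * A * l + (a i * T + t i)" using IH i by (simp add: algebra_simps)
    show "\<phi> i \<circ> \<Theta> holomorphic_on U"
      using IH(5,7) \<phi>(1)[OF i(1)] by (intro holomorphic_on_compose_gen[of _ _ _ U]) auto
    show "inj_on (\<phi> i \<circ> \<Theta>) U" using IH(6,7) \<phi>(2)[OF i(1)] by (intro comp_inj_on) (auto intro: inj_on_subset)
    show "(\<phi> i \<circ> \<Theta>) x \<in> U" if "x \<in> U" for x using that IH(7) \<phi>(3)[OF i(1)] by simp
    fix x assume x: "x \<in> nbhd \<delta>"
    have 1: "A * x + T \<in> nbhd \<delta>" "\<Theta> (f x) = f (A * x + T)" using IH(8) x by auto
    have 2: "a i * (A * x + T) + t i \<in> nbhd \<delta>" by (rule nbhd_invariant[OF i(1) 1(1)])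
    have e: "a i * A * x + (a i * T + t i) = a i * (A * x + T) + t i" by (simp add: algebra_simps)
    show "a i * A * x + (a i * T + t i) \<in> nbhd \<delta>" unfolding e by (rule 2)
    show "(\<phi> i \<circ> \<Theta>) (f x) = f (a i * A * x + (a i * T + t i))"
      unfolding e using conj[OF i(1)] 1 2 \<delta>(1) by auto
  qed
qed

text \<open>If \<open>f\<close> were affine near \<xi>, a long word would carry a whole
  neighbourhood of \<open>L\<close> into that disc, so \<open>\<Theta> (f x)\<close> would be affine
  on the neighbourhood. This makes \<Theta> affine on \<open>U\<close>, and cancelling it in
  \<open>\<Theta> (\<phi> i (f x))\<close> makes every \<open>\<phi> i\<close> affine, against
  nonlinearity.\<close>

lemma deriv_not_constant:
  assumes nl: "\<exists>i\<in>I. \<not> (\<exists>a b. \<forall>z\<in>U. \<phi> i z = a * z + b)"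
    and \<xi>: "\<xi> \<in> L" and \<epsilon>: "0 < \<epsilon>" "ball \<xi> \<epsilon> \<subseteq> V"
  shows "\<not> deriv f constant_on ball \<xi> \<epsilon>"
proof
  assume "deriv f constant_on ball \<xi> \<epsilon>"
  then obtain \<alpha> where \<alpha>: "\<And>x. x \<in> ball \<xi> \<epsilon> \<Longrightarrow> deriv f x = \<alpha>" unfolding constant_on_def by blast
  obtain \<delta> where \<delta>: "0 < \<delta>" "nbhd \<delta> \<subseteq> V" by (rule nbhd_subset)
  define \<epsilon>' where "\<epsilon>' = min \<epsilon> \<delta>"
  have \<epsilon>': "0 < \<epsilon>'" "\<epsilon>' \<le> \<epsilon>" using \<epsilon> \<delta> by (auto simp: \<epsilon>'_def)
  have bn: "ball \<xi> \<epsilon>' \<subseteq> nbhd \<delta>" unfolding nbhd_def \<epsilon>'_def using \<xi> by auto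
  have bsub: "ball \<xi> \<epsilon>' \<subseteq> ball \<xi> \<epsilon>" using \<epsilon>' by auto
  have fd: "(f has_field_derivative \<alpha>) (at x)" if "x \<in> ball \<xi> \<epsilon>'" for x
  proof -
    have "x \<in> ball \<xi> \<epsilon>" using that bsub by (rule subsetD[rotated])
    then show ?thesis using holomorphic_derivI[OF f(1) V(1), of x] \<alpha>[of x] \<epsilon>(2) by auto
  qed
  obtain \<beta> where faff: "\<And>x. x \<in> ball \<xi> \<epsilon>' \<Longrightarrow> f x = \<alpha> * x + \<beta>"
  proof -
    have "(\<lambda>x. f x - \<alpha> * x) constant_on ball \<xi> \<epsilon>'"
    proof (rule has_field_derivative_0_imp_constant_on)
      show "((\<lambda>x. f x - \<alpha> * x) has_field_derivative 0) (at x)" if "x \<in> ball \<xi> \<epsilon>'" for x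
        using fd[OF that] by (auto intro!: derivative_eq_intros)
    qed auto
    then obtain \<beta> where "\<And>x. x \<in> ball \<xi> \<epsilon>' \<Longrightarrow> f x - \<alpha> * x = \<beta>" unfolding constant_on_def by blast
    then show ?thesis using that by (metis add.commute diff_add_cancel)
  qed
  have \<alpha>0: "\<alpha> \<noteq> 0"
    using holomorphic_injective_imp_regular[OF f(1) V(1) f(2), of \<xi>] \<xi> V(2) \<alpha>[of \<xi>] \<epsilon>(1) by auto
  obtain M where M: "\<And>x. x \<in> L \<Longrightarrow> cmod x \<le> M" using compact_imp_bounded[OF L(1)] unfolding bounded_iff by blast
  \<comment> \<open>Bounds the distance between a point of \<open>L\<close> and a point of
    \<open>nbhd \<delta>\<close>.\<close>
  define D where "D = 2 * M + \<delta>"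
  obtain n where n: "\<rho> ^ n * D < \<epsilon>'"
  proof -
    have "(\<lambda>n. \<rho> ^ n * D) \<longlonglongrightarrow> 0 * D" using \<rho> by (intro tendsto_mult LIMSEQ_power_zero) auto
    then have "eventually (\<lambda>n. \<rho> ^ n * D < \<epsilon>') sequentially" using \<epsilon>' by (auto dest: order_tendstoD(2))
    then show ?thesis using that by (auto dest: eventually_happens)
  qed
  obtain \<Theta> A T l where W: "A \<noteq> 0" "cmod A \<le> \<rho> ^ n" "l \<in> L" "\<xi> = A * l + T" "\<Theta> holomorphic_on U" "inj_on \<Theta> U"
     "\<forall>x\<in>U. \<Theta> x \<in> U" "\<forall>x\<in>nbhd \<delta>. A * x + T \<in> nbhd \<delta> \<and> \<Theta> (f x) = f (A * x + T)"
    using word_map[OF \<delta>(2,1) \<xi>, of n] by blast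
  have into: "A * x + T \<in> ball \<xi> \<epsilon>'" if x: "x \<in> nbhd \<delta>" for x
  proof -
    obtain y where y: "y \<in> L" "dist y x < \<delta>" using x by (auto simp: nbhd_def)
    have "dist l x \<le> dist l y + dist y x" by (rule dist_triangle)
    also have "dist l y \<le> 2 * M" using norm_triangle_ineq4[of l y] M[OF W(3)] M[OF y(1)] by (simp add: dist_norm)
    finally have lx: "dist l x \<le> D" using y by (simp add: D_def)
    have "dist \<xi> (A * x + T) = cmod A * dist l x" by (simp add: W(4) dist_norm norm_mult[symmetric] right_diff_distrib)
    also have "\<dots> \<le> \<rho> ^ n * D" using W(2) lx \<rho> by (intro mult_mono) auto
    also have "\<dots> < \<epsilon>'" by (rule n)
    finally show ?thesis by simp
  qed
  define c where "c x = \<alpha> * (A * x + T) + \<beta>" for x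
  have \<Theta>f: "\<Theta> (f x) = c x" if "x \<in> nbhd \<delta>" for x using W(8) faff into that by (simp add: c_def)
  have \<xi>n: "\<xi> \<in> nbhd \<delta>" using L_subset_nbhd[OF \<delta>(1)] \<xi> by blast
  have nU: "f x \<in> U" if "x \<in> nbhd \<delta>" for x using that \<delta>(2) f(3) by blast
  have con: "connected U" using U(2) by (rule convex_connected)
  text \<open>The ball around \<open>\<xi>\<close> is where \<open>f\<close> itself is affine, hence so is \<open>\<Theta>\<close>.\<close>
  have ident: "h z = k z" if "h holomorphic_on U" "k holomorphic_on U" "\<And>x. x \<in> ball \<xi> \<epsilon>' \<Longrightarrow> h (f x) = k (f x)" "z \<in> U" for h k z
  proof (rule analytic_continuation_open[where f = h and g = k and s = "f ` ball \<xi> \<epsilon>'" and s' = U])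
    show "open (f ` ball \<xi> \<epsilon>')"
      using holomorphic_on_subset[OF f(1) order_trans[OF bn \<delta>(2)]] inj_on_subset[OF f(2) order_trans[OF bn \<delta>(2)]]
      by (intro open_mapping_thm3) auto
    show "f ` ball \<xi> \<epsilon>' \<noteq> {}" using \<epsilon>' by auto
    show "f ` ball \<xi> \<epsilon>' \<subseteq> U" using bn nU by blast
  qed (use U con that in auto)
  have \<Theta>aff: "\<Theta> z = A * z + (\<alpha> * T + \<beta> - A * \<beta>)" if "z \<in> U" for z
  proof (rule ident[OF W(5) _ _ that])
    show "(\<lambda>z. A * z + (\<alpha> * T + \<beta> - A * \<beta>)) holomorphic_on U" by (intro holomorphic_intros)
    show "\<Theta> (f x) = A * f x + (\<alpha> * T + \<beta> - A * \<beta>)" if "x \<in> ball \<xi> \<epsilon>'" for x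
      using \<Theta>f[of x] faff[OF that] that bn by (auto simp: c_def algebra_simps)
  qed
  have "\<exists>b c. \<forall>z\<in>U. \<phi> i z = b * z + c" if i: "i \<in> I" for i
  proof -
    have "\<phi> i z = a i * z + (\<alpha> * t i + \<beta> - a i * \<beta>)" if "z \<in> U" for z
    proof (rule ident[OF \<phi>(1)[OF i] _ _ that])
      show "(\<lambda>z. a i * z + (\<alpha> * t i + \<beta> - a i * \<beta>)) holomorphic_on U" by (intro holomorphic_intros)
      fix x assume x: "x \<in> ball \<xi> \<epsilon>'"
      then have xn: "x \<in> nbhd \<delta>" using bn by blast
      have yn: "a i * x + t i \<in> nbhd \<delta>" by (rule nbhd_invariant[OF i xn])
      have "\<Theta> (\<phi> i (f x)) = c (a i * x + t i)"
        using conj[OF i, of x] subsetD[OF \<delta>(2) xn] subsetD[OF \<delta>(2) yn] \<Theta>f[OF yn] by simp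
      moreover have "\<Theta> (\<phi> i (f x)) = A * \<phi> i (f x) + (\<alpha> * T + \<beta> - A * \<beta>)"
        by (rule \<Theta>aff) (rule \<phi>(3)[OF i nU[OF xn]])
      ultimately have "A * \<phi> i (f x) = A * (\<alpha> * (a i * x + t i) + \<beta>)" by (simp add: c_def algebra_simps)
      then have "\<phi> i (f x) = \<alpha> * (a i * x + t i) + \<beta>" using W(1) by simp
      then show "\<phi> i (f x) = a i * f x + (\<alpha> * t i + \<beta> - a i * \<beta>)"
        using faff[OF x] by (simp add: algebra_simps)
    qed
    then show ?thesis by blast
  qed
  then show False using nl by blast
qed

definition fixpt :: "nat \<Rightarrow> complex" where
  "fixpt i = t i / (1 - a i)"

lemma fixpt: "i \<in> I \<Longrightarrow> a i * fixpt i + t i = fixpt i"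
proof -
  assume i: "i \<in> I"
  then have "a i \<noteq> 1" using a(2)[OF i] \<rho> by auto
  then show ?thesis by (simp add: fixpt_def field_simps)
qed

lemma L_subset_closed_invariant:
  assumes S: "closed S" "S \<noteq> {}" "\<And>i x. i \<in> I \<Longrightarrow> x \<in> S \<Longrightarrow> a i * x + t i \<in> S"
  shows "L \<subseteq> S"
proof (rule contraction_invariant_subset[where \<phi> = "\<lambda>i x. a i * x + t i" and U = UNIV, OF _ \<rho> S(1,2) _ S(3) L(1)])
  show "dist (a i * x + t i) (a i * y + t i) \<le> \<rho> * dist x y" if "i \<in> I" for i x y
  proof -
    have "dist (a i * x + t i) (a i * y + t i) = cmod (a i) * dist x y"
      by (simp add: dist_norm norm_mult[symmetric] right_diff_distrib)
    then show ?thesis using a(2)[OF that] by (simp add: mult_right_mono)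
  qed
qed (use L(3) in auto)

text \<open>A common fixed point of the similarities would be the whole of \<open>L\<close>, and
  \<open>f\<close> would map it to a common fixed point of the \<phi>.\<close>

lemma distinct_fixpts:
  assumes "\<not> (\<exists>z\<in>U. \<forall>i\<in>I. \<phi> i z = z)"
  shows "\<exists>i\<in>I. \<exists>j\<in>I. fixpt i \<noteq> fixpt j"
proof (rule ccontr)
  assume *: "\<not> ?thesis"
  obtain i0 where i0: "i0 \<in> I" using finite_I by blast
  have eq: "fixpt i = fixpt i0" if "i \<in> I" for i using * that i0 by blast
  have "L \<subseteq> {fixpt i0}"
    by (rule L_subset_closed_invariant) (use fixpt eq in force)+
  then have L1: "L = {fixpt i0}" using L(2) by blast
  have V1: "fixpt i0 \<in> V" using L1 V by blast
  have "\<phi> i (f (fixpt i0)) = f (fixpt i0)" if "i \<in> I" for i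
    using conj[OF that V1] fixpt[OF that] eq[OF that] V1 by simp
  moreover have "f (fixpt i0) \<in> U" using V1 f(3) by blast
  ultimately show False using assms by blast
qed

text \<open>If all \<open>a i\<close> are real and the fixed points lie on a line, every similarity
  preserves that line, which then contains \<open>L\<close>. The image under \<open>f\<close> of its
  part near \<open>L\<close> is a forbidden invariant analytic curve.\<close>

lemma fixpts_not_on_line:
  assumes irr: "\<not> (\<exists>\<Gamma>. analytic_curve \<Gamma> \<and> \<Gamma> \<subseteq> U \<and> (\<forall>i\<in>I. \<phi> i ` \<Gamma> \<subseteq> \<Gamma>))"
    and distinct: "\<exists>i\<in>I. \<exists>j\<in>I. fixpt i \<noteq> fixpt j"
  shows "(\<exists>i\<in>I. Im (a i) \<noteq> 0) \<or> \<not> (\<exists>c u. \<forall>i\<in>I. \<exists>x::real. fixpt i = c + of_real x * u)"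
proof (rule ccontr)
  assume *: "\<not> ?thesis"
  then have real: "Im (a i) = 0" if "i \<in> I" for i using that by blast
  obtain c u where cu: "\<And>i. i \<in> I \<Longrightarrow> \<exists>x::real. fixpt i = c + of_real x * u" using * by blast
  have u: "u \<noteq> 0"
  proof
    assume "u = 0"
    then have "fixpt i = c" if "i \<in> I" for i using cu[OF that] by auto
    then show False using distinct by auto
  qed
  let ?l = "range (\<lambda>x::real. c + of_real x * u)"
  have inv: "a i * x + t i \<in> ?l" if i: "i \<in> I" and x: "x \<in> ?l" for i x
  proof -
    obtain s where s: "x = c + of_real s * u" using x by blast
    obtain s' where s': "fixpt i = c + of_real s' * u" using cu[OF i] by blast
    have ar: "a i = of_real (Re (a i))" using real[OF i] by (simp add: complex_eq_iff)
    have "a i * x + t i = a i * (x - fixpt i) + fixpt i" using fixpt[OF i] by (simp add: algebra_simps)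
    also have "\<dots> = c + of_real (Re (a i) * (s - s') + s') * u"
      unfolding s s' by (subst ar) (simp add: algebra_simps)
    finally show ?thesis by blast
  qed
  have "closed ?l"
  proof -
    have "?l = (\<lambda>y. c + y) ` span {u}" by (auto simp: span_singleton scaleR_conv_of_real)
    then show ?thesis by (simp add: closed_translation closed_span)
  qed
  \<comment> \<open>That \<open>L\<close> lies on the line ensures that the curve below is
    non-empty.\<close>
  then have Ll: "L \<subseteq> ?l" by (rule L_subset_closed_invariant) (use inv in auto)
  obtain \<delta> where \<delta>: "0 < \<delta>" "nbhd \<delta> \<subseteq> V" by (rule nbhd_subset)
  let ?\<Gamma> = "f ` (nbhd \<delta> \<inter> ?l)"
  have \<Gamma>1: "analytic_curve ?\<Gamma>"
  proof (rule analytic_curve_image_line[OF V(1) f(1,2) g open_nbhd \<delta>(2) u])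
    show "nbhd \<delta> \<inter> ?l \<noteq> {}" using L(2) Ll L_subset_nbhd[OF \<delta>(1)] by blast
  qed
  have \<Gamma>2: "?\<Gamma> \<subseteq> U" using \<delta>(2) f(3) by blast
  have \<Gamma>3: "\<phi> i ` ?\<Gamma> \<subseteq> ?\<Gamma>" if i: "i \<in> I" for i
  proof
    fix z assume "z \<in> \<phi> i ` ?\<Gamma>"
    then obtain w where w: "z = \<phi> i w" "w \<in> ?\<Gamma>" by (rule imageE)
    obtain x' where x': "w = f x'" "x' \<in> nbhd \<delta> \<inter> ?l" using w(2) by (rule imageE)
    define x where "x = x'"
    have x: "x \<in> nbhd \<delta>" "x \<in> ?l" "z = \<phi> i (f x)" using w x' by (simp_all only: x_def Int_iff)
    have n: "a i * x + t i \<in> nbhd \<delta>" by (rule nbhd_invariant[OF i x(1)])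
    have "z = f (a i * x + t i)" unfolding x(3) by (rule conj[OF i]) (use x n \<delta> in auto)
    then show "z \<in> ?\<Gamma>" using n inv[OF i x(2)] by blast
  qed
  show False
    by (rule notE[OF irr], rule exI[of _ ?\<Gamma>], intro conjI ballI \<Gamma>1 \<Gamma>2 \<Gamma>3)
qed

end

section \<open>Transfer of the self-conformal measure to the linear model\<close>

lemma contracting_similarity_continuous:
  assumes "contracting_similarity \<psi>"
  shows "continuous_on UNIV \<psi>"
proof -
  obtain r T t where T: "orthogonal_transformation T" and \<psi>: "\<And>x. \<psi> x = r *\<^sub>R T x + t"
    using assms unfolding contracting_similarity_def by blast
  have "bounded_linear T"
    using T by (intro linear_conv_bounded_linear[THEN iffD1]) (simp add: orthogonal_transformation_def)
  then have "continuous_on UNIV T" by (rule linear_continuous_on)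
  then show ?thesis unfolding \<psi>[abs_def] by (intro continuous_intros)
qed

text \<open>The function is only controlled on \<open>U\<close>, so measurability is obtained from
  its extension by zero.\<close>

lemma holomorphic_vimage_borel:
  assumes "open U" "f holomorphic_on U" "B \<in> sets borel"
  shows "f -` B \<inter> U \<in> sets borel"
proof -
  have U: "U \<in> sets borel" using assms(1) by simp
  have "(\<lambda>x. indicator U x *\<^sub>R f x) \<in> borel_measurable borel"
    using U assms(2) by (intro borel_measurable_continuous_on_indicator holomorphic_on_imp_continuous_on)
  from measurable_sets[OF this assms(3)]
  have "(\<lambda>x. indicator U x *\<^sub>R f x) -` B \<inter> U \<in> sets borel" using U by simp
  moreover have "(\<lambda>x. indicator U x *\<^sub>R f x) -` B \<inter> U = f -` B \<inter> U" by (auto simp: indicator_def)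
  ultimately show ?thesis by simp
qed

text \<open>Testing invariance on the whole plane shows that all mass lies in \<open>U\<close>. Each
  further application shrinks the distance to \<open>K\<close> by the factor \<rho>, so full mass
  lies within \<open>\<rho> ^ n * D\<close> of \<open>K\<close> for every n.\<close>

lemma self_conformal_measure_AE_in_set:
  assumes U: "open U" "bounded U" "U \<noteq> {}"
    and \<phi>: "\<And>i. i \<in> {1..N} \<Longrightarrow> \<phi> i holomorphic_on U" "\<And>i x. i \<in> {1..N} \<Longrightarrow> x \<in> U \<Longrightarrow> \<phi> i x \<in> U"
    and contr: "\<And>i x y. i \<in> {1..N} \<Longrightarrow> x \<in> U \<Longrightarrow> y \<in> U \<Longrightarrow> dist (\<phi> i x) (\<phi> i y) \<le> \<rho> * dist x y"
    and \<rho>: "0 \<le> \<rho>" "\<rho> < 1"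
    and K: "compact K" "K \<noteq> {}" "K \<subseteq> U" "\<And>i x. i \<in> {1..N} \<Longrightarrow> x \<in> K \<Longrightarrow> \<phi> i x \<in> K"
    and p: "probability_vector N p" and \<nu>: "self_conformal_measure U N \<phi> p \<nu>"
  shows "AE x in \<nu>. x \<in> K"
proof -
  have prob: "prob_space \<nu>" and sets: "sets \<nu> = sets borel"
    and inv: "\<And>B. B \<in> sets borel \<Longrightarrow> measure \<nu> B = (\<Sum>i=1..N. p i * measure \<nu> (\<phi> i -` B \<inter> U))"
    using \<nu> unfolding self_conformal_measure_def by auto
  interpret prob_space \<nu> by (rule prob)
  have sp: "space \<nu> = UNIV" using sets_eq_imp_space_eq[OF sets] by simp
  have p0: "0 \<le> p i" if "i \<in> {1..N}" for i using p that by (auto simp: probability_vector_def less_imp_le)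
  have p1: "(\<Sum>i=1..N. p i) = 1" using p by (simp add: probability_vector_def)
  have Ub: "U \<in> sets borel" using U(1) by simp
  obtain D0 where D0: "\<And>x. x \<in> U \<Longrightarrow> cmod x \<le> D0" using U(2) unfolding bounded_iff by blast
  define D where "D = 2 * D0"
  have D: "infdist x K \<le> D" if "x \<in> U" for x
  proof -
    obtain y where y: "y \<in> K" using K(2) by blast
    have "infdist x K \<le> dist x y" by (rule infdist_le[OF y])
    also have "\<dots> \<le> cmod x + cmod y" unfolding dist_norm by (rule norm_triangle_ineq4)
    also have "\<dots> \<le> D" using D0[OF that] D0[OF subsetD[OF K(3) y]] by (simp add: D_def)
    finally show ?thesis .
  qed
  define B where "B n = {x \<in> U. infdist x K \<le> \<rho> ^ n * D}" for n :: nat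
  have Bs: "B n \<in> sets borel" for n
  proof -
    have "closed {x. infdist x K \<le> \<rho> ^ n * D}" by (intro closed_Collect_le continuous_intros)
    then have "{x. infdist x K \<le> \<rho> ^ n * D} \<in> sets borel" by (rule borel_closed)
    then have "U \<inter> {x. infdist x K \<le> \<rho> ^ n * D} \<in> sets borel" using Ub by (intro sets.Int)
    moreover have "B n = U \<inter> {x. infdist x K \<le> \<rho> ^ n * D}" by (auto simp: B_def)
    ultimately show ?thesis by simp
  qed
  have B1: "measure \<nu> (B n) = 1" for n
  proof (induction n)
    case 0
    have B0: "B 0 = U" using D by (auto simp: B_def)
    have "1 = measure \<nu> UNIV" using prob_space sp by simp
    also have "\<dots> = (\<Sum>i=1..N. p i * measure \<nu> (\<phi> i -` UNIV \<inter> U))" by (rule inv) simp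
    also have "\<dots> = measure \<nu> U" using p1 by (simp add: sum_distrib_right[symmetric])
    finally show ?case by (simp add: B0)
  next
    case (Suc n)
    have "1 = (\<Sum>i=1..N. p i * measure \<nu> (B n))" using Suc p1 by simp
    also have "\<dots> \<le> (\<Sum>i=1..N. p i * measure \<nu> (\<phi> i -` B (Suc n) \<inter> U))"
    proof (intro sum_mono mult_left_mono p0 finite_measure_mono)
      fix i assume i: "i \<in> {1..N}"
      show "\<phi> i -` B (Suc n) \<inter> U \<in> sets \<nu>" using holomorphic_vimage_borel[OF U(1) \<phi>(1)[OF i] Bs] by (simp add: sets)
      show "B n \<subseteq> \<phi> i -` B (Suc n) \<inter> U"
      proof
        fix x assume "x \<in> B n"
        then have x: "x \<in> U" "infdist x K \<le> \<rho> ^ n * D" by (auto simp: B_def)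
        have "\<exists>y\<in>K. infdist x K = dist x y" by (rule infdist_attains_inf[OF compact_imp_closed[OF K(1)] K(2)]) blast
        then obtain y where y: "y \<in> K" "infdist x K = dist x y" by (elim bexE) (rule that)
        have "infdist (\<phi> i x) K \<le> dist (\<phi> i x) (\<phi> i y)" by (rule infdist_le) (rule K(4)[OF i y(1)])
        also have "\<dots> \<le> \<rho> * dist x y" by (rule contr[OF i x(1) subsetD[OF K(3) y(1)]])
        also have "\<dots> \<le> \<rho> * (\<rho> ^ n * D)" using x(2) y \<rho> by (intro mult_left_mono) auto
        finally show "x \<in> \<phi> i -` B (Suc n) \<inter> U" using x(1) \<phi>(2)[OF i x(1)] by (simp add: B_def mult.assoc)
      qed
    qed
    also have "\<dots> = measure \<nu> (B (Suc n))" by (rule inv[OF Bs, symmetric])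
    finally show ?case using prob_le_1 by (intro antisym) auto
  qed
  have "AE x in \<nu>. x \<in> B n" for n
    using B1[of n] Bs[of n] by (subst prob_eq_1[symmetric]) (auto simp: sets)
  then have "AE x in \<nu>. \<forall>n. x \<in> B n" by (simp add: AE_all_countable)
  moreover have "x \<in> K" if "\<forall>n. x \<in> B n" for x
  proof -
    have lim: "(\<lambda>n. \<rho> ^ n * D) \<longlonglongrightarrow> 0 * D" using \<rho> by (intro tendsto_mult LIMSEQ_power_zero tendsto_const) auto
    have "infdist x K \<le> 0 * D"
      by (rule LIMSEQ_le_const[OF lim]) (use that in \<open>auto simp: B_def\<close>)
    then have "infdist x K = 0" using infdist_nonneg[of x K] by simp
    then show ?thesis using in_closed_iff_infdist_zero[OF compact_imp_closed[OF K(1)] K(2)] by blast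
  qed
  ultimately show ?thesis by auto
qed

theorem theorem7p8:
  fixes U \<Omega> :: "complex set" and N :: nat and \<phi> :: "nat \<Rightarrow> complex \<Rightarrow> complex"
    and p :: "nat \<Rightarrow> real" and \<nu> :: "complex measure"
  assumes "conformal_IFS U \<Omega> N \<phi>"
    and "probability_vector N p"
    and "self_conformal_measure U N \<phi> p \<nu>"
    and "\<not> curve_reducible U N \<phi>"
    and "nonlinear_IFS U N \<phi>"
    and "conjugate_to_linear U \<Omega> N \<phi>"
  shows "polynomial_Fourier_decay \<nu>"
proof -
  let ?I = "{1..N}"
  have U: "open U" "convex U" "bounded U" and \<Omega>: "\<Omega> \<noteq> {}" "closure \<Omega> \<subseteq> U"
    and \<phi>: "\<And>i. i \<in> ?I \<Longrightarrow> inj_on (\<phi> i) U" "\<And>i. i \<in> ?I \<Longrightarrow> \<phi> i holomorphic_on U" "\<And>i. i \<in> ?I \<Longrightarrow> closure (\<phi> i ` U) \<subseteq> U"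
    and Sup: "bdd_above {cmod (deriv (\<phi> i) z) | z i. z \<in> U \<and> i \<in> ?I}" "Sup {cmod (deriv (\<phi> i) z) | z i. z \<in> U \<and> i \<in> ?I} < 1"
    and nofix: "\<not> (\<exists>z\<in>U. \<forall>i\<in>?I. \<phi> i z = z)"
    using assms(1) unfolding conformal_IFS_def by simp_all
  have U0: "U \<noteq> {}" using \<Omega> closure_subset by blast
  have \<phi>U: "\<phi> i x \<in> U" if "i \<in> ?I" "x \<in> U" for i x
    using \<phi>(3)[OF that(1)] closure_subset[of "\<phi> i ` U"] that(2) by blast
  define \<rho>1 where "\<rho>1 = max 0 (Sup {cmod (deriv (\<phi> i) z) | z i. z \<in> U \<and> i \<in> ?I})"
  have \<rho>1: "0 \<le> \<rho>1" "\<rho>1 < 1" using Sup(2) by (auto simp: \<rho>1_def)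
  have d_le: "cmod (deriv (\<phi> i) z) \<le> \<rho>1" if "i \<in> ?I" "z \<in> U" for i z
  proof -
    have "cmod (deriv (\<phi> i) z) \<le> Sup {cmod (deriv (\<phi> i) z) | z i. z \<in> U \<and> i \<in> ?I}"
      by (rule cSup_upper[OF _ Sup(1)]) (use that in blast)
    then show ?thesis by (simp add: \<rho>1_def)
  qed
  have contr: "dist (\<phi> i x) (\<phi> i y) \<le> \<rho>1 * dist x y" if "i \<in> ?I" "x \<in> U" "y \<in> U" for i x y
    unfolding dist_norm
  proof (rule field_differentiable_bound[OF U(2) _ d_le[OF that(1)] that(2,3)])
    show "(\<phi> i has_field_derivative deriv (\<phi> i) z) (at z within U)" if "z \<in> U" for z
      by (rule holomorphic_derivI[OF \<phi>(2)[OF \<open>i \<in> ?I\<close>] U(1) that])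
  qed
  have p1: "(\<Sum>i=1..N. p i) = 1" and ppos: "\<And>i. i \<in> ?I \<Longrightarrow> 0 < p i"
    using assms(2) by (auto simp: probability_vector_def)
  have I0: "?I \<noteq> {}" using p1 by fastforce
  obtain \<psi> L K V V' f where \<psi>: "\<forall>i\<in>?I. contracting_similarity (\<psi> i)"
    and invL: "invariant_compact N \<psi> L" and scK: "self_conformal_set \<Omega> N \<phi> K"
    and V: "open V" "L \<subseteq> V" and V': "open V'" "K \<subseteq> V'" "V' \<subseteq> U"
    and bij: "bij_betw f V V'" and hol: "f holomorphic_on V" "inv_into V f holomorphic_on V'"
    and comm: "\<forall>i\<in>?I. \<forall>z\<in>V'. \<psi> i (inv_into V f z) \<in> V \<longrightarrow> \<phi> i z = f (\<psi> i (inv_into V f z))"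
    using assms(6) unfolding conjugate_to_linear_def by (elim exE conjE) (rule that)
  define g where "g = inv_into V f"
  have fV: "f ` V = V'" and inj: "inj_on f V" using bij by (auto simp: bij_betw_def)
  have gf: "g (f x) = x" if "x \<in> V" for x using inj that by (simp add: g_def)
  have comm': "\<phi> i (f x) = f (\<psi> i x)" if "i \<in> ?I" "x \<in> V" "\<psi> i x \<in> V" for i x
  proof -
    have "f x \<in> V'" using fV that(2) by blast
    then show ?thesis using comm that gf[OF that(2)] by (simp add: g_def)
  qed
  have L: "compact L" "L \<noteq> {}" "L = (\<Union>i\<in>?I. \<psi> i ` L)" using invL by (auto simp: invariant_compact_def)
  have K: "compact K" "K \<noteq> {}" "K = (\<Union>i\<in>?I. \<phi> i ` K)" using scK by (auto simp: self_conformal_set_def invariant_compact_def)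
  have \<psi>L: "\<psi> i x \<in> L" if "i \<in> ?I" "x \<in> L" for i x using L(3) that by blast
  have KU: "K \<subseteq> U" using V' by blast
  have \<phi>K: "\<phi> i x \<in> K" if "i \<in> ?I" "x \<in> K" for i x using K(3) that by blast
  have fLU: "f ` L \<subseteq> U" using fV V V' by blast
  have cfL: "compact (f ` L)"
    by (rule compact_continuous_image[OF holomorphic_on_imp_continuous_on[OF holomorphic_on_subset[OF hol(1) V(2)]] L(1)])
  have \<phi>fL: "\<phi> i (f x) = f (\<psi> i x)" if "i \<in> ?I" "x \<in> L" for i x
    by (rule comm'[OF that(1) subsetD[OF V(2) that(2)] subsetD[OF V(2) \<psi>L[OF that]]])
  \<comment> \<open>Both sets are compact and invariant under the contractions \<phi>, so each
    contains the other.\<close>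
  have fL: "f ` L = K"
  proof
    show "f ` L \<subseteq> K"
    proof (rule contraction_invariant_subset[OF contr \<rho>1 compact_imp_closed[OF K(1)] K(2) KU \<phi>K cfL fLU])
      show "f ` L \<subseteq> (\<Union>i\<in>?I. \<phi> i ` f ` L)"
      proof (rule image_subsetI)
        fix x assume "x \<in> L"
        then have "x \<in> (\<Union>i\<in>?I. \<psi> i ` L)" using L(3) by simp
        then obtain i y where y: "i \<in> ?I" "y \<in> L" "x = \<psi> i y" by (elim UN_E imageE) (rule that)
        then have "f x = \<phi> i (f y)" using \<phi>fL by simp
        then show "f x \<in> (\<Union>i\<in>?I. \<phi> i ` f ` L)" using y by blast
      qed
    qed
    show "K \<subseteq> f ` L"
    proof (rule contraction_invariant_subset[OF contr \<rho>1 compact_imp_closed[OF cfL] _ fLU _ K(1) KU])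
      show "f ` L \<noteq> {}" using L(2) by simp
      show "\<phi> i x \<in> f ` L" if "i \<in> ?I" "x \<in> f ` L" for i x
        using that \<phi>fL \<psi>L by auto
    qed (use K(3) in simp_all)
  qed
  have "\<exists>a t. a \<noteq> 0 \<and> cmod a < 1 \<and> (\<forall>x. \<psi> i x = a * x + t)" if i: "i \<in> ?I" for i
  proof -
    obtain x0 where x0: "x0 \<in> L" using L(2) by blast
    \<comment> \<open>On this open set the conjugacy reads
      \<open>\<psi> i = g \<circ> \<phi> i \<circ> f\<close>, so the similarity is complex
      differentiable at \<open>x0\<close>.\<close>
    define W where "W = V \<inter> \<psi> i -` V"
    have c\<psi>: "continuous_on UNIV (\<psi> i)" by (rule contracting_similarity_continuous) (use \<psi> i in blast)
    have W: "open W" unfolding W_def using V(1) c\<psi> by (intro open_Int open_vimage)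
    have x0W: "x0 \<in> W" using x0 \<psi>L[OF i x0] V(2) by (auto simp: W_def)
    have x0V: "x0 \<in> V" using x0 V(2) by blast
    have fx: "f x0 \<in> U" "\<phi> i (f x0) \<in> V'"
      using fLU x0 V' \<phi>K[OF i, of "f x0"] fL by auto
    have "(\<lambda>x. g (\<phi> i (f x))) field_differentiable at x0"
    proof -
      have 1: "f field_differentiable at x0" by (rule holomorphic_on_imp_differentiable_at[OF hol(1) V(1) x0V])
      have 2: "\<phi> i field_differentiable at (f x0)" by (rule holomorphic_on_imp_differentiable_at[OF \<phi>(2)[OF i] U(1) fx(1)])
      have 3: "g field_differentiable at ((\<phi> i \<circ> f) x0)"
        unfolding g_def o_def by (rule holomorphic_on_imp_differentiable_at[OF hol(2) V'(1) fx(2)])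
      have "g \<circ> (\<phi> i \<circ> f) field_differentiable at x0"
        by (rule field_differentiable_compose[OF field_differentiable_compose[OF 1 2] 3])
      then show ?thesis by (simp add: o_def)
    qed
    then obtain d where "((\<lambda>x. g (\<phi> i (f x))) has_field_derivative d) (at x0)" unfolding field_differentiable_def by blast
    then have "(\<psi> i has_field_derivative d) (at x0)"
    proof (rule has_field_derivative_transform_within_open[OF _ W x0W])
      fix x assume "x \<in> W"
      then have "x \<in> V" "\<psi> i x \<in> V" by (auto simp: W_def)
      then show "g (\<phi> i (f x)) = \<psi> i x" using comm'[OF i] gf by simp
    qed
    then have "\<psi> i field_differentiable at x0" unfolding field_differentiable_def by blast
    from contracting_similarity_complex_linear[OF _ this] show ?thesis using \<psi> i by metis
  qed
  then obtain a t where at: "\<And>i. i \<in> ?I \<Longrightarrow> a i \<noteq> 0" "\<And>i. i \<in> ?I \<Longrightarrow> cmod (a i) < 1" "\<And>i x. i \<in> ?I \<Longrightarrow> \<psi> i x = a i * x + t i"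
    by metis
  define \<rho>2 where "\<rho>2 = Max ((\<lambda>i. cmod (a i)) ` ?I)"
  have \<rho>2: "\<And>i. i \<in> ?I \<Longrightarrow> cmod (a i) \<le> \<rho>2" "\<rho>2 < 1" using I0 at(2) by (auto simp: \<rho>2_def)
  have \<rho>20: "0 \<le> \<rho>2" using \<rho>2(1) I0 by (meson all_not_in_conv norm_ge_zero order_trans)
  interpret LC: linear_conjugacy U V ?I \<phi> \<rho>2 a t f g L
  proof
    show "L = (\<Union>i\<in>?I. (\<lambda>x. a i * x + t i) ` L)"
    proof -
      have "(\<Union>i\<in>?I. (\<lambda>x. a i * x + t i) ` L) = (\<Union>i\<in>?I. \<psi> i ` L)"
        by (intro SUP_cong image_cong refl) (simp add: at(3))
      then show ?thesis using L(3) by simp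
    qed
    show "\<phi> i (f x) = f (a i * x + t i)" if "i \<in> ?I" "x \<in> V" "a i * x + t i \<in> V" for i x
      using comm'[OF that(1,2)] that at(3) by simp
    show "f ` V \<subseteq> U" using fV V' by simp
    show "g holomorphic_on f ` V" using hol(2) by (simp add: fV g_def)
  qed (use U I0 \<phi> \<phi>U at \<rho>2 \<rho>20 V hol inj gf L in auto)
  have prob: "prob_space \<nu>" and sets: "sets \<nu> = sets borel"
    and inv: "\<And>B. B \<in> sets borel \<Longrightarrow> measure \<nu> B = (\<Sum>i=1..N. p i * measure \<nu> (\<phi> i -` B \<inter> U))"
    using assms(3) unfolding self_conformal_measure_def by auto
  interpret \<nu>: prob_space \<nu> by (rule prob)
  have sp: "space \<nu> = UNIV" using sets_eq_imp_space_eq[OF sets] by simp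
  have AE_K: "AE x in \<nu>. x \<in> K"
    by (rule self_conformal_measure_AE_in_set[OF U(1,3) U0 \<phi>(2) \<phi>U contr \<rho>1 K(1,2) KU \<phi>K assms(2,3)])
  have bK: "K \<in> sets borel" and bL: "L \<in> sets borel" using K(1) L(1) by (auto intro: borel_compact)
  \<comment> \<open>Cutting off outside \<open>K\<close> and \<open>L\<close> gives Borel functions
    on the whole plane; as \<nu> and \<mu> are carried by these sets, nothing changes almost
    everywhere.\<close>
  define g' where "g' x = indicator K x *\<^sub>R g x" for x
  define f' where "f' x = indicator L x *\<^sub>R f x" for x
  define h' where "h' x = indicator L x *\<^sub>R deriv f x" for x
  have cont: "continuous_on K g" "continuous_on L f" "continuous_on L (deriv f)"
    using hol V V' by (auto simp: g_def intro!: holomorphic_on_imp_continuous_on intro: holomorphic_on_subset holomorphic_deriv)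
  have g'm: "g' \<in> borel_measurable borel" and f'm: "f' \<in> borel_measurable borel" and h'm: "h' \<in> borel_measurable borel"
    unfolding g'_def[abs_def] f'_def[abs_def] h'_def[abs_def]
    by (intro borel_measurable_continuous_on_indicator bK bL cont)+
  have g'\<nu>: "g' \<in> measurable \<nu> borel" using g'm by (simp add: measurable_cong_sets[OF sets refl])
  define \<mu> where "\<mu> = distr \<nu> borel g'"
  have g'f: "g' (f x) = x" if "x \<in> L" for x
    using that fL gf V(2) by (auto simp: g'_def indicator_def)
  have KE: "\<exists>l\<in>L. x = f l" if "x \<in> K" for x using that fL by blast
  have \<mu>_meas: "measure \<mu> B = measure \<nu> (g' -` B)" if "B \<in> sets borel" for B
    using measure_distr[OF g'\<nu> that] by (simp add: \<mu>_def sp)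
  interpret \<mu>: self_similar_measure \<mu> ?I p a t L
  proof (intro self_similar_measure.intro self_similar_measure_axioms.intro)
    show "prob_space \<mu>" unfolding \<mu>_def by (rule \<nu>.prob_space_distr[OF g'\<nu>])
    show "sets \<mu> = sets borel" by (simp add: \<mu>_def)
    show "AE x in \<mu>. x \<in> L"
      unfolding \<mu>_def
    proof (subst AE_distr_iff[OF g'\<nu>])
      show "{x \<in> space borel. x \<in> L} \<in> sets borel" using bL by simp
      show "AE x in \<nu>. g' x \<in> L"
        by (rule AE_mp[OF AE_K], rule AE_I2, rule impI) (use KE g'f in force)
    qed
    show "measure \<mu> B = (\<Sum>i=1..N. p i * measure \<mu> {x. a i * x + t i \<in> B})" if B: "B \<in> sets borel" for B
    proof -
      have gB: "g' -` B \<in> sets borel" using measurable_sets[OF g'm B] by simp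
      have "measure \<mu> B = (\<Sum>i=1..N. p i * measure \<nu> (\<phi> i -` (g' -` B) \<inter> U))"
        by (simp add: \<mu>_meas[OF B] inv[OF gB])
      also have "\<dots> = (\<Sum>i=1..N. p i * measure \<mu> {x. a i * x + t i \<in> B})"
      proof (rule sum.cong[OF refl])
        fix i assume i: "i \<in> ?I"
        have aB: "{x. a i * x + t i \<in> B} \<in> sets borel"
        proof -
          have "(\<lambda>x. a i * x + t i) \<in> borel_measurable borel" by measurable
          from measurable_sets[OF this B] show ?thesis by (simp add: vimage_def)
        qed
        have "measure \<nu> (\<phi> i -` (g' -` B) \<inter> U) = measure \<nu> (g' -` {x. a i * x + t i \<in> B})"
        proof (rule \<nu>.finite_measure_eq_AE)
          \<comment> \<open>The two preimages are compared on \<open>K\<close>, which has full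
            measure: there \<open>x = f l\<close>, and the conjugacy translates
            \<open>\<phi> i\<close> into \<open>a i * l + t i\<close>.\<close>
          show "AE x in \<nu>. (x \<in> \<phi> i -` (g' -` B) \<inter> U) = (x \<in> g' -` {x. a i * x + t i \<in> B})"
          proof (rule AE_mp[OF AE_K], rule AE_I2, rule impI)
            fix x assume x: "x \<in> K"
            then obtain l where l: "l \<in> L" "x = f l" using KE by blast
            have "g' (\<phi> i x) = a i * g' x + t i"
              using \<phi>fL[OF i l(1)] g'f[OF l(1)] g'f[OF \<psi>L[OF i l(1)]] at(3)[OF i] by (simp add: l(2))
            then show "(x \<in> \<phi> i -` (g' -` B) \<inter> U) = (x \<in> g' -` {x. a i * x + t i \<in> B})"
              using x KU by auto
          qed
          show "g' -` {x. a i * x + t i \<in> B} \<in> sets \<nu>"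
            using measurable_sets[OF g'm aB] by (simp add: sets)
          show "\<phi> i -` (g' -` B) \<inter> U \<in> sets \<nu>"
            using holomorphic_vimage_borel[OF U(1) \<phi>(2)[OF i] gB] by (simp add: sets)
        qed
        then show "p i * measure \<nu> (\<phi> i -` (g' -` B) \<inter> U) = p i * measure \<mu> {x. a i * x + t i \<in> B}"
          by (simp add: \<mu>_meas[OF aB])
      qed
      finally show ?thesis .
    qed
  qed (use ppos p1 at L \<psi>L in auto)
  have distinct: "\<exists>i\<in>?I. \<exists>j\<in>?I. LC.fixpt i \<noteq> LC.fixpt j" by (rule LC.distinct_fixpts[OF nofix])
  then obtain i j where ij: "i \<in> ?I" "j \<in> ?I" "LC.fixpt i \<noteq> LC.fixpt j" by (elim bexE) (rule that)
  obtain C0 s0 where fr: "0 \<le> C0" "0 < s0" "\<forall>c r. 0 < r \<longrightarrow> measure \<mu> {x. cmod (x - c) \<le> r} \<le> C0 * r powr s0"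
    using \<mu>.frostman[OF ij(1) LC.fixpt[OF ij(1)] ij(2) LC.fixpt[OF ij(2)] ij(3)] by (elim exE conjE) (rule that)
  have "\<exists>C s. 0 \<le> C \<and> 0 < s \<and> (\<forall>c r. 0 < r \<longrightarrow> measure \<mu> {x \<in> L. cmod (deriv f x - c) \<le> r} \<le> C * r powr s)"
  proof (rule frostman_holomorphic[OF \<mu>.prob_space_axioms \<mu>.sets_\<mu> L(1) V(2) V(1) _ _ fr(3)[rule_format] fr(1,2)])
    show "deriv f holomorphic_on V" using hol(1) V(1) by (rule holomorphic_deriv)
    show "\<not> deriv f constant_on ball \<xi> \<epsilon>" if "\<xi> \<in> L" "0 < \<epsilon>" "ball \<xi> \<epsilon> \<subseteq> V" for \<xi> \<epsilon>
      by (rule LC.deriv_not_constant[OF _ that]) (use assms(5) in \<open>simp add: nonlinear_IFS_def\<close>)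
  qed
  then obtain C1 s1 where fr1: "0 \<le> C1" "0 < s1" "\<forall>c r. 0 < r \<longrightarrow> measure \<mu> {x \<in> L. cmod (deriv f x - c) \<le> r} \<le> C1 * r powr s1"
    by (elim exE conjE) (rule that)
  have fr_h': "measure \<mu> {x. cmod (h' x - c) \<le> r} \<le> C1 * r powr s1" if "0 < r" for c r
  proof -
    have m: "{x. cmod (h' x - c) \<le> r} \<in> sets borel"
    proof -
      have "{x \<in> space borel. cmod (h' x - c) \<le> r} \<in> sets borel" using h'm by measurable
      then show ?thesis by simp
    qed
    have e: "{x \<in> L. cmod (deriv f x - c) \<le> r} = L \<inter> {x. cmod (h' x - c) \<le> r}" by (auto simp: h'_def)
    have "measure \<mu> {x. cmod (h' x - c) \<le> r} = measure \<mu> {x \<in> L. cmod (deriv f x - c) \<le> r}"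
    proof (rule \<mu>.finite_measure_eq_AE)
      show "AE x in \<mu>. (x \<in> {x. cmod (h' x - c) \<le> r}) = (x \<in> {x \<in> L. cmod (deriv f x - c) \<le> r})"
        by (rule AE_mp[OF \<mu>.AE_L], rule AE_I2) (simp add: h'_def)
    qed (unfold e \<mu>.sets_\<mu>, use m bL in auto)
    then show ?thesis using fr1(3) that by simp
  qed
  obtain C where C: "0 \<le> C" "\<forall>x\<in>L. \<forall>y\<in>L. cmod (f y - f x - deriv f x * (y - x)) \<le> C * (cmod (y - x))\<^sup>2"
    using taylor_bound_compact[OF L(1) V(2) V(1) hol(1)] by (elim exE conjE) (rule that)
  obtain D where D: "\<forall>x\<in>L. cmod x \<le> D" using compact_imp_bounded[OF L(1)] unfolding bounded_iff by blast
  have "compact (deriv f ` L)" by (rule compact_continuous_image[OF cont(3) L(1)])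
  then have "\<exists>H. \<forall>y\<in>deriv f ` L. cmod y \<le> H" using compact_imp_bounded bounded_iff by metis
  then obtain H where H: "\<forall>x\<in>L. cmod (deriv f x) \<le> H" by auto
  have "\<exists>c>0. \<exists>s>0. \<forall>\<zeta>. \<zeta> \<noteq> 0 \<longrightarrow> cmod (\<integral>x. cis (2 * pi * Re (\<zeta> * f' x)) \<partial>\<mu>) \<le> c * cmod \<zeta> powr - s"
  proof (rule \<mu>.image_fourier_decay[OF f'm h'm _ C(1) _ fr_h' fr1(1,2) _ LC.fixpt distinct])
    show "cmod (f' y - f' x - h' x * (y - x)) \<le> C * (cmod (y - x))\<^sup>2" if "x \<in> L" "y \<in> L" for x y
      using C(2) that by (simp add: f'_def h'_def)
    show "cmod (y - x) \<le> 2 * D" if "x \<in> L" "y \<in> L" for x y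
      using norm_triangle_ineq4[of y x] bspec[OF D that(1)] bspec[OF D that(2)] by linarith
    show "cmod (h' x) \<le> \<bar>H\<bar>" for x
      using H by (auto simp: h'_def indicator_def intro: order_trans)
    show "(\<exists>i\<in>?I. Im (a i) \<noteq> 0) \<or> \<not> (\<exists>c u. \<forall>i\<in>?I. \<exists>x::real. LC.fixpt i = c + of_real x * u)"
      by (rule LC.fixpts_not_on_line[OF _ distinct]) (use assms(4) in \<open>simp only: curve_reducible_def not_False_eq_True\<close>)
  qed
  then obtain c s where cs: "0 < c" "0 < s" "\<forall>\<zeta>. \<zeta> \<noteq> 0 \<longrightarrow> cmod (\<integral>x. cis (2 * pi * Re (\<zeta> * f' x)) \<partial>\<mu>) \<le> c * cmod \<zeta> powr - s"
    by (elim exE conjE) (rule that)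
  \<comment> \<open>Since \<open>inner \<xi> x = Re (cnj \<xi> * x)\<close>, the sign convention of
    the transform leads to the frequency \<open>- cnj \<xi>\<close>, which has the same modulus as
    \<xi>.\<close>
  have ft: "fourier_transform \<nu> \<xi> = (\<integral>x. cis (2 * pi * Re (- cnj \<xi> * f' x)) \<partial>\<mu>)" for \<xi>
  proof -
    note [measurable] = \<mu>.cis_measurable f'm g'm
    note [measurable_cong] = sets
    have "(\<integral>x. cis (2 * pi * Re (- cnj \<xi> * f' x)) \<partial>\<mu>) = (\<integral>x. cis (2 * pi * Re (- cnj \<xi> * f' (g' x))) \<partial>\<nu>)"
      unfolding \<mu>_def by (rule integral_distr) measurable
    also have "\<dots> = (\<integral>x. exp (- 2 * complex_of_real pi * \<i> * complex_of_real (inner \<xi> x)) \<partial>\<nu>)"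
    proof (rule integral_cong_AE)
      show "AE x in \<nu>. cis (2 * pi * Re (- cnj \<xi> * f' (g' x))) = exp (- 2 * complex_of_real pi * \<i> * complex_of_real (inner \<xi> x))"
      proof (rule AE_mp[OF AE_K], rule AE_I2, rule impI)
        fix x assume "x \<in> K"
        then obtain l where l: "l \<in> L" "x = f l" using KE by blast
        then have "f' (g' x) = x" using g'f[OF l(1)] by (simp add: f'_def)
        moreover have "Re (- cnj \<xi> * x) = - inner \<xi> x" by (simp add: inner_complex_def)
        ultimately show "cis (2 * pi * Re (- cnj \<xi> * f' (g' x))) = exp (- 2 * complex_of_real pi * \<i> * complex_of_real (inner \<xi> x))"
          by (simp add: cis_conv_exp mult_ac)
      qed
    qed measurable
    finally show ?thesis by (simp add: fourier_transform_def)
  qed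
  show ?thesis
    unfolding polynomial_Fourier_decay_def
  proof (rule exI[of _ s], rule conjI[OF cs(2)], rule exI[of _ c], rule conjI[OF cs(1)], intro allI impI)
    fix \<xi> :: complex assume "\<xi> \<noteq> 0"
    then have "- cnj \<xi> \<noteq> 0" by simp
    from cs(3)[rule_format, OF this] show "cmod (fourier_transform \<nu> \<xi>) \<le> c * cmod \<xi> powr - s"
      by (simp only: ft norm_minus_cancel complex_mod_cnj)
  qed
qed

end
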